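(* Let $N$ be a compact, connected $n$-dimensional manifold with boundary, where $n\geq 2$. Then $N$ admits a boundary special generic map into $\mathbb{R}$ if and only if $N$ is diffeomorphic to the closed disk $D^n$.
   Context: All manifolds and maps are smooth ($C^\infty$); "manifold with boundary" means the boundary is non-empty. Let $N$ be a compact, connected $n$-dimensional manifold with boundary and $F\colon N\to\mathbb{R}^k$ a map with $n>k\ge 1$. A point $p\in\partial N$ is a boundary definite fold point of $F$ if there are local coordinates $(x_1,\dots,x_n)$ of $N$ around $p$, with $x_n>0$ and $x_n=0$ corresponding to $\operatorname{Int} N$ and $\partial N$ respectively, and local coordinates $(y_1,\dots,y_k)$ of $\mathbb{R}^k$ around $F(p)$, in which $F$ has the form $(x_1,\dots,x_n)\mapsto (x_1,\dots,x_{k-1},\sum_{i=k}^{n-1}x_i^2+x_n)$. A boundary special generic map is a submersion $F\colon N\to\mathbb{R}^k$ (i.e. $\operatorname{rank} dF_p=k$ at every $p\in N$, boundary points included) such that every singular point of $F|_{\partial N}$ (a point $p\in\partial N$ where $\operatorname{rank} d(F|_{\partial N})_p<k$) is a boundary definite fold point of $F$. *)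

theory Defs
  imports "HOL-Analysis.Analysis"
begin

text \<open>
  \<open>n\<close>-space is modelled as \<open>'m \<times> real\<close> with \<open>'m :: euclidean_space\<close>, so that
  \<open>n = DIM('m) + 1\<close> and \<open>x\<^sub>n\<close> is the second component. As \<open>DIM('m)\<close> ranges over all positive
  numbers, \<open>n\<close> ranges over all numbers \<open>\<ge> 2\<close>. The norm on \<open>'m \<times> real\<close> is the Euclidean one.
  The target \<open>k\<close>-space is a type \<open>'e :: euclidean_space\<close>, \<open>k = DIM('e)\<close>; everything below is meant
  for \<open>k < n\<close>.
\<close>

subsection \<open>Smooth maps on subsets of Euclidean spaces\<close>

text \<open>\<open>Ck_on k f W\<close>: the map \<open>f\<close> is \<open>k\<close> times continuously differentiable on the open set \<open>W\<close>.\<close>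

fun Ck_on :: "nat \<Rightarrow> ('a::real_normed_vector \<Rightarrow> 'b::real_normed_vector) \<Rightarrow> 'a set \<Rightarrow> bool" where
  "Ck_on 0 f W \<longleftrightarrow> continuous_on W f"
| "Ck_on (Suc k) f W \<longleftrightarrow> (\<forall>x\<in>W. f differentiable at x) \<and>
     (\<forall>v. Ck_on k (\<lambda>x. frechet_derivative f (at x) v) W)"

text \<open>On a set that need not be open, smoothness means that smooth local extensions exist.\<close>

definition smooth_on :: "'a::real_normed_vector set \<Rightarrow> ('a \<Rightarrow> 'b::real_normed_vector) \<Rightarrow> bool" where
  "smooth_on S f \<longleftrightarrow> (\<forall>x\<in>S. \<exists>W g. open W \<and> x \<in> W \<and> (\<forall>k. Ck_on k g W) \<and> (\<forall>y\<in>S \<inter> W. g y = f y))"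

subsection \<open>Smooth manifolds with (possibly empty) boundary\<close>

definition half_space :: "('m::euclidean_space \<times> real) set" where
  "half_space = {x. 0 \<le> snd x}"

text \<open>Only the values of \<open>\<phi>\<close> on \<open>U\<close> matter in a chart \<open>(U, \<phi>)\<close>.\<close>

type_synonym ('a, 'm) chart = "'a set \<times> ('a \<Rightarrow> 'm \<times> real)"

record ('a, 'm) manifold =
  mtop :: "'a topology"
  atlas :: "('a, 'm) chart set"

definition is_chart :: "'a topology \<Rightarrow> ('a, 'm::euclidean_space) chart \<Rightarrow> bool" where
  "is_chart T = (\<lambda>(U, \<phi>). openin T U \<and> openin (top_of_set half_space) (\<phi> ` U) \<and>
     homeomorphic_map (subtopology T U) (top_of_set (\<phi> ` U)) \<phi>)"

definition compatible ::
    "('a, 'm::euclidean_space) chart \<Rightarrow> ('a, 'm) chart \<Rightarrow> bool" where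
  "compatible = (\<lambda>(U, \<phi>) (V, \<psi>).
     smooth_on (\<phi> ` (U \<inter> V)) (\<psi> \<circ> inv_into U \<phi>) \<and>
     smooth_on (\<psi> ` (U \<inter> V)) (\<phi> \<circ> inv_into V \<psi>))"

definition smooth_manifold :: "('a, 'm::euclidean_space) manifold \<Rightarrow> bool" where
  "smooth_manifold N \<longleftrightarrow>
     Hausdorff_space (mtop N) \<and> second_countable (mtop N) \<and>
     (\<forall>c\<in>atlas N. is_chart (mtop N) c) \<and>
     (\<Union>(U, \<phi>)\<in>atlas N. U) = topspace (mtop N) \<and>
     (\<forall>c\<in>atlas N. \<forall>d\<in>atlas N. compatible c d)"

text \<open>The maximal atlas, i.e. all local coordinate systems of the manifold.\<close>

definition smooth_charts :: "('a, 'm::euclidean_space) manifold \<Rightarrow> ('a, 'm) chart set" where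
  "smooth_charts N = {c. is_chart (mtop N) c \<and> (\<forall>d\<in>atlas N. compatible c d)}"

definition manifold_boundary :: "('a, 'm::euclidean_space) manifold \<Rightarrow> 'a set" where
  "manifold_boundary N = {p. \<exists>(U, \<phi>)\<in>atlas N. p \<in> U \<and> snd (\<phi> p) = 0}"

definition manifold_with_boundary :: "('a, 'm::euclidean_space) manifold \<Rightarrow> bool" where
  "manifold_with_boundary N \<longleftrightarrow> smooth_manifold N \<and> manifold_boundary N \<noteq> {}"

definition smooth_map ::
    "('a, 'm::euclidean_space) manifold \<Rightarrow> ('b, 'l::euclidean_space) manifold \<Rightarrow> ('a \<Rightarrow> 'b) \<Rightarrow> bool" where
  "smooth_map M N f \<longleftrightarrow> continuous_map (mtop M) (mtop N) f \<and>
     (\<forall>(U, \<phi>)\<in>atlas M. \<forall>(V, \<psi>)\<in>atlas N.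
        smooth_on (\<phi> ` (U \<inter> f -` V)) (\<psi> \<circ> f \<circ> inv_into U \<phi>))"

definition diffeomorphic ::
    "('a, 'm::euclidean_space) manifold \<Rightarrow> ('b, 'l::euclidean_space) manifold \<Rightarrow> bool" where
  "diffeomorphic M N \<longleftrightarrow> (\<exists>f g. smooth_map M N f \<and> smooth_map N M g \<and>
     (\<forall>p\<in>topspace (mtop M). g (f p) = p) \<and> (\<forall>q\<in>topspace (mtop N). f (g q) = q))"

text \<open>
  The closed unit ball with its standard smooth structure: the charts are all diffeomorphisms, in the
  sense of \<^const>\<open>smooth_on\<close>, between open subsets of the ball and open subsets of the half space.
\<close>

definition closed_disk :: "('m::euclidean_space \<times> real, 'm) manifold" where
  "closed_disk = \<lparr>mtop = top_of_set (cball 0 1),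
     atlas = {(U, \<phi>). is_chart (top_of_set (cball 0 1)) (U, \<phi>) \<and>
        smooth_on U \<phi> \<and> smooth_on (\<phi> ` U) (inv_into U \<phi>)}\<rparr>"

subsection \<open>Boundary special generic maps\<close>

definition smooth_fun ::
    "('a, 'm::euclidean_space) manifold \<Rightarrow> ('a \<Rightarrow> 'e::euclidean_space) \<Rightarrow> bool" where
  "smooth_fun N F \<longleftrightarrow> (\<forall>(U, \<phi>)\<in>atlas N. smooth_on (\<phi> ` U) (F \<circ> inv_into U \<phi>))"

text \<open>
  The derivative within \<open>\<phi> ` U\<close> is unique also at boundary points, since \<open>\<phi> ` U\<close> is relatively open
  in the half space. The rank does not depend on the chart.
\<close>

definition submersion ::
    "('a, 'm::euclidean_space) manifold \<Rightarrow> ('a \<Rightarrow> 'e::euclidean_space) \<Rightarrow> bool" where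
  "submersion N F \<longleftrightarrow> smooth_fun N F \<and>
     (\<forall>(U, \<phi>)\<in>atlas N. \<forall>p\<in>U.
        dim (range (frechet_derivative (F \<circ> inv_into U \<phi>) (at (\<phi> p) within \<phi> ` U))) = DIM('e))"

text \<open>
  A chart \<open>(U, \<phi>)\<close> of the manifold restricts to the chart \<open>fst \<circ> \<phi>\<close> of its boundary, in which
  \<open>F\<close> restricted to the boundary is \<open>y \<mapsto> F (\<phi>\<inverse> (y, 0))\<close>.
\<close>

definition boundary_singular_point ::
    "('a, 'm::euclidean_space) manifold \<Rightarrow> ('a \<Rightarrow> 'e::euclidean_space) \<Rightarrow> 'a \<Rightarrow> bool" where
  "boundary_singular_point N F p \<longleftrightarrow> p \<in> manifold_boundary N \<and>
     (\<exists>(U, \<phi>)\<in>atlas N. p \<in> U \<and>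
        dim (range (frechet_derivative (\<lambda>y. F (inv_into U \<phi> (y, 0))) (at (fst (\<phi> p))))) < DIM('e))"

definition local_coordinates :: "'e::euclidean_space set \<Rightarrow> ('e \<Rightarrow> 'e) \<Rightarrow> bool" where
  "local_coordinates W \<psi> \<longleftrightarrow> open W \<and> open (\<psi> ` W) \<and> inj_on \<psi> W \<and>
     smooth_on W \<psi> \<and> smooth_on (\<psi> ` W) (inv_into W \<psi>)"

text \<open>
  The bijections \<open>b\<close> and \<open>c\<close> number the coordinates \<open>x\<^sub>1, \<dots>, x\<^sub>n\<^sub>-\<^sub>1\<close> of \<open>'m\<close> and
  \<open>y\<^sub>1, \<dots>, y\<^sub>k\<close> of \<open>'e\<close>; the choice of numbering is immaterial since coordinates may be permuted.
  Local coordinates around \<open>p\<close> are centred at \<open>p\<close>.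
\<close>

definition boundary_definite_fold_point ::
    "('a, 'm::euclidean_space) manifold \<Rightarrow> ('a \<Rightarrow> 'e::euclidean_space) \<Rightarrow> 'a \<Rightarrow> bool" where
  "boundary_definite_fold_point N F p \<longleftrightarrow> p \<in> manifold_boundary N \<and>
     (\<exists>U \<phi> W \<psi> b c.
        (U, \<phi>) \<in> smooth_charts N \<and> p \<in> U \<and> \<phi> p = 0 \<and>
        local_coordinates W \<psi> \<and> F ` U \<subseteq> W \<and>
        bij_betw b {1..DIM('m)} (Basis :: 'm set) \<and> bij_betw c {1..DIM('e)} (Basis :: 'e set) \<and>
        (\<forall>q\<in>U.
           (\<forall>j\<in>{1..<DIM('e)}. \<psi> (F q) \<bullet> c j = fst (\<phi> q) \<bullet> b j) \<and>
           \<psi> (F q) \<bullet> c DIM('e) = (\<Sum>i=DIM('e)..DIM('m). (fst (\<phi> q) \<bullet> b i)\<^sup>2) + snd (\<phi> q)))"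

definition boundary_special_generic ::
    "('a, 'm::euclidean_space) manifold \<Rightarrow> ('a \<Rightarrow> 'e::euclidean_space) \<Rightarrow> bool" where
  "boundary_special_generic N F \<longleftrightarrow> submersion N F \<and>
     (\<forall>p. boundary_singular_point N F p \<longrightarrow> boundary_definite_fold_point N F p)"

end

theory Submission
  imports Defs
begin

text \<open>
  The height function on the disk is boundary special generic; near the poles, \<open>1 - x\<^sub>n\<^sup>2\<close> is the fold
  form \<open>|x'|\<^sup>2 + y\<close> in the coordinates \<open>(x', y)\<close> with \<open>y = 1 - |x|\<^sup>2\<close>.

  Conversely, call a function increasing at a point if some tangent vector increases it, required to point
  outwards at boundary points. A boundary special generic map \<open>F\<close> has this property except at finitely many
  points, the folds where it has a local minimum. Modifying \<open>F\<close> near these moves each local minimum to an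
  interior point, where the function becomes \<open>|x|\<^sup>2\<close> up to a constant that is the same for all of them.
  After subtracting a constant to make the function negative, it is damped by a boundary defining
  function. The result \<open>f\<close> vanishes exactly on the boundary, is negative inside and still has no
  further critical points. Hence all sublevel sets between the boundary value and the minimal value are
  diffeomorphic to \<open>N\<close>; the low ones are disjoint unions of round balls in charts, and by connectedness there is
  only one ball.

  The diffeomorphisms between the sublevel sets are not obtained from a flow but as finite compositions of pushes
  supported in single charts, one for each function of a partition of unity. A push moves every point
  along a fixed direction of its chart, so that it is given by a scalar equation. A map into or between subsets
  of \<open>N\<close> is treated as smooth if composing with it preserves smooth functions.
\<close>

section \<open>Smooth maps between normed spaces\<close>

text \<open>A boundary minimum of \<open>F\<close> cuts off half balls with corners, and nonconstant
  boundary values make sublevel sets meet the boundary in corners as well. Both are avoided by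
  turning \<open>N\<close> itself into a sublevel set \<open>f \<le> 0\<close> of a function whose
  critical points lie inside. A fold at which \<open>F\<close> has a local maximum needs no
  treatment: \<open>F\<close> increases outwards there, and lower sublevel sets just recede from it.
  The minima get one common value because a critical level met on the way down would stop the sweep.
  The pushes need no vector field. One direction per chart suffices, and lowering the level by
  \<open>\<tau>\<close> is split into adding \<open>\<tau>\<close> times one bump after the other.
  This only requires that being increasing survives small perturbations, which compactness makes
  uniform. On a set that is not open, smoothness and derivatives are those of local extensions; most
  proofs therefore carry an extension along with the function. For the converse, a boundary point is
  singular for the height function exactly where the tangent space of the sphere is horizontal, that
  is at a pole.\<close>

lemma frechet_derivativeI: "(f has_derivative D) (at x) \<Longrightarrow> frechet_derivative f (at x) = D"
  by (metis frechet_derivative_at)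

section \<open>Closure properties of k times continuously differentiable maps\<close>

lemma Ck_on_cong:
  assumes "open W" "\<And>x. x \<in> W \<Longrightarrow> f x = g x"
  shows "Ck_on k f W \<longleftrightarrow> Ck_on k g W"
proof -
  have *: "Ck_on k g W" if "Ck_on k f W" "\<And>x. x \<in> W \<Longrightarrow> f x = g x" for f g :: "'a \<Rightarrow> 'b"
    using that
  proof (induction k arbitrary: f g)
    case 0
    then show ?case using continuous_on_cong by (metis Ck_on.simps(1))
  next
    case (Suc k)
    have d: "(g has_derivative frechet_derivative f (at x)) (at x)" if "x \<in> W" for x
      using Suc.prems that has_derivative_transform_within_open[OF _ \<open>open W\<close> that]
      by (metis Ck_on.simps(2) frechet_derivative_works)
    then have e: "frechet_derivative g (at x) = frechet_derivative f (at x)" if "x \<in> W" for x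
      using frechet_derivativeI that by blast
    have "Ck_on k (\<lambda>x. frechet_derivative g (at x) v) W" for v
      by (rule Suc.IH[of "\<lambda>x. frechet_derivative f (at x) v"]) (use Suc.prems e in auto)
    then show ?case using d unfolding Ck_on.simps differentiable_def by blast
  qed
  show ?thesis using *[of f g] *[of g f] assms(2) by auto
qed

text \<open>Lets an induction on the order use a derivative \<open>D\<close> in closed form, so that
  \<open>frechet_derivative\<close> of a compound expression never has to be computed.\<close>

lemma Ck_on_SucI:
  assumes "open W" "\<And>x. x \<in> W \<Longrightarrow> (f has_derivative D x) (at x)" "\<And>v. Ck_on k (\<lambda>x. D x v) W"
  shows "Ck_on (Suc k) f W"
proof -
  have "Ck_on k (\<lambda>x. frechet_derivative f (at x) v) W" for v
    by (subst Ck_on_cong[of W _ "\<lambda>x. D x v"]) (use assms frechet_derivativeI[OF assms(2)] in auto)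
  then show ?thesis using assms(2) unfolding Ck_on.simps differentiable_def by blast
qed

lemma Ck_on_SucD:
  assumes "Ck_on (Suc k) f W"
  shows "x \<in> W \<Longrightarrow> (f has_derivative frechet_derivative f (at x)) (at x)"
    and "Ck_on k (\<lambda>x. frechet_derivative f (at x) v) W"
  using assms by (auto simp: frechet_derivative_works[symmetric])

lemma Ck_on_Suc_imp: "Ck_on (Suc k) f W \<Longrightarrow> Ck_on k f W"
proof (induction k arbitrary: f)
  case 0
  then show ?case
    by (auto intro!: continuous_at_imp_continuous_on differentiable_imp_continuous_within)
next
  case (Suc k)
  then show ?case by (metis Ck_on.simps(2))
qed

lemma Ck_on_subset: "Ck_on k f W \<Longrightarrow> V \<subseteq> W \<Longrightarrow> Ck_on k f V"
  by (induction k arbitrary: f) (auto intro: continuous_on_subset)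

lemma Ck_on_const: "Ck_on k (\<lambda>x. c) W"
  by (induction k arbitrary: c) auto

lemma Ck_on_bounded_linear:
  assumes "bounded_linear L" "open W" "Ck_on k f W"
  shows "Ck_on k (\<lambda>x. L (f x)) W"
  using assms(3)
proof (induction k arbitrary: f)
  case 0
  then show ?case using assms(1) by (auto intro: bounded_linear.continuous_on)
next
  case (Suc k)
  show ?case
    by (intro Ck_on_SucI[where D="\<lambda>x v. L (frechet_derivative f (at x) v)"] Suc.IH
        Ck_on_SucD[OF Suc.prems] bounded_linear.has_derivative[OF assms(1)] assms(2))
qed

lemma Ck_on_add:
  assumes "open W" "Ck_on k f W" "Ck_on k g W"
  shows "Ck_on k (\<lambda>x. f x + g x) W"
  using assms(2,3)
proof (induction k arbitrary: f g)
  case 0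
  then show ?case by (auto intro: continuous_on_add)
next
  case (Suc k)
  show ?case
    by (intro Ck_on_SucI[where D="\<lambda>x v. frechet_derivative f (at x) v + frechet_derivative g (at x) v"]
         Suc.IH has_derivative_add Ck_on_SucD[OF Suc.prems(1)] Ck_on_SucD[OF Suc.prems(2)] assms(1))
qed

lemma Ck_on_sum:
  assumes "open W" "\<And>i. i \<in> I \<Longrightarrow> Ck_on k (f i) W"
  shows "Ck_on k (\<lambda>x. \<Sum>i\<in>I. f i x) W"
  using assms(2) by (induction I rule: infinite_finite_induct) (auto intro: Ck_on_const Ck_on_add assms(1))

lemma Ck_on_bounded_bilinear:
  assumes "bounded_bilinear B" "open W" "Ck_on k f W" "Ck_on k g W"
  shows "Ck_on k (\<lambda>x. B (f x) (g x)) W"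
  using assms(3,4)
proof (induction k arbitrary: f g)
  case 0
  then show ?case using assms(1) by (auto intro: bounded_bilinear.continuous_on)
next
  case (Suc k)
  show ?case
    by (intro Ck_on_SucI[where D="\<lambda>x v. B (f x) (frechet_derivative g (at x) v) + B (frechet_derivative f (at x) v) (g x)"]
         bounded_bilinear.FDERIV[OF assms(1)] Suc.IH Ck_on_add assms(2)
         Ck_on_SucD[OF Suc.prems(1)] Ck_on_SucD[OF Suc.prems(2)] Suc.prems[THEN Ck_on_Suc_imp])
qed

text \<open>\<open>Ck_on\<close> differentiates along fixed vectors, whereas the chain rule applies
  the derivative of \<open>g\<close> to the moving vector supplied by the derivative of
  \<open>f\<close>. Expanding that vector in the basis of the intermediate space leaves a finite sum
  of products, to which the induction hypothesis applies; this is why the intermediate space is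
  Euclidean.\<close>

lemma Ck_on_compose:
  fixes f :: "'a::real_normed_vector \<Rightarrow> 'b::euclidean_space" and g :: "'b \<Rightarrow> 'c::real_normed_vector"
  assumes "open W" "open V" "f ` W \<subseteq> V" "Ck_on k f W" "Ck_on k g V"
  shows "Ck_on k (\<lambda>x. g (f x)) W"
  using assms(4,5)
proof (induction k arbitrary: g)
  case 0
  then show ?case using assms(3) continuous_on_compose2 by (metis Ck_on.simps(1))
next
  case (Suc k)
  let ?D = "\<lambda>x v. \<Sum>b\<in>Basis. (frechet_derivative f (at x) v \<bullet> b) *\<^sub>R frechet_derivative g (at (f x)) b"
  show ?case
  proof (rule Ck_on_SucI[where D="?D"])
    fix x assume x: "x \<in> W"
    have dg: "(g has_derivative frechet_derivative g (at (f x))) (at (f x))"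
      using Suc.prems(2) Ck_on_SucD(1) x assms(3) by blast
    have l: "linear (frechet_derivative g (at (f x)))"
      using dg has_derivative_linear by blast
    have rep: "frechet_derivative g (at (f x)) w = (\<Sum>b\<in>Basis. (w \<bullet> b) *\<^sub>R frechet_derivative g (at (f x)) b)" for w
      using linear_sum[OF l, of "\<lambda>b. (w \<bullet> b) *\<^sub>R b" Basis]
      by (simp add: euclidean_representation linear_scale[OF l])
    show "((\<lambda>x. g (f x)) has_derivative ?D x) (at x)"
      by (rule has_derivative_eq_rhs[OF has_derivative_compose[OF Ck_on_SucD(1)[OF Suc.prems(1) x] dg]])
         (rule ext, rule rep)
  next
    fix v
    have a: "Ck_on k (\<lambda>x. frechet_derivative f (at x) v \<bullet> b) W" for b
      by (rule Ck_on_bounded_linear[OF bounded_linear_inner_left assms(1) Ck_on_SucD(2)[OF Suc.prems(1)]])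
    have c: "Ck_on k (\<lambda>x. frechet_derivative g (at (f x)) b) W" for b
      by (rule Suc.IH[OF Ck_on_Suc_imp[OF Suc.prems(1)] Ck_on_SucD(2)[OF Suc.prems(2)]])
    show "Ck_on k (\<lambda>x. ?D x v) W"
      by (rule Ck_on_sum[OF assms(1)]) (rule Ck_on_bounded_bilinear[OF bounded_bilinear_scaleR assms(1) a c])
  qed (rule assms(1))
qed

lemma Ck_on_id: "open W \<Longrightarrow> Ck_on k (\<lambda>x. x) W"
  by (cases k) (auto intro!: Ck_on_SucI[where D="\<lambda>x v. v"] Ck_on_const continuous_on_id)

section \<open>Smooth maps on open sets\<close>

definition Cinf :: "'a::real_normed_vector set \<Rightarrow> ('a \<Rightarrow> 'b::real_normed_vector) \<Rightarrow> bool" where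
  "Cinf W f \<longleftrightarrow> open W \<and> (\<forall>k. Ck_on k f W)"

lemma Cinf_open: "Cinf W f \<Longrightarrow> open W"
  by (simp add: Cinf_def)

lemma smooth_on_Cinf:
  "smooth_on S f \<longleftrightarrow> (\<forall>x\<in>S. \<exists>W g. Cinf W g \<and> x \<in> W \<and> (\<forall>y\<in>S \<inter> W. g y = f y))"
  unfolding smooth_on_def Cinf_def by blast

lemma Cinf_subset: "Cinf W f \<Longrightarrow> open V \<Longrightarrow> V \<subseteq> W \<Longrightarrow> Cinf V f"
  unfolding Cinf_def using Ck_on_subset by blast

lemma Cinf_continuous_on: "Cinf W f \<Longrightarrow> continuous_on W f"
  unfolding Cinf_def by (metis Ck_on.simps(1))

lemma Cinf_has_derivative:
  "Cinf W f \<Longrightarrow> x \<in> W \<Longrightarrow> (f has_derivative frechet_derivative f (at x)) (at x)"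
  unfolding Cinf_def using Ck_on_SucD(1) by blast

lemma Cinf_derivative: "Cinf W f \<Longrightarrow> Cinf W (\<lambda>x. frechet_derivative f (at x) v)"
  unfolding Cinf_def using Ck_on_SucD(2) by blast

lemma Cinf_const: "open W \<Longrightarrow> Cinf W (\<lambda>x. c)"
  by (simp add: Cinf_def Ck_on_const)

lemma Cinf_id: "open W \<Longrightarrow> Cinf W (\<lambda>x. x)"
  by (simp add: Cinf_def Ck_on_id)

lemma Cinf_bounded_linear: "bounded_linear L \<Longrightarrow> Cinf W f \<Longrightarrow> Cinf W (\<lambda>x. L (f x))"
  by (simp add: Cinf_def Ck_on_bounded_linear)

lemma Cinf_bounded_bilinear:
  "bounded_bilinear B \<Longrightarrow> Cinf W f \<Longrightarrow> Cinf W g \<Longrightarrow> Cinf W (\<lambda>x. B (f x) (g x))"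
  by (simp add: Cinf_def Ck_on_bounded_bilinear)

lemma Cinf_add: "Cinf W f \<Longrightarrow> Cinf W g \<Longrightarrow> Cinf W (\<lambda>x. f x + g x)"
  by (simp add: Cinf_def Ck_on_add)

lemma Cinf_scaleR: "Cinf W f \<Longrightarrow> Cinf W g \<Longrightarrow> Cinf W (\<lambda>x. f x *\<^sub>R g x)"
  by (rule Cinf_bounded_bilinear[OF bounded_bilinear_scaleR])

lemma Cinf_mult: "Cinf W f \<Longrightarrow> Cinf W g \<Longrightarrow> Cinf W (\<lambda>x. f x * g x :: 'b::real_normed_algebra)"
  by (rule Cinf_bounded_bilinear[OF bounded_bilinear_mult])

lemma Cinf_inner: "Cinf W f \<Longrightarrow> Cinf W g \<Longrightarrow> Cinf W (\<lambda>x. f x \<bullet> g x)"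
  by (rule Cinf_bounded_bilinear[OF bounded_bilinear_inner])

lemma Cinf_minus: "Cinf W f \<Longrightarrow> Cinf W (\<lambda>x. - f x)"
  by (rule Cinf_bounded_linear[OF bounded_linear_minus[OF bounded_linear_ident]])

lemma Cinf_diff: "Cinf W f \<Longrightarrow> Cinf W g \<Longrightarrow> Cinf W (\<lambda>x. f x - g x)"
  using Cinf_add[of W f "\<lambda>x. - g x"] Cinf_minus[of W g] by simp

lemma Cinf_fst: "Cinf W f \<Longrightarrow> Cinf W (\<lambda>x. fst (f x))"
  by (rule Cinf_bounded_linear[OF bounded_linear_fst])

lemma Cinf_snd: "Cinf W f \<Longrightarrow> Cinf W (\<lambda>x. snd (f x))"
  by (rule Cinf_bounded_linear[OF bounded_linear_snd])

lemma Cinf_Pair: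
  assumes "Cinf W f" "Cinf W g"
  shows "Cinf W (\<lambda>x. (f x, g x))"
proof -
  have "bounded_linear (\<lambda>a. (a, 0::'c))" "bounded_linear (\<lambda>b. (0::'b, b))"
    by (intro bounded_linear_Pair bounded_linear_ident bounded_linear_zero)+
  from Cinf_add[OF Cinf_bounded_linear[OF this(1) assms(1)] Cinf_bounded_linear[OF this(2) assms(2)]]
  show ?thesis by simp
qed

lemma Cinf_power: "Cinf W f \<Longrightarrow> Cinf W (\<lambda>x. f x ^ n :: 'b::real_normed_algebra_1)"
  by (induction n) (auto intro: Cinf_const Cinf_mult Cinf_open)

lemma Cinf_compose:
  fixes f :: "'a::real_normed_vector \<Rightarrow> 'b::euclidean_space"
  assumes "Cinf W f" "Cinf V g" "\<And>x. x \<in> W \<Longrightarrow> f x \<in> V"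
  shows "Cinf W (\<lambda>x. g (f x))"
  using assms Ck_on_compose[of W V f _ g] unfolding Cinf_def by blast

lemmas Cinf_intros = Cinf_id Cinf_const Cinf_add Cinf_diff Cinf_minus Cinf_scaleR Cinf_mult
  Cinf_inner Cinf_fst Cinf_snd Cinf_Pair Cinf_power

text \<open>The derivative of \<open>1 / f\<close> is a product of \<open>1 / f\<close> and
  derivatives of \<open>f\<close>, so the induction hypothesis for \<open>1 / f\<close> itself
  closes the induction.\<close>

lemma Ck_on_inverse:
  fixes f :: "'a::real_normed_vector \<Rightarrow> real"
  assumes "open W" "\<And>x. x \<in> W \<Longrightarrow> f x \<noteq> 0" "Cinf W f"
  shows "Ck_on k (\<lambda>x. inverse (f x)) W"
proof (induction k)
  case 0
  then show ?case
    using assms continuous_on_inverse[OF Cinf_continuous_on[OF assms(3)]] by auto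
next
  case (Suc k)
  have "Ck_on k (\<lambda>x. frechet_derivative f (at x) v) W" for v
    using Cinf_derivative[OF assms(3)] unfolding Cinf_def by blast
  note d = this
  have "((\<lambda>x. inverse (f x)) has_derivative
      (\<lambda>v. - (inverse (f x) * frechet_derivative f (at x) v * inverse (f x)))) (at x)" if "x \<in> W" for x
    by (rule Deriv.has_derivative_inverse[OF assms(2)[OF that] Cinf_has_derivative[OF assms(3) that]])
  moreover have "Ck_on k (\<lambda>x. - (inverse (f x) * frechet_derivative f (at x) v * inverse (f x))) W" for v
    by (intro Ck_on_bounded_linear[OF bounded_linear_minus[OF bounded_linear_ident]] assms(1) Suc d
          Ck_on_bounded_bilinear[OF bounded_bilinear_mult])
  ultimately show ?case
    by (rule Ck_on_SucI[OF assms(1), where D="\<lambda>x v. - (inverse (f x) * frechet_derivative f (at x) v * inverse (f x))"])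
qed

lemma Cinf_inverse:
  fixes f :: "'a::real_normed_vector \<Rightarrow> real"
  shows "Cinf W f \<Longrightarrow> (\<And>x. x \<in> W \<Longrightarrow> f x \<noteq> 0) \<Longrightarrow> Cinf W (\<lambda>x. inverse (f x))"
  using Ck_on_inverse[of W f] unfolding Cinf_def by blast

lemma Cinf_divide:
  fixes f :: "'a::real_normed_vector \<Rightarrow> real"
  shows "Cinf W f \<Longrightarrow> Cinf W g \<Longrightarrow> (\<And>x. x \<in> W \<Longrightarrow> g x \<noteq> 0) \<Longrightarrow> Cinf W (\<lambda>x. f x / g x)"
  unfolding divide_inverse by (intro Cinf_mult Cinf_inverse)

lemma Cinf_sqrt:
  fixes f :: "'a::real_normed_vector \<Rightarrow> real"
  assumes f: "Cinf W f" and pos: "\<And>x. x \<in> W \<Longrightarrow> 0 < f x"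
  shows "Cinf W (\<lambda>x. sqrt (f x))"
proof -
  note W = Cinf_open[OF f]
  have "Ck_on k (\<lambda>x. sqrt (f x)) W" for k
  proof (induction k)
    case 0
    then show ?case
      using continuous_on_real_sqrt[OF Cinf_continuous_on[OF f]] by auto
  next
    case (Suc k)
    have a: "Ck_on k (\<lambda>x. frechet_derivative f (at x) v) W" for v
      using Cinf_derivative[OF f] unfolding Cinf_def by blast
    have b: "Ck_on k (\<lambda>x. inverse (f x) / 2) W"
      using Cinf_divide[OF Cinf_inverse[OF f] Cinf_const[OF W, of 2]] pos unfolding Cinf_def by fastforce
    show ?case
    \<comment> \<open>The usual derivative \<open>f' / (2 sqrt f)\<close> is written with
      \<open>sqrt f\<close> in the numerator, so that the induction hypothesis applies to it
      directly.\<close>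
    proof (rule Ck_on_SucI[where D="\<lambda>x v. (inverse (f x) / 2) * (sqrt (f x) * frechet_derivative f (at x) v)"])
      fix x assume x: "x \<in> W"
      have "((\<lambda>x. sqrt (f x)) has_derivative (\<lambda>v. frechet_derivative f (at x) v * (inverse (sqrt (f x)) / 2))) (at x)"
        using has_derivative_real_sqrt[OF pos[OF x] Cinf_has_derivative[OF f x]] by simp
      moreover have "inverse (sqrt (f x)) / 2 = inverse (f x) / 2 * sqrt (f x)"
        using pos[OF x] by (simp add: field_simps)
      ultimately show "((\<lambda>x. sqrt (f x)) has_derivative (\<lambda>v. (inverse (f x) / 2) * (sqrt (f x) * frechet_derivative f (at x) v))) (at x)"
        by (simp add: mult_ac)
    qed (intro W Ck_on_bounded_bilinear[OF bounded_bilinear_mult] a b Suc)+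
  qed
  then show ?thesis by (simp add: W Cinf_def)
qed

section \<open>Flat functions, ramps and smooth steps\<close>

definition flat_exp :: "nat \<Rightarrow> real \<Rightarrow> real" where
  "flat_exp p u = (if 0 < u then (1 / u) ^ p * exp (- 1 / u) else 0)"

lemma flat_exp_tendsto_0: "(flat_exp p \<longlongrightarrow> 0) (at 0)"
proof -
  have "((\<lambda>u. (inverse u) ^ p / exp (inverse u)) \<longlongrightarrow> (0::real)) (at_right 0)"
    by (rule filterlim_compose[OF tendsto_power_div_exp_0 filterlim_inverse_at_top_right])
  then have r: "(flat_exp p \<longlongrightarrow> 0) (at_right 0)"
    by (rule Lim_transform_eventually)
       (auto simp: eventually_at_filter flat_exp_def exp_minus divide_inverse)
  have "((\<lambda>_. 0) \<longlongrightarrow> (0::real)) (at_left 0)"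
    by simp
  then have l: "(flat_exp p \<longlongrightarrow> 0) (at_left 0)"
    by (rule Lim_transform_eventually) (auto simp: eventually_at_filter flat_exp_def)
  from l r show ?thesis by (simp add: filterlim_split_at)
qed

text \<open>The classical flat function is the case \<open>p = 0\<close>. The powers of
  \<open>1 / u\<close> are part of the family so that it is closed under differentiation up to
  linear combinations, and one induction then shows all members smooth.\<close>

lemma flat_exp_has_derivative:
  "(flat_exp p has_real_derivative flat_exp (p + 2) u - real p * flat_exp (p + 1) u) (at u)"
proof (cases u "0 :: real" rule: linorder_cases)
  case less
  have "((\<lambda>_. 0) has_real_derivative 0) (at u)" by simp
  then have "(flat_exp p has_real_derivative 0) (at u)"
    by (rule has_field_derivative_transform_within_open[where S="{..<0}"]) (use less in \<open>auto simp: flat_exp_def\<close>)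
  then show ?thesis using less by (simp add: flat_exp_def)
next
  case equal
  \<comment> \<open>At 0 the difference quotient is itself a member of the family,
    \<open>flat_exp (Suc p)\<close>, whose limit is known.\<close>
  have "((\<lambda>h. (flat_exp p (0 + h) - flat_exp p 0) / h) \<longlongrightarrow> 0) (at 0)"
    by (rule Lim_transform_eventually[OF flat_exp_tendsto_0[of "Suc p"]])
       (auto simp: eventually_at_filter flat_exp_def field_simps)
  then show ?thesis using equal by (simp add: DERIV_def flat_exp_def)
next
  case greater
  have "((\<lambda>u. (1 / u) ^ p * exp (- 1 / u)) has_real_derivative flat_exp (p + 2) u - real p * flat_exp (p + 1) u) (at u)"
  proof (cases p)
    case 0
    then show ?thesis
      using greater by (auto intro!: derivative_eq_intros simp: flat_exp_def field_simps power2_eq_square)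
  next
    case (Suc q)
    have a: "((\<lambda>u. 1 / u) has_real_derivative - 1 / (u * u)) (at u)"
      using greater by (auto intro!: derivative_eq_intros)
    have b: "((\<lambda>u. exp (- 1 / u)) has_real_derivative exp (- 1 / u) * (1 / (u * u))) (at u)"
      using greater by (auto intro!: derivative_eq_intros)
    show ?thesis
      using DERIV_mult[OF DERIV_power_Suc[OF a, of q] b] greater
      by (simp add: Suc flat_exp_def field_simps)
  qed
  then show ?thesis
    by (rule has_field_derivative_transform_within_open[where S="{0<..}"]) (use greater in \<open>auto simp: flat_exp_def\<close>)
qed

lemma Cinf_flat_exp: "Cinf UNIV (flat_exp p)"
proof -
  have "Ck_on k (flat_exp p) UNIV" for k
  proof (induction k arbitrary: p)
    case 0
    show ?case
      by (auto intro!: DERIV_continuous_on[OF has_field_derivative_at_within[OF flat_exp_has_derivative]])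
  next
    case (Suc k)
    have "Ck_on k (\<lambda>u. flat_exp (p + 2) u + (- real p) * flat_exp (p + 1) u) UNIV"
      by (intro Ck_on_add open_UNIV Suc Ck_on_bounded_linear[OF bounded_linear_mult_right])
    from Ck_on_bounded_linear[OF bounded_linear_mult_left open_UNIV this]
    have *: "Ck_on k (\<lambda>u. (flat_exp (p + 2) u - real p * flat_exp (p + 1) u) * v) UNIV" for v
      by simp
    show ?case
      by (rule Ck_on_SucI[OF open_UNIV _ *]) (rule flat_exp_has_derivative[unfolded has_field_derivative_def])
  qed
  then show ?thesis by (simp add: Cinf_def)
qed

lemma flat_exp_nonneg: "0 \<le> flat_exp p u"
  and flat_exp_pos: "0 < u \<Longrightarrow> 0 < flat_exp p u"
  and flat_exp_zero: "u \<le> 0 \<Longrightarrow> flat_exp p u = 0"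
  by (auto simp: flat_exp_def)

lemma flat_exp_mono: "u \<le> w \<Longrightarrow> flat_exp 0 u \<le> flat_exp 0 w"
  by (auto simp: flat_exp_def field_simps)

text \<open>Increasing on \<open>{0..1}\<close> from \<open>0\<close> to \<open>1\<close>, with positive derivative at \<open>0\<close>, constant from \<open>1\<close> on.\<close>

definition ramp :: "real \<Rightarrow> real" where
  "ramp s = 1 - exp 1 * flat_exp 0 (1 - s)"

definition ramp' :: "real \<Rightarrow> real" where
  "ramp' s = exp 1 * flat_exp 2 (1 - s)"

lemma Cinf_flat_exp_compose: "Cinf W f \<Longrightarrow> Cinf W (\<lambda>x. flat_exp p (f x))"
  by (rule Cinf_compose[OF _ Cinf_flat_exp]) auto

lemma Cinf_ramp: "Cinf W f \<Longrightarrow> Cinf W (\<lambda>x. ramp (f x))"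
  unfolding ramp_def by (intro Cinf_intros Cinf_flat_exp_compose) (auto intro: Cinf_open)

lemma ramp_has_derivative: "(ramp has_real_derivative ramp' s) (at s)"
  unfolding ramp_def ramp'_def
  by (auto intro!: derivative_eq_intros DERIV_chain'[OF _ flat_exp_has_derivative] simp: numeral_2_eq_2)

lemma ramp'_nonneg: "0 \<le> ramp' s"
  and ramp'_pos: "s < 1 \<Longrightarrow> 0 < ramp' s"
  by (auto simp: ramp'_def flat_exp_nonneg flat_exp_pos)

lemma ramp_1: "1 \<le> s \<Longrightarrow> ramp s = 1"
  by (simp add: ramp_def flat_exp_zero)

lemma ramp_0: "ramp 0 = 0"
  by (simp add: ramp_def flat_exp_def exp_minus)

lemma ramp_le_1: "ramp s \<le> 1"
  by (simp add: ramp_def flat_exp_nonneg)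

lemma ramp_pos: "0 < s \<Longrightarrow> 0 < ramp s"
proof -
  assume s: "0 < s"
  have "flat_exp 0 (1 - s) < exp (- 1)"
    using s by (auto simp: flat_exp_def field_simps)
  then show ?thesis by (simp add: ramp_def exp_minus field_simps)
qed

lemma ramp_nonneg: "0 \<le> s \<Longrightarrow> 0 \<le> ramp s"
  using ramp_pos[of s] ramp_0 by (cases "s = 0") auto

text \<open>\<open>ramp\<close> is constant only from 1 on. Feeding it a flat function makes the
  composite constant for \<open>s \<le> 0\<close> too; the factor \<open>exp 1\<close> lets the
  argument reach 1 exactly at \<open>s = 1\<close>.\<close>

definition smooth_step :: "real \<Rightarrow> real" where
  "smooth_step s = ramp (exp 1 * flat_exp 0 s)"

definition smooth_step' :: "real \<Rightarrow> real" where
  "smooth_step' s = ramp' (exp 1 * flat_exp 0 s) * (exp 1 * flat_exp 2 s)"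

lemma Cinf_smooth_step: "Cinf W f \<Longrightarrow> Cinf W (\<lambda>x. smooth_step (f x))"
  unfolding smooth_step_def by (intro Cinf_intros Cinf_flat_exp_compose Cinf_ramp) (auto intro: Cinf_open)

lemma smooth_step_has_derivative: "(smooth_step has_real_derivative smooth_step' s) (at s)"
  unfolding smooth_step_def smooth_step'_def
  by (rule DERIV_chain2[OF ramp_has_derivative])
     (auto intro!: derivative_eq_intros flat_exp_has_derivative simp: numeral_2_eq_2)

lemma smooth_step'_nonneg: "0 \<le> smooth_step' s"
  by (simp add: smooth_step'_def ramp'_nonneg flat_exp_nonneg)

lemma smooth_step_0: "s \<le> 0 \<Longrightarrow> smooth_step s = 0"
  by (simp add: smooth_step_def flat_exp_zero ramp_0)

lemma smooth_step_1: "1 \<le> s \<Longrightarrow> smooth_step s = 1"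
proof -
  assume "1 \<le> s"
  then have "flat_exp 0 1 \<le> flat_exp 0 s" by (rule flat_exp_mono)
  then have "1 \<le> exp 1 * flat_exp 0 s" by (simp add: flat_exp_def exp_minus field_simps)
  then show ?thesis by (simp add: smooth_step_def ramp_1)
qed

lemma smooth_step_nonneg: "0 \<le> smooth_step s"
  and smooth_step_le_1: "smooth_step s \<le> 1"
  by (auto simp: smooth_step_def ramp_le_1 intro!: ramp_nonneg mult_nonneg_nonneg flat_exp_nonneg)

section \<open>Smoothness on sets that need not be open\<close>

lemma smooth_on_continuous_on:
  assumes "smooth_on S f" shows "continuous_on S f"
proof -
  have "continuous (at x within S) f" if x: "x \<in> S" for x
  proof -
    obtain W g where g: "Cinf W g" "x \<in> W" "\<And>y. y \<in> S \<inter> W \<Longrightarrow> g y = f y"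
      using assms x unfolding smooth_on_Cinf by meson
    have "continuous (at x within S) g"
      using Cinf_continuous_on[OF g(1)] Cinf_open[OF g(1)] g(2)
      by (meson continuous_at_imp_continuous_at_within continuous_on_eq_continuous_at)
    moreover obtain d where d: "0 < d" "ball x d \<subseteq> W"
      using Cinf_open[OF g(1)] g(2) open_contains_ball by blast
    then have "g x' = f x'" if "x' \<in> S" "dist x' x < d" for x'
      using that g(3) by (auto simp: dist_commute subset_iff)
    ultimately show ?thesis using continuous_transform_within[of x S g d f] x d by blast
  qed
  then show ?thesis by (simp add: continuous_on_eq_continuous_within)
qed

lemma smooth_on_cong: "smooth_on S f \<Longrightarrow> (\<And>x. x \<in> S \<Longrightarrow> f x = g x) \<Longrightarrow> smooth_on S g"
  unfolding smooth_on_Cinf by (metis IntD1)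

lemma smooth_on_subset: "smooth_on S f \<Longrightarrow> T \<subseteq> S \<Longrightarrow> smooth_on T f"
  unfolding smooth_on_Cinf by (meson IntD1 IntD2 IntI subsetD)

lemma Cinf_smooth_on: "Cinf W f \<Longrightarrow> S \<subseteq> W \<Longrightarrow> smooth_on S f"
  unfolding smooth_on_Cinf by blast

lemma smooth_on_compose:
  fixes f :: "'a::real_normed_vector \<Rightarrow> 'b::euclidean_space" and g :: "'b \<Rightarrow> 'c::real_normed_vector"
  assumes "smooth_on S f" "smooth_on T g" "\<And>x. x \<in> S \<Longrightarrow> f x \<in> T"
  shows "smooth_on S (\<lambda>x. g (f x))"
  unfolding smooth_on_Cinf
proof
  fix x assume x: "x \<in> S"
  obtain W f' where f': "Cinf W f'" "x \<in> W" "\<And>y. y \<in> S \<inter> W \<Longrightarrow> f' y = f y"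
    using assms(1) x unfolding smooth_on_Cinf by meson
  obtain V g' where g': "Cinf V g'" "f x \<in> V" "\<And>y. y \<in> T \<inter> V \<Longrightarrow> g' y = g y"
    using assms(2,3) x unfolding smooth_on_Cinf by meson
  let ?O = "W \<inter> f' -` V"
  have o: "open ?O"
    using Cinf_open[OF f'(1)] Cinf_open[OF g'(1)] Cinf_continuous_on[OF f'(1)] by (simp add: continuous_on_open_vimage Int_commute)
  have "Cinf ?O (\<lambda>x. g' (f' x))"
    by (rule Cinf_compose[OF Cinf_subset[OF f'(1) o] g'(1)]) auto
  moreover have "x \<in> ?O" using f' g' x by auto
  moreover have "\<forall>y\<in>S \<inter> ?O. g' (f' y) = g (f y)"
    using f'(3) g'(3) assms(3) by auto
  ultimately show "\<exists>W h. Cinf W h \<and> x \<in> W \<and> (\<forall>y\<in>S \<inter> W. h y = g (f y))" by blast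
qed

section \<open>Pushing sublevel sets in the half space\<close>

text \<open>\<open>straighten v g\<close> takes \<open>g\<close> for the coordinate in the direction of the unit vector \<open>v\<close>. Its inverse
  has an explicit derivative, so no general inverse function theorem is needed.\<close>

definition straighten :: "'a::real_inner \<Rightarrow> ('a \<Rightarrow> real) \<Rightarrow> 'a \<Rightarrow> 'a" where
  "straighten v g x = x + (g x - x \<bullet> v) *\<^sub>R v"

lemma straighten_inner: "norm v = 1 \<Longrightarrow> straighten v g x \<bullet> v = g x"
  by (simp add: straighten_def inner_add_left dot_square_norm)

lemma straighten_eqD: "straighten v f x = straighten v g y \<Longrightarrow> \<exists>c. y = x + c *\<^sub>R v"
  by (rule exI[of _ "(f x - x \<bullet> v) - (g y - y \<bullet> v)"]) (simp add: straighten_def algebra_simps)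

lemma straighten_line:
  assumes "norm v = 1" "f (x + c *\<^sub>R v) = g x"
  shows "straighten v f (x + c *\<^sub>R v) = straighten v g x"
proof -
  have "v \<bullet> v = 1" using assms(1) by (simp add: dot_square_norm)
  then show ?thesis using assms(2) by (simp add: straighten_def inner_add_left algebra_simps)
qed

text \<open>The set \<open>R\<close> will be a ball cut by the half space, so the derivative is that
  of a local extension \<open>h\<close> and not of \<open>g\<close>.\<close>

definition increasing_along :: "'a::euclidean_space set \<Rightarrow> 'a \<Rightarrow> ('a \<Rightarrow> real) \<Rightarrow> bool" where
  "increasing_along R v g \<longleftrightarrow> (\<forall>y\<in>R. \<exists>W h. Cinf W h \<and> y \<in> W \<and> (\<forall>z\<in>R \<inter> W. h z = g z) \<and>
     0 < frechet_derivative h (at y) v)"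

lemma increasing_along_smooth_on: "increasing_along R v g \<Longrightarrow> smooth_on R g"
  unfolding increasing_along_def smooth_on_Cinf by blast

lemma DERIV_along_line:
  assumes "Cinf W h" "x + s *\<^sub>R v \<in> W"
  shows "((\<lambda>s. h (x + s *\<^sub>R v)) has_real_derivative frechet_derivative h (at (x + s *\<^sub>R v)) v) (at s)"
proof -
  have "((\<lambda>s. x + s *\<^sub>R v) has_derivative (\<lambda>d. d *\<^sub>R v)) (at s)"
    by (auto intro!: derivative_eq_intros)
  from has_derivative_compose[OF this Cinf_has_derivative[OF assms]]
  show ?thesis
    using linear_scale[OF has_derivative_linear[OF Cinf_has_derivative[OF assms]]]
    by (simp add: has_field_derivative_def mult_commute_abs)
qed

text \<open>The segment stays in \<open>R\<close> by convexity, so along it \<open>g\<close>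
  coincides with its extensions and has a genuine positive derivative at every inner
  parameter.\<close>

lemma increasing_along_less:
  assumes g: "increasing_along R v g" and R: "convex R" "x \<in> R" "x + t *\<^sub>R v \<in> R" and t: "0 < t"
  shows "g x < g (x + t *\<^sub>R v)"
proof -
  have mem: "x + s *\<^sub>R v \<in> R" if "0 \<le> s" "s \<le> t" for s
  proof -
    have "x + s *\<^sub>R v = (1 - s / t) *\<^sub>R x + (s / t) *\<^sub>R (x + t *\<^sub>R v)"
      using t by (simp add: algebra_simps)
    moreover have "0 \<le> s / t" "0 \<le> 1 - s / t" using that t by (simp_all add: field_simps)
    ultimately show ?thesis
      using convexD[OF R, of "1 - s / t" "s / t"] by simp
  qed
  have "g (x + 0 *\<^sub>R v) < g (x + t *\<^sub>R v)"
  proof (rule DERIV_pos_imp_increasing_open[OF t])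
    show "continuous_on {0..t} (\<lambda>s. g (x + s *\<^sub>R v))"
      by (rule continuous_on_compose2[OF smooth_on_continuous_on[OF increasing_along_smooth_on[OF g]]])
         (auto intro!: continuous_intros mem)
  next
    fix s assume s: "0 < s" "s < t"
    let ?y = "x + s *\<^sub>R v"
    obtain W h where h: "Cinf W h" "?y \<in> W" "\<And>z. z \<in> R \<inter> W \<Longrightarrow> h z = g z" "0 < frechet_derivative h (at ?y) v"
      using g mem[of s] s unfolding increasing_along_def by (meson less_imp_le)
    have "open ({0<..<t} \<inter> (\<lambda>s. x + s *\<^sub>R v) -` W)"
      by (intro open_Int open_greaterThanLessThan open_vimage Cinf_open[OF h(1)] continuous_intros)
    with DERIV_along_line[OF h(1,2)]
    have "((\<lambda>s. g (x + s *\<^sub>R v)) has_real_derivative frechet_derivative h (at ?y) v) (at s)"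
      by (rule has_field_derivative_transform_within_open) (use s h mem in auto)
    then show "\<exists>D. ((\<lambda>s. g (x + s *\<^sub>R v)) has_real_derivative D) (at s) \<and> 0 < D" using h(4) by blast
  qed
  then show ?thesis by simp
qed

text \<open>Points with the same image lie on one line in direction \<open>v\<close> and share the
  value of \<open>g\<close>, but \<open>g\<close> is strictly increasing on that line.\<close>

lemma increasing_along_inj_straighten:
  assumes "increasing_along R v g" "convex R" "norm v = 1"
  shows "inj_on (straighten v g) R"
proof (rule inj_onI)
  fix x y assume xy: "x \<in> R" "y \<in> R" "straighten v g x = straighten v g y"
  then obtain c where c: "y = x + c *\<^sub>R v" using straighten_eqD by blast
  have e: "g x = g y" using xy(3) straighten_inner[OF assms(3)] by metis
  have "\<not> 0 < c"
    using increasing_along_less[OF assms(1,2) xy(1), of c] e xy(2) unfolding c by auto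
  moreover have "\<not> 0 < - c"
    using increasing_along_less[OF assms(1,2) xy(2), of "- c"] e xy(1) unfolding c by auto
  ultimately show "x = y" using c by auto
qed

text \<open>Invariance of domain makes the image open and the inverse \<open>Q\<close> continuous.
  The derivative of \<open>Q\<close> is then a smooth expression evaluated at \<open>Q\<close>, so
  that each order of differentiability of \<open>Q\<close> yields the next one.\<close>

lemma straighten_inverse:
  fixes g :: "'a::euclidean_space \<Rightarrow> real"
  assumes g: "Cinf W g" and W: "convex W" and v: "norm v = 1"
    and pos: "\<And>x. x \<in> W \<Longrightarrow> 0 < frechet_derivative g (at x) v"
  shows "\<exists>Q. Cinf (straighten v g ` W) Q \<and> (\<forall>x\<in>W. Q (straighten v g x) = x)"
proof -
  note W' = Cinf_open[OF g]
  let ?P = "straighten v g"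
  have P: "Cinf W ?P"
    unfolding straighten_def by (intro Cinf_intros g W')
  have "increasing_along W v g"
    unfolding increasing_along_def using g pos by blast
  then have inj: "inj_on ?P W" using increasing_along_inj_straighten W v by blast
  define Q where "Q = inv_into W ?P"
  have QP: "Q (?P x) = x" if "x \<in> W" for x using that inj by (simp add: Q_def)
  have o: "open (?P ` W)"
    by (rule invariance_of_domain[OF Cinf_continuous_on[OF P] W' inj])
  have cQ: "continuous_on (?P ` W) Q"
    by (rule continuous_on_inverse_open[OF W' Cinf_continuous_on[OF P] order.refl QP])
  \<comment> \<open>\<open>?E w z\<close> solves \<open>w = h + (g' h - h \<bullet> v) v\<close> for
    \<open>h\<close>, where \<open>g'\<close> is the derivative of \<open>g\<close> at
    \<open>z\<close>: pairing with \<open>v\<close> gives \<open>g' h = w \<bullet> v\<close>, and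
    inserting \<open>h = w + c v\<close> there determines \<open>c\<close>.\<close>
  let ?E = "\<lambda>w z. w + ((w \<bullet> v - frechet_derivative g (at z) w) / frechet_derivative g (at z) v) *\<^sub>R v"
  have E: "Cinf W (?E w)" for w
    by (intro Cinf_intros Cinf_divide Cinf_derivative g W') (use pos in fastforce)
  have dQ: "(Q has_derivative (\<lambda>w. ?E w (Q y))) (at y)" if y: "y \<in> ?P ` W" for y
  proof -
    obtain x where x: "x \<in> W" "y = ?P x" "Q y = x" using y QP by auto
    let ?g' = "frechet_derivative g (at x)"
    note dg = Cinf_has_derivative[OF g x(1)]
    have dP: "(?P has_derivative (\<lambda>h. h + (?g' h - h \<bullet> v) *\<^sub>R v)) (at x)"
      unfolding straighten_def by (auto intro!: derivative_eq_intros dg)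
    note bl = has_derivative_bounded_linear[OF dg]
    have bE: "bounded_linear (\<lambda>w. ?E w x)"
      by (intro bounded_linear_add bounded_linear_ident bounded_linear_scaleR_left[THEN bounded_linear_compose]
         bounded_linear_divide[THEN bounded_linear_compose] bounded_linear_sub bounded_linear_inner_left bl)
    have vv: "v \<bullet> v = 1" using v by (simp add: dot_square_norm)
    have "(\<lambda>w. ?E w x) \<circ> (\<lambda>h. h + (?g' h - h \<bullet> v) *\<^sub>R v) = id"
    proof
      fix h
      interpret bounded_linear ?g' by (rule bl)
      have "?g' v \<noteq> 0" using pos[OF x(1)] by simp
      then have e1: "(?g' h - (?g' h + (?g' h - h \<bullet> v) * ?g' v)) / ?g' v = - (?g' h - h \<bullet> v)"
        by simp
      have e2: "(h + (?g' h - h \<bullet> v) *\<^sub>R v) \<bullet> v = ?g' h"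
        by (simp add: inner_add_left vv)
      have e3: "?g' (h + (?g' h - h \<bullet> v) *\<^sub>R v) = ?g' h + (?g' h - h \<bullet> v) * ?g' v"
        by (simp only: add scale real_scaleR_def)
      show "((\<lambda>w. ?E w x) \<circ> (\<lambda>h. h + (?g' h - h \<bullet> v) *\<^sub>R v)) h = id h"
        by (simp only: o_apply e1 e2 e3 id_apply scaleR_minus_left add.assoc right_minus add_0_right)
    qed
    moreover have "continuous (at y) Q" using cQ o y continuous_on_eq_continuous_at by blast
    moreover have "?P (Q z) = z" if "z \<in> ?P ` W" for z using that QP by auto
    ultimately show ?thesis
      using has_derivative_inverse_basic[of ?P _ Q y "\<lambda>w. ?E w x", OF _ bE _ _ o y] dP x(3) by simp
  qed
  have "Ck_on k Q (?P ` W)" for k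
  proof (induction k)
    case 0
    then show ?case using cQ by simp
  next
    case (Suc k)
    have "Ck_on k (\<lambda>y. ?E w (Q y)) (?P ` W)" for w
      by (rule Ck_on_compose[OF o W' _ Suc]) (use E QP in \<open>auto simp: Cinf_def\<close>)
    then show ?case by (rule Ck_on_SucI[OF o dQ, rotated])
  qed
  then show ?thesis using o QP unfolding Cinf_def by blast
qed

lemma smooth_on_straighten:
  assumes "smooth_on S g" shows "smooth_on S (straighten v g)"
  unfolding smooth_on_Cinf
proof
  fix x assume x: "x \<in> S"
  obtain W f' where f': "Cinf W f'" "x \<in> W" "\<And>y. y \<in> S \<inter> W \<Longrightarrow> f' y = g y"
    using assms(1) x unfolding smooth_on_Cinf by meson
  have "Cinf W (straighten v f')"
    unfolding straighten_def by (intro Cinf_intros f' Cinf_open[OF f'(1)])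
  then show "\<exists>W h. Cinf W h \<and> x \<in> W \<and> (\<forall>y\<in>S \<inter> W. h y = straighten v g y)"
    using f' by (intro exI[of _ W] exI[of _ "straighten v f'"]) (auto simp: straighten_def)
qed

lemma increasing_along_ball:
  assumes "increasing_along R v g" "x \<in> R"
  shows "\<exists>W h. Cinf W h \<and> x \<in> W \<and> convex W \<and> (\<forall>z\<in>R \<inter> W. h z = g z) \<and>
    (\<forall>z\<in>W. 0 < frechet_derivative h (at z) v)"
proof -
  obtain W h where h: "Cinf W h" "x \<in> W" "\<And>z. z \<in> R \<inter> W \<Longrightarrow> h z = g z" "0 < frechet_derivative h (at x) v"
    using assms unfolding increasing_along_def by meson
  have "open (W \<inter> (\<lambda>z. frechet_derivative h (at z) v) -` {0<..})"
    using continuous_on_open_vimage[OF Cinf_open[OF h(1)]] Cinf_continuous_on[OF Cinf_derivative[OF h(1)]]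
    by (metis Int_commute open_greaterThan)
  then obtain d where d: "0 < d" "ball x d \<subseteq> W \<inter> (\<lambda>z. frechet_derivative h (at z) v) -` {0<..}"
    using h open_contains_ball by (metis (no_types, lifting) IntI greaterThan_iff vimage_eq)
  show ?thesis
    by (intro exI[of _ "ball x d"] exI[of _ h]) (use d h Cinf_subset[OF h(1), of "ball x d"] in auto)
qed

text \<open>Compactness of \<open>A\<close> makes the global inverse continuous. Near an image point
  its values therefore stay in the neighbourhood where an extension of \<open>g\<close> has the
  smooth inverse of \<open>straighten_inverse\<close>, and there both inverses agree.\<close>

lemma smooth_on_inv_straighten:
  assumes g: "increasing_along R v g" "convex R" and v: "norm v = 1" and A: "compact A" "A \<subseteq> R"
  shows "smooth_on (straighten v g ` A) (inv_into A (straighten v g))"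
  unfolding smooth_on_Cinf
proof
  let ?P = "straighten v g"
  have inj: "inj_on ?P A" using increasing_along_inj_straighten[OF g v] A inj_on_subset by blast
  have "continuous_on A ?P"
    using smooth_on_continuous_on smooth_on_straighten increasing_along_smooth_on[OF g(1)] A
    by (metis continuous_on_subset)
  then have c: "continuous_on (?P ` A) (inv_into A ?P)"
    using A inj by (intro continuous_on_inv) auto
  fix y assume y: "y \<in> ?P ` A"
  then obtain x where x: "x \<in> A" "y = ?P x" by auto
  then have xR: "x \<in> R" using A by auto
  have ix: "inv_into A ?P y = x" using inj x by simp
  obtain W h where W: "Cinf W h" "x \<in> W" "convex W" "\<forall>z\<in>R \<inter> W. h z = g z"
    "\<forall>z\<in>W. 0 < frechet_derivative h (at z) v"
    using increasing_along_ball[OF g(1) xR] by blast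
  obtain Q where Q: "Cinf (straighten v h ` W) Q" "\<And>x. x \<in> W \<Longrightarrow> Q (straighten v h x) = x"
    using straighten_inverse[OF W(1,3) v] W(5) by blast
  obtain V where V: "open V" "V \<inter> ?P ` A = inv_into A ?P -` W \<inter> ?P ` A"
    using c Cinf_open[OF W(1)] unfolding continuous_on_open_invariant by metis
  have eq: "straighten v h z = ?P z" if "z \<in> A" "z \<in> W" for z
    using that W(4) A by (auto simp: straighten_def subset_iff)
  have "Cinf (straighten v h ` W \<inter> V) Q"
    using Q(1) V(1) Cinf_open by (intro Cinf_subset[OF Q(1)]) auto
  moreover have "y \<in> straighten v h ` W \<inter> V"
    using x W(2) eq V(2) ix y by (metis IntI IntD1 image_eqI vimageI)
  moreover have "\<forall>u\<in>?P ` A \<inter> (straighten v h ` W \<inter> V). Q u = inv_into A ?P u"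
  proof
    fix u assume u: "u \<in> ?P ` A \<inter> (straighten v h ` W \<inter> V)"
    then have "inv_into A ?P u \<in> W" "inv_into A ?P u \<in> A" "?P (inv_into A ?P u) = u"
      using V(2) by (auto simp: inv_into_into f_inv_into_f)
    then show "Q u = inv_into A ?P u" using Q(2) eq by metis
  qed
  ultimately show "\<exists>W' h'. Cinf W' h' \<and> y \<in> W' \<and> (\<forall>u\<in>?P ` A \<inter> W'. h' u = inv_into A ?P u)" by blast
qed

section \<open>Moving along lines inside a half ball\<close>

lemma half_space_vimage: "half_space = snd -` {0..}"
  by (auto simp: half_space_def)

lemma closed_half_space: "closed half_space"
  unfolding half_space_vimage by (intro closed_vimage closed_atLeast continuous_intros)

lemma convex_half_space: "convex half_space"
  unfolding half_space_vimage by (rule convex_linear_vimage) (auto simp: bounded_linear.linear[OF bounded_linear_snd])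

text \<open>After moving by \<open>2 * r\<close> the distance to the centre is at least
  \<open>2 * r - r\<close>, so the intermediate value theorem applies on
  \<open>{0..2 * r}\<close>.\<close>

lemma line_exits_cball:
  fixes v :: "'a::euclidean_space"
  assumes "y \<in> cball a r" "norm v = 1"
  shows "\<exists>s\<ge>0. dist a (y + s *\<^sub>R v) = r"
proof -
  have r: "0 \<le> r" using assms(1) by (metis mem_cball order_trans zero_le_dist)
  have "\<exists>s. 0 \<le> s \<and> s \<le> 2 * r \<and> dist a (y + s *\<^sub>R v) = r"
  proof (rule IVT')
    have "norm ((2 * r) *\<^sub>R v) \<le> dist a (y + (2 * r) *\<^sub>R v) + dist a y"
      using dist_triangle3[of "y + (2 * r) *\<^sub>R v" y a] by (simp add: dist_norm)
    then show "r \<le> dist a (y + (2 * r) *\<^sub>R v)" using assms r by simp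
  qed (use assms r in \<open>auto intro!: continuous_intros\<close>)
  then show ?thesis by blast
qed

lemma segment_along_line:
  assumes "convex R" "x \<in> R" "x + t *\<^sub>R v \<in> R" "0 \<le> s" "s \<le> t"
  shows "x + s *\<^sub>R v \<in> R"
proof (cases "t = 0")
  case True
  then show ?thesis using assms by simp
next
  case False
  then have "x + s *\<^sub>R v = (1 - s / t) *\<^sub>R x + (s / t) *\<^sub>R (x + t *\<^sub>R v)"
    by (simp add: algebra_simps)
  moreover have "0 \<le> s / t" "0 \<le> 1 - s / t" using assms(4,5) by (auto simp: divide_le_eq_1)
  ultimately show ?thesis
    using convexD[OF assms(1-3), of "1 - s / t" "s / t"] by simp
qed

lemma increasing_along_le:
  assumes "increasing_along R v g" "convex R" "x \<in> R" "x + t *\<^sub>R v \<in> R" "0 \<le> t"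
  shows "g x \<le> g (x + t *\<^sub>R v)"
  using increasing_along_less[OF assms(1-4)] assms(5) by (cases "t = 0") auto

lemma increasing_along_IVT:
  assumes g: "increasing_along R v g" and R: "convex R" "x \<in> R" "x + t *\<^sub>R v \<in> R" and t: "0 \<le> t"
    and c: "g x \<le> c" "c \<le> g (x + t *\<^sub>R v)"
  shows "\<exists>s. x + s *\<^sub>R v \<in> R \<and> g (x + s *\<^sub>R v) = c"
proof -
  have mem: "x + s *\<^sub>R v \<in> R" if "0 \<le> s" "s \<le> t" for s
    using segment_along_line[OF R that] .
  have "\<exists>s. 0 \<le> s \<and> s \<le> t \<and> g (x + s *\<^sub>R v) = c"
  proof (rule IVT')
    show "continuous_on {0..t} (\<lambda>s. g (x + s *\<^sub>R v))"
      by (rule continuous_on_compose2[OF smooth_on_continuous_on[OF increasing_along_smooth_on[OF g]]])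
         (auto intro!: continuous_intros mem)
  qed (use c t in auto)
  then show ?thesis using mem by blast
qed

text \<open>Each point moves along its line in direction \<open>v\<close> until \<open>\<omega>1\<close> takes the value that \<open>\<omega>0\<close> had
  before. The conditions on \<open>v\<close> and \<open>\<omega>0\<close> at the boundary keep the points in the half space.\<close>

lemma half_ball_push:
  fixes a v :: "'m::euclidean_space \<times> real" and r :: real and \<omega>0 \<omega>1 :: "'m \<times> real \<Rightarrow> real"
  defines "R \<equiv> cball a r \<inter> half_space"
  defines "A \<equiv> {y \<in> R. \<omega>0 y \<le> 0}" and "B \<equiv> {y \<in> R. \<omega>1 y \<le> 0}"
  assumes r: "0 < r" and v: "norm v = 1"
    and dir: "cball a r \<subseteq> {x. 0 < snd x} \<or> snd v \<le> 0"
    and inc: "increasing_along R v \<omega>0" "increasing_along R v \<omega>1"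
    and le: "\<And>y. y \<in> R \<Longrightarrow> \<omega>0 y \<le> \<omega>1 y"
    and eq: "\<And>y. y \<in> R \<Longrightarrow> y \<notin> ball a (r / 2) \<Longrightarrow> \<omega>0 y = \<omega>1 y"
    and bd: "\<And>y. y \<in> R \<Longrightarrow> snd y = 0 \<Longrightarrow> 0 \<le> \<omega>0 y"
  shows "\<exists>e t. smooth_on A e \<and> smooth_on B t \<and>
    (\<forall>y\<in>A. e y \<in> B \<and> t (e y) = y \<and> (\<omega>0 y = \<omega>1 y \<longrightarrow> e y = y)) \<and>
    (\<forall>x\<in>B. t x \<in> A \<and> e (t x) = x \<and> (\<omega>0 x = \<omega>1 x \<longrightarrow> t x = x))"
proof -
  have R: "convex R" "compact R"
    unfolding R_def by (auto intro: convex_Int convex_half_space compact_Int_closed closed_half_space)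
  have c: "continuous_on R \<omega>0" "continuous_on R \<omega>1"
    using inc increasing_along_smooth_on smooth_on_continuous_on by blast+
  have A: "compact A"
  proof -
    have "A = R \<inter> \<omega>0 -` {..0}" by (auto simp: A_def)
    then show ?thesis
      using continuous_closed_preimage[OF c(1) compact_imp_closed[OF R(2)] closed_atMost, of 0] R(2)
      by (metis compact_Int_closed inf_left_idem)
  qed
  have B: "compact B"
  proof -
    have "B = R \<inter> \<omega>1 -` {..0}" by (auto simp: B_def)
    then show ?thesis
      using continuous_closed_preimage[OF c(2) compact_imp_closed[OF R(2)] closed_atMost, of 0] R(2)
      by (metis compact_Int_closed inf_left_idem)
  qed
  have sub: "A \<subseteq> R" "B \<subseteq> R" by (auto simp: A_def B_def)
  let ?P = "straighten v \<omega>0" and ?Q = "straighten v \<omega>1"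
  have inj: "inj_on ?P A" "inj_on ?Q B"
    using increasing_along_inj_straighten[OF _ R(1) v] inc sub inj_on_subset by blast+
  have same: "?P y = ?Q y" if "\<omega>0 y = \<omega>1 y" for y using that by (simp add: straighten_def)
  \<comment> \<open>From \<open>y\<close> one goes backwards along \<open>v\<close> to the sphere of
    radius \<open>r / 2\<close>, where both functions agree and hence \<open>\<omega>1\<close> is at
    most \<open>\<omega>0 y\<close>. At \<open>y\<close> itself \<open>\<omega>1\<close> is at least
    \<open>\<omega>0 y\<close>, so the value is taken in between. The condition on \<open>v\<close>
    keeps the backward path in the half space.\<close>
  have PQ: "?P y \<in> ?Q ` B" if y: "y \<in> A" for y
  proof (cases "\<omega>0 y = \<omega>1 y")
    case True
    then show ?thesis using y same[OF True] by (auto simp: A_def B_def)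
  next
    case False
    then have yb: "y \<in> ball a (r / 2)" "y \<in> R" "\<omega>0 y \<le> 0" using y eq[of y] False unfolding A_def by blast+
    then obtain s where s: "0 \<le> s" "dist a (y + s *\<^sub>R (- v)) = r / 2"
      using line_exits_cball[of y a "r / 2" "- v"] v by auto
    define z where "z = y + s *\<^sub>R (- v)"
    have yz: "y = z + s *\<^sub>R v" by (simp add: z_def)
    have zc: "z \<in> cball a r" using s r by (simp add: z_def)
    have "0 \<le> snd z"
      using dir
    proof
      assume "cball a r \<subseteq> {x. 0 < snd x}"
      then show ?thesis using zc by fastforce
    next
      assume "snd v \<le> 0"
      then have "s * snd v \<le> 0" using s(1) by (simp add: mult_nonneg_nonpos)
      then show ?thesis using yb(2) by (simp add: z_def R_def half_space_def)
    qed
    with zc have zR: "z \<in> R" by (simp add: R_def half_space_def)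
    have "\<omega>1 z = \<omega>0 z" using eq[OF zR] s(2) by (simp add: z_def)
    then have "\<omega>1 z \<le> \<omega>0 y"
      using increasing_along_le[OF inc(1) R(1) zR _ s(1)] yb(2) yz by simp
    with increasing_along_IVT[OF inc(2) R(1) zR _ s(1), of "\<omega>0 y"] yz yb(2) le[OF yb(2)]
    obtain u where u: "z + u *\<^sub>R v \<in> R" "\<omega>1 (z + u *\<^sub>R v) = \<omega>0 y" by auto
    then have u': "y + (u - s) *\<^sub>R v \<in> R" "\<omega>1 (y + (u - s) *\<^sub>R v) = \<omega>0 y"
      by (simp_all add: z_def algebra_simps)
    then have "?Q (y + (u - s) *\<^sub>R v) = ?P y" by (intro straighten_line[OF v])
    moreover have "y + (u - s) *\<^sub>R v \<in> B" using u' yb by (simp add: B_def)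
    ultimately show ?thesis by (metis image_eqI)
  qed
  have QP: "?Q x \<in> ?P ` A" if x: "x \<in> B" for x
  proof (cases "\<omega>0 x = \<omega>1 x")
    case True
    then show ?thesis using x same[OF True] by (force simp: A_def B_def)
  next
    case False
    then have xb: "x \<in> ball a (r / 2)" "x \<in> R" "\<omega>1 x \<le> 0" using x eq[of x] False unfolding B_def by blast+
    then obtain s where s: "0 \<le> s" "dist a (x + s *\<^sub>R v) = r / 2"
      using line_exits_cball[of x a "r / 2" v] v by auto
    define z where "z = x + s *\<^sub>R v"
    have z: "z \<in> cball a r" using s r by (simp add: z_def)
    \<comment> \<open>Going forwards, the path may hit the boundary before it reaches the sphere.
      Then the boundary point serves as end point: \<open>\<omega>0\<close> is nonnegative there,
      whereas \<open>\<omega>1 x \<le> 0\<close>.\<close>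
    have "\<exists>u\<ge>0. x + u *\<^sub>R v \<in> R \<and> \<omega>1 x \<le> \<omega>0 (x + u *\<^sub>R v)"
    proof (cases "0 \<le> snd z")
      case True
      then have zR: "z \<in> R" using z by (simp add: R_def half_space_def)
      have "\<omega>1 z = \<omega>0 z" using eq[OF zR] s(2) by (simp add: z_def)
      then have "\<omega>1 x \<le> \<omega>0 (x + s *\<^sub>R v)"
        using increasing_along_le[OF inc(2) R(1) xb(2) _ s(1)] zR by (simp add: z_def)
      then show ?thesis using s(1) zR z_def by blast
    next
      case False
      have "\<exists>u. 0 \<le> u \<and> u \<le> s \<and> snd (x + u *\<^sub>R v) = 0"
        by (rule IVT2') (use False s xb in \<open>auto intro!: continuous_intros simp: z_def R_def half_space_def\<close>)
      then obtain u where u: "0 \<le> u" "u \<le> s" "snd (x + u *\<^sub>R v) = 0" by blast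
      have "x + u *\<^sub>R v \<in> cball a r"
        by (rule segment_along_line[of _ _ s]) (use u z xb r in \<open>auto simp: z_def R_def\<close>)
      then have "x + u *\<^sub>R v \<in> R" using u(3) by (simp add: R_def half_space_def)
      moreover from bd[OF this u(3)] have "\<omega>1 x \<le> \<omega>0 (x + u *\<^sub>R v)" using xb(3) by simp
      ultimately show ?thesis using u(1) by blast
    qed
    then obtain w where w: "0 \<le> w" "x + w *\<^sub>R v \<in> R" "\<omega>1 x \<le> \<omega>0 (x + w *\<^sub>R v)" by blast
    from increasing_along_IVT[OF inc(1) R(1) xb(2) w(2,1) le[OF xb(2)] w(3)]
    obtain u where u: "x + u *\<^sub>R v \<in> R" "\<omega>0 (x + u *\<^sub>R v) = \<omega>1 x" by auto
    then have "?P (x + u *\<^sub>R v) = ?Q x" by (intro straighten_line[OF v])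
    moreover have "x + u *\<^sub>R v \<in> A" using u xb by (simp add: A_def)
    ultimately show ?thesis by (metis image_eqI)
  qed
  have sm: "smooth_on A ?P" "smooth_on B ?Q"
    using smooth_on_straighten increasing_along_smooth_on inc smooth_on_subset sub by metis+
  let ?e = "\<lambda>y. inv_into B ?Q (?P y)" and ?t = "\<lambda>x. inv_into A ?P (?Q x)"
  have "smooth_on A ?e"
    by (rule smooth_on_compose[OF sm(1) smooth_on_inv_straighten[OF inc(2) R(1) v B sub(2)]]) (rule PQ)
  moreover have "smooth_on B ?t"
    by (rule smooth_on_compose[OF sm(2) smooth_on_inv_straighten[OF inc(1) R(1) v A sub(1)]]) (rule QP)
  moreover have "?e y \<in> B \<and> ?t (?e y) = y \<and> (\<omega>0 y = \<omega>1 y \<longrightarrow> ?e y = y)" if y: "y \<in> A" for y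
  proof (intro conjI impI)
    show "?e y \<in> B" by (rule inv_into_into[OF PQ[OF y]])
    show "?t (?e y) = y" using f_inv_into_f[OF PQ[OF y]] inv_into_f_f[OF inj(1) y] by simp
    assume e: "\<omega>0 y = \<omega>1 y"
    then have "y \<in> B" using y by (simp add: A_def B_def)
    then show "?e y = y" using same[OF e] inj(2) by simp
  qed
  moreover have "?t x \<in> A \<and> ?e (?t x) = x \<and> (\<omega>0 x = \<omega>1 x \<longrightarrow> ?t x = x)" if x: "x \<in> B" for x
  proof (intro conjI impI)
    show "?t x \<in> A" by (rule inv_into_into[OF QP[OF x]])
    show "?e (?t x) = x" using f_inv_into_f[OF QP[OF x]] inv_into_f_f[OF inj(2) x] by simp
    assume e: "\<omega>0 x = \<omega>1 x"
    then have "x \<in> A" using x by (simp add: A_def B_def)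
    then show "?t x = x" using same[OF e] inj(1) by (metis inv_into_f_f)
  qed
  ultimately show ?thesis by (intro exI[of _ ?e] exI[of _ ?t]) blast
qed

section \<open>Smooth functions on a manifold\<close>

lemma is_chartD:
  assumes "is_chart T (U, \<phi>)"
  shows "openin T U" "U \<subseteq> topspace T" "inj_on \<phi> U" "\<phi> ` U \<subseteq> half_space"
    and "x \<in> U \<Longrightarrow> inv_into U \<phi> (\<phi> x) = x" "x \<in> U \<Longrightarrow> 0 \<le> snd (\<phi> x)"
proof -
  have c: "openin T U" "openin (top_of_set half_space) (\<phi> ` U)"
    "homeomorphic_map (subtopology T U) (top_of_set (\<phi> ` U)) \<phi>"
    using assms by (auto simp: is_chart_def)
  show "openin T U" by fact
  show U: "U \<subseteq> topspace T" using c(1) by (rule openin_subset)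
  show inj: "inj_on \<phi> U"
    using homeomorphic_imp_injective_map[OF c(3)] U by (simp add: Int_absorb1)
  show h: "\<phi> ` U \<subseteq> half_space" using openin_subset[OF c(2)] by simp
  show "x \<in> U \<Longrightarrow> inv_into U \<phi> (\<phi> x) = x" using inj by simp
  show "x \<in> U \<Longrightarrow> 0 \<le> snd (\<phi> x)" using h by (auto simp: half_space_def)
qed

lemma is_chart_vimage_open:
  assumes "is_chart T (U, \<phi>)" "open W"
  shows "openin T {x \<in> U. \<phi> x \<in> W}"
proof -
  have "continuous_map (subtopology T U) (top_of_set (\<phi> ` U)) \<phi>"
    using assms(1) homeomorphic_imp_continuous_map by (auto simp: is_chart_def)
  then have "continuous_map (subtopology T U) euclidean \<phi>"
    using continuous_map_in_subtopology by blast
  then have "openin (subtopology T U) {x \<in> topspace (subtopology T U). \<phi> x \<in> W}"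
    using assms(2) by (auto simp: continuous_map_def)
  moreover have "{x \<in> topspace (subtopology T U). \<phi> x \<in> W} = {x \<in> U. \<phi> x \<in> W}"
    using is_chartD(2)[OF assms(1)] by auto
  ultimately show ?thesis
    using is_chartD(1)[OF assms(1)] by (simp add: openin_open_subtopology)
qed

lemma is_chart_image_open:
  assumes "is_chart T (U, \<phi>)" "openin T V"
  shows "\<exists>W. open W \<and> \<phi> ` (U \<inter> V) = W \<inter> half_space"
proof -
  have c: "openin (top_of_set half_space) (\<phi> ` U)"
    "open_map (subtopology T U) (top_of_set (\<phi> ` U)) \<phi>"
    using assms(1) homeomorphic_imp_open_map by (auto simp: is_chart_def)
  have "openin (subtopology T U) (U \<inter> V)"
    using assms(2) by (auto simp: openin_subtopology)
  then have "openin (top_of_set (\<phi> ` U)) (\<phi> ` (U \<inter> V))"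
    using c(2) by (auto simp: open_map_def)
  then have "openin (top_of_set half_space) (\<phi> ` (U \<inter> V))"
    using c(1) openin_trans by blast
  then show ?thesis by (metis openin_open inf_commute)
qed

lemma is_chart_compactin:
  assumes "is_chart T (U, \<phi>)" "compact K" "K \<subseteq> \<phi> ` U"
  shows "compactin T {x \<in> U. \<phi> x \<in> K}"
proof -
  obtain g where g: "homeomorphic_maps (subtopology T U) (top_of_set (\<phi> ` U)) \<phi> g"
    using assms(1) by (auto simp: is_chart_def homeomorphic_map_maps)
  have U: "topspace (subtopology T U) = U"
    using is_chartD(2)[OF assms(1)] by (simp add: Int_absorb1)
  have "compactin (top_of_set (\<phi> ` U)) K"
    using assms by (simp add: compactin_subtopology)
  moreover have "continuous_map (top_of_set (\<phi> ` U)) (subtopology T U) g"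
    using g by (simp add: homeomorphic_maps_def)
  ultimately have "compactin (subtopology T U) (g ` K)" by (rule image_compactin)
  moreover have gx: "g (\<phi> x) = x" if "x \<in> U" for x
    using g that U by (simp add: homeomorphic_maps_def)
  have "g ` K = {x \<in> U. \<phi> x \<in> K}"
  proof
    show "g ` K \<subseteq> {x \<in> U. \<phi> x \<in> K}" using gx assms(3) by force
    show "{x \<in> U. \<phi> x \<in> K} \<subseteq> g ` K" using gx by force
  qed
  ultimately show ?thesis by (simp add: compactin_subtopology)
qed

text \<open>If \<open>\<psi> p\<close> had positive last coordinate, the transition map would be
  continuous and injective on an open set of the full space around it, and its image would be open
  by invariance of domain. But the image lies in the half space and contains the boundary point
  \<open>\<phi> p\<close>.\<close>

lemma is_chart_boundary_aux:
  fixes \<phi> \<psi> :: "'a \<Rightarrow> 'm::euclidean_space \<times> real"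
  assumes c: "is_chart T (U, \<phi>)" "is_chart T (V, \<psi>)" and p: "p \<in> U" "p \<in> V" and 0: "snd (\<phi> p) = 0"
  shows "snd (\<psi> p) = 0"
proof (rule ccontr)
  assume "snd (\<psi> p) \<noteq> 0"
  then have pos: "0 < snd (\<psi> p)" using is_chartD(6)[OF c(2) p(2)] by simp
  obtain W where W: "open W" "\<psi> ` (V \<inter> U) = W \<inter> half_space"
    using is_chart_image_open[OF c(2) is_chartD(1)[OF c(1)]] by blast
  let ?W = "W \<inter> {y. 0 < snd y}"
  have sub: "?W \<subseteq> \<psi> ` (V \<inter> U)" using W(2) by (auto simp: half_space_def)
  have oW: "open ?W" using W(1) by (intro open_Int open_Collect_less continuous_intros)
  let ?f = "\<phi> \<circ> inv_into V \<psi>"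
  have inv: "inv_into V \<psi> y \<in> V \<inter> U \<and> \<psi> (inv_into V \<psi> y) = y" if "y \<in> ?W" for y
    using subsetD[OF sub that] is_chartD(5)[OF c(2)] by auto
  have "continuous_on ?W ?f"
    unfolding continuous_on_open_invariant
  proof (intro allI impI)
    fix B :: "('m \<times> real) set" assume B: "open B"
    obtain O' where O': "open O'" "\<psi> ` (V \<inter> {x \<in> U. \<phi> x \<in> B}) = O' \<inter> half_space"
      using is_chart_image_open[OF c(2) is_chart_vimage_open[OF c(1) B]] by blast
    have "y \<in> O' \<longleftrightarrow> ?f y \<in> B" if y: "y \<in> ?W" for y
    proof -
      have "y \<in> half_space" using y by (auto simp: half_space_def)
      then have "y \<in> O' \<longleftrightarrow> y \<in> \<psi> ` (V \<inter> {x \<in> U. \<phi> x \<in> B})" using O'(2) by blast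
      also have "\<dots> \<longleftrightarrow> ?f y \<in> B"
      proof
        show "y \<in> \<psi> ` (V \<inter> {x \<in> U. \<phi> x \<in> B}) \<Longrightarrow> ?f y \<in> B"
          using is_chartD(5)[OF c(2)] by auto
        show "?f y \<in> B \<Longrightarrow> y \<in> \<psi> ` (V \<inter> {x \<in> U. \<phi> x \<in> B})"
          using inv[OF y] by (intro image_eqI[of _ _ "inv_into V \<psi> y"]) auto
      qed
      finally show ?thesis .
    qed
    then have "O' \<inter> ?W = ?f -` B \<inter> ?W" by auto
    then show "\<exists>A. open A \<and> A \<inter> ?W = ?f -` B \<inter> ?W" using O'(1) by blast
  qed
  moreover have "inj_on ?f ?W"
  proof (rule inj_onI)
    fix y z assume y: "y \<in> ?W" and z: "z \<in> ?W" and "?f y = ?f z"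
    then have "inv_into V \<psi> y = inv_into V \<psi> z"
      using inv[OF y] inv[OF z] is_chartD(3)[OF c(1)] by (auto dest: inj_onD)
    then show "y = z" using inv[OF y] inv[OF z] by metis
  qed
  ultimately have o: "open (?f ` ?W)" using invariance_of_domain[OF _ oW] by blast
  have "\<psi> p \<in> ?W" using pos W(2) p by auto
  then have "\<phi> p \<in> ?f ` ?W" using is_chartD(5)[OF c(2) p(2)] by (metis comp_apply image_eqI)
  then obtain e where e: "0 < e" "ball (\<phi> p) e \<subseteq> ?f ` ?W" using o open_contains_ball by blast
  have "\<phi> p - (0, e / 2) \<in> ball (\<phi> p) e" using e(1) by (simp add: dist_norm norm_Pair)
  then have "\<phi> p - (0, e / 2) \<in> ?f ` ?W" using e(2) by blast
  then obtain y where y: "y \<in> ?W" "\<phi> p - (0, e / 2) = \<phi> (inv_into V \<psi> y)" by auto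
  then have "0 \<le> snd (\<phi> p - (0, e / 2))" using inv[OF y(1)] is_chartD(6)[OF c(1)] by simp
  then show False using 0 e(1) by simp
qed

lemma is_chart_boundary:
  fixes \<phi> \<psi> :: "'a \<Rightarrow> 'm::euclidean_space \<times> real"
  assumes "is_chart T (U, \<phi>)" "is_chart T (V, \<psi>)" "p \<in> U" "p \<in> V"
  shows "snd (\<phi> p) = 0 \<longleftrightarrow> snd (\<psi> p) = 0"
  using is_chart_boundary_aux assms by metis

text \<open>The set \<open>S\<close> is kept as a parameter because the functions of interest live
  on sublevel sets, which are not open; the extension has to match \<open>g\<close> only on
  \<open>S\<close>.\<close>

definition ext_at :: "'a set \<Rightarrow> ('a \<Rightarrow> 'c::real_normed_vector) \<Rightarrow> 'a set \<Rightarrow> ('a \<Rightarrow> 'b::real_normed_vector) \<Rightarrow> 'a \<Rightarrow> bool" where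
  "ext_at U \<phi> S g p \<longleftrightarrow> (\<exists>W h. Cinf W h \<and> \<phi> p \<in> W \<and> (\<forall>x\<in>S \<inter> U. \<phi> x \<in> W \<longrightarrow> h (\<phi> x) = g x))"

text \<open>The extension is composed with an extension of the transition map. \<open>W3\<close>
  confines the comparison to points of the overlap, where the latter is the true transition
  map.\<close>

lemma ext_at_change_chart:
  fixes \<phi> \<psi> :: "'a \<Rightarrow> 'm::euclidean_space \<times> real"
  assumes c: "is_chart T (U, \<phi>)" "is_chart T (V, \<psi>)" "compatible (U, \<phi>) (V, \<psi>)"
    and p: "p \<in> U" "p \<in> V" and g: "ext_at U \<phi> S g p"
  shows "ext_at V \<psi> S g p"
proof -
  obtain W h where h: "Cinf W h" "\<phi> p \<in> W" "\<And>x. x \<in> S \<inter> U \<Longrightarrow> \<phi> x \<in> W \<Longrightarrow> h (\<phi> x) = g x"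
    using g unfolding ext_at_def by blast
  have "smooth_on (\<psi> ` (U \<inter> V)) (\<phi> \<circ> inv_into V \<psi>)" using c(3) by (simp add: compatible_def)
  moreover have "\<psi> p \<in> \<psi> ` (U \<inter> V)" using p by blast
  ultimately obtain W' \<tau> where t: "Cinf W' \<tau>" "\<psi> p \<in> W'"
    "\<And>y. y \<in> \<psi> ` (U \<inter> V) \<inter> W' \<Longrightarrow> \<tau> y = (\<phi> \<circ> inv_into V \<psi>) y"
    unfolding smooth_on_Cinf by meson
  obtain W3 where W3: "open W3" "\<psi> ` (V \<inter> U) = W3 \<inter> half_space"
    using is_chart_image_open[OF c(2) is_chartD(1)[OF c(1)]] by blast
  have tx: "\<tau> (\<psi> x) = \<phi> x" if "x \<in> U" "x \<in> V" "\<psi> x \<in> W'" for x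
    using t(3)[of "\<psi> x"] that is_chartD(5)[OF c(2)] by auto
  let ?W = "(W' \<inter> W3) \<inter> \<tau> -` W"
  have o: "open ?W"
    by (intro continuous_open_preimage continuous_on_subset[OF Cinf_continuous_on[OF t(1)]] open_Int
        Cinf_open[OF t(1)] Cinf_open[OF h(1)] W3(1)) auto
  have "Cinf ?W (\<lambda>y. h (\<tau> y))"
    by (rule Cinf_compose[OF Cinf_subset[OF t(1) o] h(1)]) auto
  moreover have "\<psi> p \<in> ?W" using t(2) tx p h(2) W3(2) by auto
  moreover have "h (\<tau> (\<psi> x)) = g x" if x: "x \<in> S \<inter> V" "\<psi> x \<in> ?W" for x
  proof -
    have "\<psi> x \<in> half_space" using x is_chartD(4)[OF c(2)] by auto
    then have "\<psi> x \<in> \<psi> ` (V \<inter> U)" using x W3(2) by auto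
    then have "x \<in> U" using x is_chartD(3)[OF c(2)] by (auto dest: inj_onD)
    then show ?thesis using tx[of x] x h(3)[of x] by auto
  qed
  ultimately show ?thesis unfolding ext_at_def by blast
qed

lemma compatible_sym: "compatible c d \<longleftrightarrow> compatible d c"
  by (auto simp: compatible_def Int_commute split: prod.splits)

definition smooth_at ::
    "('a, 'm::euclidean_space) manifold \<Rightarrow> 'a set \<Rightarrow> ('a \<Rightarrow> 'b::real_normed_vector) \<Rightarrow> 'a \<Rightarrow> bool" where
  "smooth_at N S g p \<longleftrightarrow> (\<exists>(U, \<phi>)\<in>atlas N. p \<in> U \<and> ext_at U \<phi> S g p)"

definition smooth_in ::
    "('a, 'm::euclidean_space) manifold \<Rightarrow> 'a set \<Rightarrow> ('a \<Rightarrow> 'b::real_normed_vector) \<Rightarrow> bool" where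
  "smooth_in N S g \<longleftrightarrow> (\<forall>p\<in>S. smooth_at N S g p)"

section \<open>Calculus of smooth functions on subsets of a manifold\<close>

locale smooth_mfd =
  fixes N :: "('a, 'm::euclidean_space) manifold"
  assumes mfd: "smooth_manifold N"
begin

abbreviation "T \<equiv> mtop N"
abbreviation "X \<equiv> topspace (mtop N)"

lemma atlas_smooth_charts: "atlas N \<subseteq> smooth_charts N"
  using mfd by (auto simp: smooth_manifold_def smooth_charts_def)

lemma smooth_charts_is_chart: "c \<in> smooth_charts N \<Longrightarrow> is_chart T c"
  by (simp add: smooth_charts_def)

lemma smooth_charts_compatible: "c \<in> smooth_charts N \<Longrightarrow> d \<in> atlas N \<Longrightarrow> compatible c d"
  by (simp add: smooth_charts_def)

lemma atlas_cover: "p \<in> X \<Longrightarrow> \<exists>U \<phi>. (U, \<phi>) \<in> atlas N \<and> p \<in> U"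
  using mfd unfolding smooth_manifold_def by blast

lemmas chartD = is_chartD[OF smooth_charts_is_chart]

text \<open>Together with \<open>smooth_atI\<close> this frees smoothness from the given atlas: any
  chart of the maximal atlas may be used both to test it and to prove it.\<close>

lemma smooth_at_chart:
  assumes "smooth_at N S g p" "(U, \<phi>) \<in> smooth_charts N" "p \<in> U"
  shows "ext_at U \<phi> S g p"
proof -
  obtain V \<psi> where V: "(V, \<psi>) \<in> atlas N" "p \<in> V" "ext_at V \<psi> S g p"
    using assms(1) unfolding smooth_at_def by blast
  show ?thesis
    using ext_at_change_chart[OF _ _ _ V(2) assms(3) V(3)] assms(2) V(1) atlas_smooth_charts
      smooth_charts_is_chart smooth_charts_compatible compatible_sym by (metis subsetD)
qed

lemma smooth_atI:
  assumes "(U, \<phi>) \<in> smooth_charts N" "p \<in> U" "ext_at U \<phi> S g p"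
  shows "smooth_at N S g p"
proof -
  have "p \<in> X" using chartD(2)[OF assms(1)] assms(2) by blast
  then obtain V \<psi> where V: "(V, \<psi>) \<in> atlas N" "p \<in> V" using atlas_cover by blast
  show ?thesis
    unfolding smooth_at_def
    using ext_at_change_chart[OF _ _ _ assms(2) V(2) assms(3)] assms(1) V atlas_smooth_charts
      smooth_charts_is_chart smooth_charts_compatible by (metis (no_types, lifting) case_prodI subsetD)
qed

lemma smooth_at_compose:
  fixes g :: "'a \<Rightarrow> 'b::euclidean_space"
  assumes "smooth_at N S g p" "p \<in> S" "Cinf V k" "g p \<in> V"
  shows "smooth_at N S (\<lambda>x. k (g x)) p"
proof -
  obtain U \<phi> W h where h: "(U, \<phi>) \<in> atlas N" "p \<in> U" "Cinf W h" "\<phi> p \<in> W"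
    "\<And>x. x \<in> S \<inter> U \<Longrightarrow> \<phi> x \<in> W \<Longrightarrow> h (\<phi> x) = g x"
    using assms(1) unfolding smooth_at_def ext_at_def by fast
  let ?W = "W \<inter> h -` V"
  have o: "open ?W"
    by (intro continuous_open_preimage Cinf_continuous_on[OF h(3)] Cinf_open[OF h(3)] Cinf_open[OF assms(3)])
  have "Cinf ?W (\<lambda>y. k (h y))"
    by (rule Cinf_compose[OF Cinf_subset[OF h(3) o] assms(3)]) auto
  moreover have "\<phi> p \<in> ?W" using h assms by auto
  ultimately have "ext_at U \<phi> S (\<lambda>x. k (g x)) p"
    unfolding ext_at_def using h(5) by (intro exI[of _ ?W] exI[of _ "\<lambda>y. k (h y)"]) auto
  then show ?thesis unfolding smooth_at_def using h(1,2) by blast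
qed

lemma smooth_at_Pair:
  assumes "smooth_at N S f p" "smooth_at N S g p"
  shows "smooth_at N S (\<lambda>x. (f x, g x)) p"
proof -
  obtain U \<phi> W h where h: "(U, \<phi>) \<in> atlas N" "p \<in> U" "Cinf W h" "\<phi> p \<in> W"
    "\<And>x. x \<in> S \<inter> U \<Longrightarrow> \<phi> x \<in> W \<Longrightarrow> h (\<phi> x) = f x"
    using assms(1) unfolding smooth_at_def ext_at_def by fast
  have "ext_at U \<phi> S g p"
    using smooth_at_chart assms(2) h atlas_smooth_charts by blast
  then obtain V k where k: "Cinf V k" "\<phi> p \<in> V" "\<And>x. x \<in> S \<inter> U \<Longrightarrow> \<phi> x \<in> V \<Longrightarrow> k (\<phi> x) = g x"
    unfolding ext_at_def by blast
  have o: "open (W \<inter> V)" by (intro open_Int Cinf_open[OF h(3)] Cinf_open[OF k(1)])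
  have "Cinf (W \<inter> V) (\<lambda>y. (h y, k y))"
    by (intro Cinf_Pair Cinf_subset[OF h(3) o] Cinf_subset[OF k(1) o]) auto
  then have "ext_at U \<phi> S (\<lambda>x. (f x, g x)) p"
    unfolding ext_at_def using h k by (intro exI[of _ "W \<inter> V"] exI[of _ "\<lambda>y. (h y, k y)"]) auto
  then show ?thesis unfolding smooth_at_def using h(1,2) by blast
qed

lemma smooth_at_binop:
  fixes f :: "'a \<Rightarrow> 'b::euclidean_space" and g :: "'a \<Rightarrow> 'c::euclidean_space"
  assumes "smooth_at N S f p" "smooth_at N S g p" "p \<in> S" "Cinf UNIV (\<lambda>z. k (fst z) (snd z))"
  shows "smooth_at N S (\<lambda>x. k (f x) (g x)) p"
  using smooth_at_compose[OF smooth_at_Pair[OF assms(1,2)] assms(3,4)] by simp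

lemma smooth_at_const: "p \<in> X \<Longrightarrow> smooth_at N S (\<lambda>x. c) p"
  using atlas_cover[of p] Cinf_const[OF open_UNIV, of c] unfolding smooth_at_def ext_at_def by blast

lemma smooth_at_chart_map:
  assumes "(U, \<phi>) \<in> smooth_charts N" "p \<in> U"
  shows "smooth_at N U \<phi> p"
  by (rule smooth_atI[OF assms])
     (use Cinf_id[OF open_UNIV] in \<open>auto simp: ext_at_def intro!: exI[of _ UNIV] exI[of _ "\<lambda>x. x"]\<close>)

lemma smooth_at_subset: "smooth_at N S g p \<Longrightarrow> S' \<subseteq> S \<Longrightarrow> smooth_at N S' g p"
proof -
  assume a: "smooth_at N S g p" "S' \<subseteq> S"
  then obtain U \<phi> where u: "(U, \<phi>) \<in> atlas N" "p \<in> U" "ext_at U \<phi> S g p"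
    unfolding smooth_at_def by blast
  then have "ext_at U \<phi> S' g p" using a(2) unfolding ext_at_def by (meson IntD1 IntD2 IntI subsetD)
  then show ?thesis using u unfolding smooth_at_def by blast
qed

lemma smooth_at_local:
  assumes g: "smooth_at N S' g p" and O: "openin T V" "p \<in> V" "S \<inter> V \<subseteq> S'" "\<And>x. x \<in> S \<inter> V \<Longrightarrow> g x = g' x"
  shows "smooth_at N S g' p"
proof -
  obtain U \<phi> W h where h: "(U, \<phi>) \<in> atlas N" "p \<in> U" "Cinf W h" "\<phi> p \<in> W"
    "\<And>x. x \<in> S' \<inter> U \<Longrightarrow> \<phi> x \<in> W \<Longrightarrow> h (\<phi> x) = g x"
    using g unfolding smooth_at_def ext_at_def by fast
  have c: "(U, \<phi>) \<in> smooth_charts N" using h(1) atlas_smooth_charts by blast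
  obtain W' where W': "open W'" "\<phi> ` (U \<inter> V) = W' \<inter> half_space"
    using is_chart_image_open[OF smooth_charts_is_chart[OF c] O(1)] by blast
  have o: "open (W \<inter> W')" using Cinf_open[OF h(3)] W'(1) by blast
  have "h (\<phi> x) = g' x" if x: "x \<in> S \<inter> U" "\<phi> x \<in> W \<inter> W'" for x
  proof -
    have "\<phi> x \<in> \<phi> ` (U \<inter> V)" using x W'(2) chartD(4)[OF c] by auto
    then have "x \<in> V" using x chartD(3)[OF c] by (auto dest: inj_onD)
    then show ?thesis using x O h(5)[of x] by auto
  qed
  moreover have "\<phi> p \<in> W \<inter> W'" using h O(2) W'(2) by auto
  ultimately have "ext_at U \<phi> S g' p"
    unfolding ext_at_def using Cinf_subset[OF h(3) o] by blast
  then show ?thesis unfolding smooth_at_def using h(1,2) by blast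
qed

lemma smooth_in_compose:
  fixes g :: "'a \<Rightarrow> 'b::euclidean_space"
  assumes "smooth_in N S g" "Cinf V k" "\<And>x. x \<in> S \<Longrightarrow> g x \<in> V"
  shows "smooth_in N S (\<lambda>x. k (g x))"
  unfolding smooth_in_def
proof
  fix p assume p: "p \<in> S"
  show "smooth_at N S (\<lambda>x. k (g x)) p"
    by (rule smooth_at_compose[OF _ p assms(2)]) (use assms p in \<open>auto simp: smooth_in_def\<close>)
qed

lemma smooth_in_binop:
  fixes f :: "'a \<Rightarrow> 'b::euclidean_space" and g :: "'a \<Rightarrow> 'c::euclidean_space"
  assumes "smooth_in N S f" "smooth_in N S g" "Cinf UNIV (\<lambda>z. k (fst z) (snd z))"
  shows "smooth_in N S (\<lambda>x. k (f x) (g x))"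
  unfolding smooth_in_def
proof
  fix p assume p: "p \<in> S"
  show "smooth_at N S (\<lambda>x. k (f x) (g x)) p"
    by (rule smooth_at_binop[OF _ _ p assms(3)]) (use assms p in \<open>auto simp: smooth_in_def\<close>)
qed

lemma smooth_in_add:
  fixes f g :: "'a \<Rightarrow> 'b::euclidean_space"
  shows "smooth_in N S f \<Longrightarrow> smooth_in N S g \<Longrightarrow> smooth_in N S (\<lambda>x. f x + g x)"
  by (rule smooth_in_binop[where k="(+)"])
    (auto intro: Cinf_add[OF Cinf_fst[OF Cinf_id[OF open_UNIV]] Cinf_snd[OF Cinf_id[OF open_UNIV]]])

lemma smooth_in_diff:
  fixes f g :: "'a \<Rightarrow> 'b::euclidean_space"
  shows "smooth_in N S f \<Longrightarrow> smooth_in N S g \<Longrightarrow> smooth_in N S (\<lambda>x. f x - g x)"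
  by (rule smooth_in_binop[where k="(-)"])
    (auto intro: Cinf_diff[OF Cinf_fst[OF Cinf_id[OF open_UNIV]] Cinf_snd[OF Cinf_id[OF open_UNIV]]])

lemma smooth_in_mult:
  fixes f g :: "'a \<Rightarrow> real"
  shows "smooth_in N S f \<Longrightarrow> smooth_in N S g \<Longrightarrow> smooth_in N S (\<lambda>x. f x * g x)"
  by (rule smooth_in_binop[where k="(*)"])
    (auto intro: Cinf_mult[OF Cinf_fst[OF Cinf_id[OF open_UNIV]] Cinf_snd[OF Cinf_id[OF open_UNIV]]])

lemma smooth_in_scaleR:
  fixes f :: "'a \<Rightarrow> real" and g :: "'a \<Rightarrow> 'b::euclidean_space"
  shows "smooth_in N S f \<Longrightarrow> smooth_in N S g \<Longrightarrow> smooth_in N S (\<lambda>x. f x *\<^sub>R g x)"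
  by (rule smooth_in_binop[where k="(*\<^sub>R)"])
    (auto intro: Cinf_scaleR[OF Cinf_fst[OF Cinf_id[OF open_UNIV]] Cinf_snd[OF Cinf_id[OF open_UNIV]]])

lemma smooth_in_const: "S \<subseteq> X \<Longrightarrow> smooth_in N S (\<lambda>x. c)"
  using smooth_at_const unfolding smooth_in_def by blast

lemma smooth_in_chart: "(U, \<phi>) \<in> smooth_charts N \<Longrightarrow> smooth_in N U \<phi>"
  using smooth_at_chart_map unfolding smooth_in_def by blast

lemma smooth_in_subset: "smooth_in N S g \<Longrightarrow> S' \<subseteq> S \<Longrightarrow> smooth_in N S' g"
  using smooth_at_subset unfolding smooth_in_def by blast

lemma smooth_in_sum:
  fixes f :: "'i \<Rightarrow> 'a \<Rightarrow> 'b::euclidean_space"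
  assumes "S \<subseteq> X" "\<And>i. i \<in> I \<Longrightarrow> smooth_in N S (f i)"
  shows "smooth_in N S (\<lambda>x. \<Sum>i\<in>I. f i x)"
  using assms by (induction I rule: infinite_finite_induct) (auto intro: smooth_in_const smooth_in_add)

lemma smooth_in_extend_zero:
  fixes g :: "'a \<Rightarrow> 'b::real_normed_vector"
  assumes "openin T U" "smooth_in N U g" "closedin T K" "K \<subseteq> U" "\<And>x. x \<notin> K \<Longrightarrow> g x = 0"
  shows "smooth_in N X g"
  unfolding smooth_in_def
proof
  fix x assume x: "x \<in> X"
  show "smooth_at N X g x"
  proof (cases "x \<in> U")
    case True
    then show ?thesis
      using smooth_at_local[of U g x U X g] assms(1,2) by (auto simp: smooth_in_def)
  next
    case False
    then have "x \<in> X - K" using x assms(4) by blast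
    moreover have "openin T (X - K)" using assms(3) by (simp add: closedin_def)
    ultimately show ?thesis
      using smooth_at_local[OF smooth_at_const[OF x, of X 0], of "X - K" X g] assms(5) by auto
  qed
qed

lemma smooth_in_continuous_map:
  assumes "smooth_in N X g" shows "continuous_map T euclidean g"
  unfolding continuous_map_def
proof (intro conjI allI impI)
  fix B :: "'b set" assume "openin euclidean B"
  then have B: "open B" by simp
  show "openin T {x \<in> X. g x \<in> B}"
    unfolding openin_subopen[of T "{x \<in> X. g x \<in> B}"]
  proof
    fix x assume x: "x \<in> {x \<in> X. g x \<in> B}"
    obtain U \<phi> W h where h: "(U, \<phi>) \<in> atlas N" "x \<in> U" "Cinf W h" "\<phi> x \<in> W"
      "\<And>x. x \<in> X \<inter> U \<Longrightarrow> \<phi> x \<in> W \<Longrightarrow> h (\<phi> x) = g x"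
      using assms x unfolding smooth_in_def smooth_at_def ext_at_def by fast
    have c: "(U, \<phi>) \<in> smooth_charts N" using h(1) atlas_smooth_charts by blast
    have "open (W \<inter> h -` B)"
      by (intro continuous_open_preimage Cinf_continuous_on[OF h(3)] Cinf_open[OF h(3)] B)
    then have "openin T {y \<in> U. \<phi> y \<in> W \<inter> h -` B}"
      using is_chart_vimage_open smooth_charts_is_chart c by blast
    then show "\<exists>V. openin T V \<and> x \<in> V \<and> V \<subseteq> {x \<in> X. g x \<in> B}"
      using h(2,4,5) x chartD(2)[OF c] by (intro exI conjI) (assumption, auto)
  qed
qed auto

end

text \<open>The direction \<open>v\<close> is a vector of the model space, not a tangent vector, so
  that one and the same \<open>v\<close> can be used at all points of the chart.\<close>

definition upward ::
    "'a set \<Rightarrow> ('a \<Rightarrow> 'c::real_normed_vector) \<Rightarrow> 'c \<Rightarrow> ('a \<Rightarrow> real) \<Rightarrow> 'a \<Rightarrow> bool" where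
  "upward U \<phi> v g p \<longleftrightarrow> p \<in> U \<and> (\<exists>W h. Cinf W h \<and> \<phi> p \<in> W \<and> (\<forall>x\<in>U. \<phi> x \<in> W \<longrightarrow> h (\<phi> x) = g x) \<and>
     0 < frechet_derivative h (at (\<phi> p)) v)"

text \<open>The manifold occupies the side of nonnegative last coordinate, so
  \<open>snd v < 0\<close> means that \<open>v\<close> points outwards. Pushing a sublevel set down
  along \<open>-v\<close> then stays inside.\<close>

definition increasing_at :: "('a, 'm::euclidean_space) manifold \<Rightarrow> ('a \<Rightarrow> real) \<Rightarrow> 'a \<Rightarrow> bool" where
  "increasing_at N g p \<longleftrightarrow>
    (\<exists>(U, \<phi>)\<in>smooth_charts N. \<exists>v. upward U \<phi> v g p \<and> (snd (\<phi> p) = 0 \<longrightarrow> snd v < 0))"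

lemma upwardI:
  assumes "p \<in> U" "Cinf W h" "\<phi> p \<in> W" "\<And>x. x \<in> U \<Longrightarrow> \<phi> x \<in> W \<Longrightarrow> h (\<phi> x) = g x"
    "0 < frechet_derivative h (at (\<phi> p)) v"
  shows "upward U \<phi> v g p"
  using assms unfolding upward_def by blast

lemma upward_nbhd:
  fixes \<phi> :: "'a \<Rightarrow> 'c::real_normed_vector"
  assumes "upward U \<phi> v g p"
  shows "\<exists>W. open W \<and> \<phi> p \<in> W \<and> (\<forall>x\<in>U. \<phi> x \<in> W \<longrightarrow> upward U \<phi> v g x)"
proof -
  obtain W h where h: "p \<in> U" "Cinf W h" "\<phi> p \<in> W" "\<And>x. x \<in> U \<Longrightarrow> \<phi> x \<in> W \<Longrightarrow> h (\<phi> x) = g x"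
    "0 < frechet_derivative h (at (\<phi> p)) v"
    using assms unfolding upward_def by blast
  let ?W = "W \<inter> (\<lambda>y. frechet_derivative h (at y) v) -` {0<..}"
  have "open ?W"
    by (intro continuous_open_preimage Cinf_continuous_on[OF Cinf_derivative[OF h(2)]] Cinf_open[OF h(2)] open_greaterThan)
  moreover have "upward U \<phi> v g x" if "x \<in> U" "\<phi> x \<in> ?W" for x
    using that h(2,4) by (intro upwardI[of _ _ W h]) auto
  ultimately show ?thesis using h(3,5) by (intro exI[of _ ?W]) auto
qed

section \<open>Bump functions and extensions in charts\<close>

context smooth_mfd
begin

lemma chart_cover: "p \<in> X \<Longrightarrow> \<exists>U \<phi>. (U, \<phi>) \<in> smooth_charts N \<and> p \<in> U"
  using atlas_cover atlas_smooth_charts by blast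

lemma manifold_boundary_subset: "manifold_boundary N \<subseteq> X"
  unfolding manifold_boundary_def using atlas_smooth_charts chartD(2) by blast

lemma manifold_boundary_chart:
  assumes "(U, \<phi>) \<in> smooth_charts N" "p \<in> U"
  shows "p \<in> manifold_boundary N \<longleftrightarrow> snd (\<phi> p) = 0"
proof
  assume "p \<in> manifold_boundary N"
  then obtain V \<psi> where V: "(V, \<psi>) \<in> atlas N" "p \<in> V" "snd (\<psi> p) = 0"
    unfolding manifold_boundary_def by blast
  then show "snd (\<phi> p) = 0"
    using is_chart_boundary[OF smooth_charts_is_chart smooth_charts_is_chart] assms atlas_smooth_charts by blast
next
  assume s: "snd (\<phi> p) = 0"
  obtain V \<psi> where V: "(V, \<psi>) \<in> atlas N" "p \<in> V"
    using atlas_cover assms chartD(2) by blast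
  then have "snd (\<psi> p) = 0"
    using is_chart_boundary[OF smooth_charts_is_chart smooth_charts_is_chart] assms atlas_smooth_charts s by blast
  then show "p \<in> manifold_boundary N" using V unfolding manifold_boundary_def by blast
qed

lemma chart_ball:
  assumes "(U, \<phi>) \<in> smooth_charts N" "p \<in> U" "openin T V" "p \<in> V"
  shows "\<exists>r>0. cball (\<phi> p) r \<inter> half_space \<subseteq> \<phi> ` (U \<inter> V)"
proof -
  obtain W where W: "open W" "\<phi> ` (U \<inter> V) = W \<inter> half_space"
    using is_chart_image_open[OF smooth_charts_is_chart[OF assms(1)] assms(3)] by blast
  then have "\<phi> p \<in> W" using assms by blast
  then obtain r where "0 < r" "cball (\<phi> p) r \<subseteq> W" using W(1) open_contains_cball by metis
  then show ?thesis using W(2) by auto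
qed

lemma chart_vimage_open: "(U, \<phi>) \<in> smooth_charts N \<Longrightarrow> open W \<Longrightarrow> openin T {x \<in> U. \<phi> x \<in> W}"
  using is_chart_vimage_open smooth_charts_is_chart by blast

lemma chart_vimage_compactin:
  "(U, \<phi>) \<in> smooth_charts N \<Longrightarrow> compact K \<Longrightarrow> K \<subseteq> \<phi> ` U \<Longrightarrow> compactin T {x \<in> U. \<phi> x \<in> K}"
  using is_chart_compactin smooth_charts_is_chart by blast

lemma chart_vimage_closedin:
  "(U, \<phi>) \<in> smooth_charts N \<Longrightarrow> compact K \<Longrightarrow> K \<subseteq> \<phi> ` U \<Longrightarrow> closedin T {x \<in> U. \<phi> x \<in> K}"
  by (rule compactin_imp_closedin[OF _ chart_vimage_compactin]) (use mfd in \<open>auto simp: smooth_manifold_def\<close>)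

lemma smooth_in_chart_compose:
  fixes h :: "'m \<times> real \<Rightarrow> 'b::real_normed_vector"
  assumes c: "(U, \<phi>) \<in> smooth_charts N" and h: "smooth_on S h" "\<And>x. x \<in> S' \<Longrightarrow> x \<in> U \<and> \<phi> x \<in> S"
  shows "smooth_in N S' (\<lambda>x. h (\<phi> x))"
  unfolding smooth_in_def
proof
  fix x assume x: "x \<in> S'"
  obtain W k where k: "Cinf W k" "\<phi> x \<in> W" "\<And>y. y \<in> S \<inter> W \<Longrightarrow> k y = h y"
    using h(1) h(2)[OF x] unfolding smooth_on_Cinf by meson
  have "ext_at U \<phi> S' (\<lambda>x. h (\<phi> x)) x"
    unfolding ext_at_def using k h(2) by blast
  then show "smooth_at N S' (\<lambda>x. h (\<phi> x)) x" using smooth_atI[OF c] h(2)[OF x] by blast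
qed

text \<open>A smooth step of the squared distance, which unlike the distance is smooth at the
  centre. The closed ball meets the half space in a compact part of the chart, which is closed in
  the manifold, so that extension by zero is smooth.\<close>

lemma chart_bump:
  assumes c: "(U, \<phi>) \<in> smooth_charts N" and r: "0 \<le> r0" "r0 < r1" and sub: "cball a r1 \<inter> half_space \<subseteq> \<phi> ` U"
  shows "\<exists>\<beta>::'a \<Rightarrow> real. smooth_in N X \<beta> \<and> (\<forall>x. 0 \<le> \<beta> x \<and> \<beta> x \<le> 1) \<and>
    (\<forall>x\<in>U. \<phi> x \<in> cball a r0 \<longrightarrow> \<beta> x = 1) \<and> (\<forall>x. \<beta> x \<noteq> 0 \<longrightarrow> x \<in> U \<and> \<phi> x \<in> ball a r1)"
proof -
  let ?b = "\<lambda>y. smooth_step ((r1\<^sup>2 - (y - a) \<bullet> (y - a)) / (r1\<^sup>2 - r0\<^sup>2))"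
  define \<beta> where "\<beta> x = (if x \<in> U then ?b (\<phi> x) else 0)" for x
  have pos: "0 < r1\<^sup>2 - r0\<^sup>2" using r by (simp add: power_strict_mono)
  have b: "Cinf UNIV ?b"
    by (intro Cinf_smooth_step Cinf_divide Cinf_intros open_UNIV) (use pos in auto)
  have b1: "?b y = 1" if "y \<in> cball a r0" for y
  proof (rule smooth_step_1)
    have "(norm (y - a))\<^sup>2 \<le> r0\<^sup>2" using that by (intro power_mono) (auto simp: dist_norm norm_minus_commute)
    then show "1 \<le> (r1\<^sup>2 - (y - a) \<bullet> (y - a)) / (r1\<^sup>2 - r0\<^sup>2)" using pos by (simp add: dot_square_norm)
  qed
  have b0: "?b y = 0" if "y \<notin> ball a r1" for y
  proof (rule smooth_step_0)
    have "r1\<^sup>2 \<le> (norm (y - a))\<^sup>2" using that r by (intro power_mono) (auto simp: dist_norm norm_minus_commute)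
    then show "(r1\<^sup>2 - (y - a) \<bullet> (y - a)) / (r1\<^sup>2 - r0\<^sup>2) \<le> 0"
      using pos by (simp add: dot_square_norm divide_nonpos_pos)
  qed
  have "smooth_in N U (\<lambda>x. ?b (\<phi> x))"
    by (rule smooth_in_chart_compose[OF c Cinf_smooth_on[OF b]]) auto
  then have "smooth_in N U \<beta>"
    unfolding smooth_in_def using smooth_at_local[of U "\<lambda>x. ?b (\<phi> x)" _ U U \<beta>] chartD(1)[OF c] by (simp add: \<beta>_def)
  then have "smooth_in N X \<beta>"
  proof (rule smooth_in_extend_zero[OF chartD(1)[OF c]])
    show "closedin T {x \<in> U. \<phi> x \<in> cball a r1 \<inter> half_space}"
      using sub by (intro chart_vimage_closedin[OF c]) (auto intro: compact_Int_closed closed_half_space)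
    show "\<beta> x = 0" if "x \<notin> {x \<in> U. \<phi> x \<in> cball a r1 \<inter> half_space}" for x
    proof (cases "x \<in> U")
      case True
      then have "\<phi> x \<notin> ball a r1" using that chartD(4)[OF c] by auto
      then show ?thesis using b0 True by (simp add: \<beta>_def)
    qed (simp add: \<beta>_def)
  qed auto
  moreover have "0 \<le> \<beta> x \<and> \<beta> x \<le> 1" for x by (simp add: \<beta>_def smooth_step_nonneg smooth_step_le_1)
  moreover have "\<beta> x = 1" if "x \<in> U" "\<phi> x \<in> cball a r0" for x
    unfolding \<beta>_def if_P[OF that(1)] by (rule b1[OF that(2)])
  moreover have "x \<in> U \<and> \<phi> x \<in> ball a r1" if "\<beta> x \<noteq> 0" for x
  proof (rule ccontr)
    assume "\<not> (x \<in> U \<and> \<phi> x \<in> ball a r1)"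
    then have "\<beta> x = 0" using b0[of "\<phi> x"] unfolding \<beta>_def by (cases "x \<in> U") simp_all
    then show False using that by simp
  qed
  ultimately show ?thesis by blast
qed

lemma chart_extension:
  fixes g :: "'a \<Rightarrow> 'b::real_normed_vector"
  assumes "(U, \<phi>) \<in> smooth_charts N" "p \<in> U" "smooth_in N X g"
  obtains W h where "Cinf W h" "\<phi> p \<in> W" "W \<inter> half_space \<subseteq> \<phi> ` U" "\<And>x. x \<in> U \<Longrightarrow> \<phi> x \<in> W \<Longrightarrow> h (\<phi> x) = g x"
proof -
  have "ext_at U \<phi> X g p"
    using smooth_at_chart assms chartD(2)[OF assms(1)] unfolding smooth_in_def by blast
  then obtain W h where h: "Cinf W h" "\<phi> p \<in> W" "\<And>x. x \<in> X \<inter> U \<Longrightarrow> \<phi> x \<in> W \<Longrightarrow> h (\<phi> x) = g x"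
    unfolding ext_at_def by blast
  obtain W' where W': "open W'" "\<phi> ` (U \<inter> U) = W' \<inter> half_space"
    using is_chart_image_open[OF smooth_charts_is_chart[OF assms(1)] chartD(1)[OF assms(1)]] by blast
  show ?thesis
  proof (rule that)
    show "Cinf (W \<inter> W') h" using W'(1) Cinf_open[OF h(1)] by (intro Cinf_subset[OF h(1)]) auto
  qed (use h W' assms(2) chartD(2)[OF assms(1)] in auto)
qed

end

text \<open>Since \<open>h\<close> vanishes along the boundary hyperplane, so do its tangential
  derivatives, and only the inner normal \<open>(0, 1)\<close> contributes; there the difference
  quotients from the right are nonnegative. It is applied to a boundary defining function and, on
  the disk, to \<open>1 - |x|^2\<close>.\<close>

lemma derivative_at_half_space_boundary:
  fixes h :: "'m::euclidean_space \<times> real \<Rightarrow> real"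
  assumes h: "Cinf W h" "y \<in> W" "snd y = 0"
    and 0: "\<And>z. z \<in> W \<Longrightarrow> snd z = 0 \<Longrightarrow> h z = 0" and nn: "\<And>z. z \<in> W \<Longrightarrow> 0 < snd z \<Longrightarrow> 0 \<le> h z"
  shows "frechet_derivative h (at y) v = snd v * frechet_derivative h (at y) (0, 1)"
    and "0 \<le> frechet_derivative h (at y) (0, 1)"
proof -
  let ?D = "frechet_derivative h (at y)"
  have lin: "linear ?D" using has_derivative_linear[OF Cinf_has_derivative[OF h(1,2)]] .
  have line: "((\<lambda>s. h (y + s *\<^sub>R w)) has_real_derivative ?D w) (at 0)" for w
    using DERIV_along_line[OF h(1), of y 0 w] h(2) by simp
  have ev: "\<forall>\<^sub>F s in at 0. y + s *\<^sub>R w \<in> W" for w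
  proof -
    have "((\<lambda>s. y + s *\<^sub>R w) \<longlongrightarrow> y) (at 0)" by (auto intro!: tendsto_eq_intros)
    then show ?thesis by (rule topological_tendstoD[OF _ Cinf_open[OF h(1)] h(2)])
  qed
  have hy: "h y = 0" using 0 h by blast
  have "?D (w, 0) = 0" for w
  proof -
    have "(h (y + s *\<^sub>R (w, 0)) - h y) / s = 0" if "y + s *\<^sub>R (w, 0) \<in> W" for s
    proof -
      have "h (y + s *\<^sub>R (w, 0)) = 0" by (rule 0[OF that]) (simp add: h(3))
      then show ?thesis by (simp only: hy diff_self div_0)
    qed
    then have "\<forall>\<^sub>F s in at 0. (h (y + s *\<^sub>R (w, 0)) - h y) / s = 0"
      by (rule eventually_mono[OF ev])
    then have l0: "((\<lambda>s. (h (y + s *\<^sub>R (w, 0)) - h y) / s) \<longlongrightarrow> 0) (at 0)"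
      by (rule tendsto_eventually)
    have "((\<lambda>s. (h (y + s *\<^sub>R (w, 0)) - h y) / s) \<longlongrightarrow> ?D (w, 0)) (at 0)"
      using line[of "(w, 0)"] by (simp only: DERIV_def add_0_left scaleR_zero_left add_0_right)
    from tendsto_unique[OF at_neq_bot this l0] show ?thesis .
  qed
  moreover have "v = (fst v, 0) + snd v *\<^sub>R (0, 1)" by (simp add: prod_eq_iff)
  then have "?D v = ?D (fst v, 0) + snd v *\<^sub>R ?D (0, 1)"
    using linear_add[OF lin] linear_scale[OF lin] by metis
  ultimately show "?D v = snd v * ?D (0, 1)" by simp
  have "((\<lambda>s. (h (y + s *\<^sub>R (0, 1)) - h y) / s) \<longlongrightarrow> ?D (0, 1)) (at_right 0)"
    using line[of "(0, 1)"] unfolding DERIV_def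
    by (simp only: add_0_left scaleR_zero_left add_0_right) (rule tendsto_mono[OF at_le], auto)
  moreover have "\<forall>\<^sub>F s in at_right 0. y + s *\<^sub>R (0, 1) \<in> W"
    using ev[of "(0, 1)"] by (rule filter_leD[OF at_le, rotated]) auto
  then have "\<forall>\<^sub>F s in at_right 0. 0 \<le> (h (y + s *\<^sub>R (0, 1)) - h y) / s"
    using eventually_at_right_less[of 0]
  proof eventually_elim
    case (elim s)
    have "0 \<le> h (y + s *\<^sub>R (0, 1))" by (rule nn[OF elim(1)]) (simp add: h(3) elim(2))
    then show ?case using elim(2) by (simp only: hy diff_0_right divide_nonneg_pos)
  qed
  ultimately show "0 \<le> ?D (0, 1)" by (rule tendsto_lowerbound) simp
qed

lemma Cinf_frechet_derivative_compose:
  fixes f :: "'a::real_normed_vector \<Rightarrow> 'b::real_normed_vector"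
  assumes "Cinf W f" "Cinf V g" "x \<in> W" "f x \<in> V"
  shows "frechet_derivative (\<lambda>x. g (f x)) (at x) v = frechet_derivative g (at (f x)) (frechet_derivative f (at x) v)"
  using frechet_derivativeI[OF has_derivative_compose[OF Cinf_has_derivative[OF assms(1,3)] Cinf_has_derivative[OF assms(2,4)]]]
  by simp

lemma Cinf_frechet_derivative_minus:
  assumes "Cinf W f" "x \<in> W"
  shows "frechet_derivative (\<lambda>x. - f x) (at x) v = - frechet_derivative f (at x) v"
  using frechet_derivativeI[OF has_derivative_minus[OF Cinf_has_derivative[OF assms]]] by simp

section \<open>Compact manifolds and a boundary defining function\<close>

locale compact_mfd = smooth_mfd N for N :: "('a, 'm::euclidean_space) manifold" +
  assumes cpt: "compact_space (mtop N)"
begin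

lemma closedin_finite_cover:
  assumes "closedin T K" "\<And>x. x \<in> K \<Longrightarrow> openin T (V x)" "\<And>x. x \<in> K \<Longrightarrow> x \<in> V x"
  shows "\<exists>F. finite F \<and> F \<subseteq> K \<and> K \<subseteq> (\<Union>x\<in>F. V x)"
proof -
  have "compactin T K" using assms(1) cpt closedin_compact_space by blast
  then obtain \<F> where F: "finite \<F>" "\<F> \<subseteq> V ` K" "K \<subseteq> \<Union>\<F>"
    using compactinD[of T K "V ` K"] assms(2,3) by blast
  then obtain F where "F \<subseteq> K" "finite F" "\<F> = V ` F" by (meson finite_subset_image)
  then show ?thesis using F by blast
qed

lemma continuous_attains_inf:
  fixes g :: "'a \<Rightarrow> real"
  assumes "smooth_in N X g" "closedin T K" "K \<noteq> {}"
  shows "\<exists>x\<in>K. \<forall>y\<in>K. g x \<le> g y"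
proof -
  have "compactin T K" using assms(2) cpt closedin_compact_space by blast
  then have "compact (g ` K)"
    using image_compactin[OF _ smooth_in_continuous_map[OF assms(1)]] by simp
  then show ?thesis using compact_attains_inf[of "g ` K"] assms(3) by auto
qed

lemma smooth_in_openin_less:
  fixes g :: "'a \<Rightarrow> real"
  assumes "smooth_in N X g"
  shows "openin T {x \<in> X. c < g x}" "openin T {x \<in> X. g x < c}"
proof -
  have "openin T {x \<in> X. g x \<in> B}" if "open B" for B
    using smooth_in_continuous_map[OF assms] that unfolding continuous_map_def by simp
  from this[of "{c<..}"] this[of "{..<c}"]
  show "openin T {x \<in> X. c < g x}" "openin T {x \<in> X. g x < c}" by simp_all
qed

lemma smooth_in_closedin_le:
  fixes g :: "'a \<Rightarrow> real"
  assumes "smooth_in N X g"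
  shows "closedin T {x \<in> X. c \<le> g x}" "closedin T {x \<in> X. g x \<le> c}"
proof -
  have "X - {x \<in> X. c \<le> g x} = {x \<in> X. g x < c}" "X - {x \<in> X. g x \<le> c} = {x \<in> X. c < g x}" by auto
  then show "closedin T {x \<in> X. c \<le> g x}" "closedin T {x \<in> X. g x \<le> c}"
    using smooth_in_openin_less[OF assms, of c] by (auto simp: closedin_def)
qed

text \<open>One summand of the boundary defining function: the last coordinate of a chart, cut off
  by a bump.\<close>

lemma boundary_function_local:
  assumes "p \<in> X"
  shows "\<exists>U \<phi> \<beta>. (U, \<phi>) \<in> smooth_charts N \<and> p \<in> U \<and> smooth_in N X (\<beta> :: 'a \<Rightarrow> real) \<and> \<beta> p = 1 \<and>
    (\<forall>x. 0 \<le> \<beta> x) \<and> (\<forall>x. \<beta> x \<noteq> 0 \<longrightarrow> x \<in> U) \<and> smooth_in N X (\<lambda>x. \<beta> x * snd (\<phi> x))"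
proof -
  obtain U \<phi> where c: "(U, \<phi>) \<in> smooth_charts N" "p \<in> U" using chart_cover assms by blast
  obtain r where r: "0 < r" "cball (\<phi> p) r \<inter> half_space \<subseteq> \<phi> ` U"
    using chart_ball[OF c chartD(1)[OF c(1)] c(2)] by auto
  obtain \<beta> :: "'a \<Rightarrow> real" where b: "smooth_in N X \<beta>" "\<And>x. 0 \<le> \<beta> x" "\<And>x. x \<in> U \<Longrightarrow> \<phi> x \<in> cball (\<phi> p) 0 \<Longrightarrow> \<beta> x = 1"
    "\<And>x. \<beta> x \<noteq> 0 \<Longrightarrow> x \<in> U \<and> \<phi> x \<in> ball (\<phi> p) r"
    using chart_bump[OF c(1), of 0 r "\<phi> p"] r by auto
  have "smooth_in N U (\<lambda>x. snd (\<phi> x))"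
    by (rule smooth_in_compose[OF smooth_in_chart[OF c(1)] Cinf_snd[OF Cinf_id[OF open_UNIV]]]) simp
  then have "smooth_in N U (\<lambda>x. \<beta> x * snd (\<phi> x))"
    by (intro smooth_in_mult smooth_in_subset[OF b(1)] chartD(2)[OF c(1)])
  then have "smooth_in N X (\<lambda>x. \<beta> x * snd (\<phi> x))"
  proof (rule smooth_in_extend_zero[OF chartD(1)[OF c(1)]])
    show "closedin T {x \<in> U. \<phi> x \<in> cball (\<phi> p) r \<inter> half_space}"
      using r by (intro chart_vimage_closedin[OF c(1)] compact_Int_closed closed_half_space) auto
    show "\<beta> x * snd (\<phi> x) = 0" if "x \<notin> {x \<in> U. \<phi> x \<in> cball (\<phi> p) r \<inter> half_space}" for x
    proof -
      have "\<beta> x = 0"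
      proof (rule ccontr)
        assume "\<beta> x \<noteq> 0"
        then show False using b(4)[of x] that chartD(4)[OF c(1)] by auto
      qed
      then show ?thesis by simp
    qed
  qed auto
  moreover have "\<beta> p = 1" using b(3)[OF c(2)] by simp
  ultimately show ?thesis using b(1,2,4) c by (intro exI[of _ U] exI[of _ \<phi>] exI[of _ \<beta>]) simp
qed

text \<open>Finitely many cut-off last coordinates are added; all are nonnegative, and at each point
  one of the bumps exceeds \<open>1 / 2\<close>. The last clause covers every chart and every
  outward vector because in its application the vector is dictated by another function.\<close>

theorem boundary_function:
  "\<exists>d::'a \<Rightarrow> real. smooth_in N X d \<and> (\<forall>x\<in>X. 0 \<le> d x) \<and> (\<forall>x\<in>X. d x = 0 \<longleftrightarrow> x \<in> manifold_boundary N) \<and>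
    (\<forall>U \<phi> p v. (U, \<phi>) \<in> smooth_charts N \<longrightarrow> p \<in> U \<longrightarrow> snd (\<phi> p) = 0 \<longrightarrow> snd v < 0 \<longrightarrow> upward U \<phi> v (\<lambda>x. - d x) p)"
proof -
  define Q where "Q p U \<phi> \<beta> \<longleftrightarrow> (U, \<phi>) \<in> smooth_charts N \<and> p \<in> U \<and> smooth_in N X (\<beta> :: 'a \<Rightarrow> real) \<and> \<beta> p = 1 \<and>
    (\<forall>x. 0 \<le> \<beta> x) \<and> (\<forall>x. \<beta> x \<noteq> 0 \<longrightarrow> x \<in> U) \<and> smooth_in N X (\<lambda>x. \<beta> x * snd (\<phi> x))" for p U \<phi> \<beta>
  have "\<forall>p\<in>X. \<exists>U \<phi> \<beta>. Q p U \<phi> \<beta>"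
    unfolding Q_def using boundary_function_local by (intro ballI)
  then obtain U \<phi> \<beta> where loc: "\<forall>p\<in>X. Q p (U p) (\<phi> p) (\<beta> p)"
    by metis
  note loc = loc[unfolded Q_def]
  define V where "V p = {x \<in> X. 1 / 2 < \<beta> p x}" for p
  obtain F where F: "finite F" "F \<subseteq> X" "X \<subseteq> (\<Union>p\<in>F. V p)"
  proof -
    have "openin T (V p)" "p \<in> V p" if "p \<in> X" for p
      using that loc smooth_in_openin_less[of "\<beta> p" "1 / 2"] by (auto simp: V_def)
    then show ?thesis using closedin_finite_cover[of X V] that by auto
  qed
  define e where "e p x = \<beta> p x * snd (\<phi> p x)" for p x
  define d where "d x = (\<Sum>p\<in>F. e p x)" for x
  have e_nonneg: "0 \<le> e p x" if "p \<in> F" for p x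
  proof (cases "x \<in> U p")
    case True
    then have "0 \<le> snd (\<phi> p x)" using chartD(6) loc that F(2) by blast
    then show ?thesis using loc that F(2) by (auto simp: e_def)
  next
    case False
    then have "\<beta> p x = 0" using loc that F(2) by blast
    then show ?thesis by (simp add: e_def)
  qed
  have d_nonneg: "0 \<le> d x" for x unfolding d_def using e_nonneg by (simp add: sum_nonneg)
  have e_le_d: "e p x \<le> d x" if "p \<in> F" for p x
    unfolding d_def by (rule member_le_sum[OF that _ F(1)]) (auto intro: e_nonneg)
  have d: "smooth_in N X d"
    unfolding d_def e_def
    by (rule smooth_in_sum) (use loc F(2) in auto)
  have d0: "d x = 0 \<longleftrightarrow> x \<in> manifold_boundary N" if x: "x \<in> X" for x
  proof
    assume "d x = 0"
    obtain p where p: "p \<in> F" "x \<in> V p" using F(3) x by blast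
    then have "e p x = 0" using e_le_d e_nonneg \<open>d x = 0\<close> by (metis order_antisym)
    moreover have "0 < \<beta> p x" using p(2) by (simp add: V_def)
    ultimately have "snd (\<phi> p x) = 0" "x \<in> U p" using loc p(1) F(2) by (auto simp: e_def)
    then show "x \<in> manifold_boundary N" using manifold_boundary_chart loc p(1) F(2) by blast
  next
    assume b: "x \<in> manifold_boundary N"
    have "e p x = 0" if "p \<in> F" for p
    proof (cases "x \<in> U p")
      case True
      then have "snd (\<phi> p x) = 0" using manifold_boundary_chart loc that F(2) b by blast
      then show ?thesis by (simp add: e_def)
    next
      case False
      then have "\<beta> p x = 0" using loc that F(2) by blast
      then show ?thesis by (simp add: e_def)
    qed
    then show "d x = 0" by (simp add: d_def)
  qed
  have up: "upward U' \<phi>' v (\<lambda>x. - d x) p"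
    if c: "(U', \<phi>') \<in> smooth_charts N" "p \<in> U'" and p0: "snd (\<phi>' p) = 0" and v: "snd v < 0" for U' \<phi>' p v
  proof -
    have pX: "p \<in> X" using c chartD(2) by blast
    have dp: "d p = 0" using d0[OF pX] manifold_boundary_chart[OF c] p0 by blast
    obtain W h where h: "Cinf W h" "\<phi>' p \<in> W" "W \<inter> half_space \<subseteq> \<phi>' ` U'" "\<And>x. x \<in> U' \<Longrightarrow> \<phi>' x \<in> W \<Longrightarrow> h (\<phi>' x) = d x"
      using chart_extension[OF c d] by metis
    have hz: "\<exists>x\<in>U'. z = \<phi>' x \<and> h z = d x" if "z \<in> W" "0 \<le> snd z" for z
      using that h(3,4) by (auto simp: half_space_def)
    have h0: "h z = 0" if z: "z \<in> W" "snd z = 0" for z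
    proof -
      obtain x where x: "x \<in> U'" "z = \<phi>' x" "h z = d x" using hz[of z] z by auto
      then have "x \<in> manifold_boundary N" using manifold_boundary_chart[OF c(1)] z(2) by blast
      then show ?thesis using x d0 chartD(2)[OF c(1)] by auto
    qed
    have hn: "0 \<le> h z" if "z \<in> W" "0 < snd z" for z
      using hz[of z] that d_nonneg by auto
    let ?D = "frechet_derivative h (at (\<phi>' p))"
    note D = derivative_at_half_space_boundary[OF h(1,2) p0 h0 hn]
    \<comment> \<open>Otherwise the whole derivative of \<open>d\<close> at \<open>p\<close> would
      vanish. But in the chart of a summand \<open>q\<close> whose bump exceeds \<open>1 / 2\<close>
      near \<open>p\<close>, the point at height \<open>s\<close> above \<open>p\<close> has
      \<open>d \<ge> s / 2\<close>, so the difference quotient along the inner normal cannot tend to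
      0.\<close>
    have "?D (0, 1) \<noteq> 0"
    proof
      assume "?D (0, 1) = 0"
      then have D0: "?D w = 0" for w using D(1)[of w] by simp
      obtain q where q: "q \<in> F" "p \<in> V q" using F(3) pX by blast
      have qX: "q \<in> X" using q(1) F(2) by blast
      have cq: "(U q, \<phi> q) \<in> smooth_charts N" using loc qX by blast
      have "0 < \<beta> q p" using q(2) by (simp add: V_def)
      then have pq: "p \<in> U q" using loc qX by (metis less_irrefl)
      have "smooth_at N U' \<phi>' p" by (rule smooth_at_chart_map[OF c])
      then have "ext_at (U q) (\<phi> q) U' \<phi>' p" by (rule smooth_at_chart[OF _ cq pq])
      then obtain W1 \<tau> where t: "Cinf W1 \<tau>" "\<phi> q p \<in> W1" "\<And>x. x \<in> U' \<Longrightarrow> x \<in> U q \<Longrightarrow> \<phi> q x \<in> W1 \<Longrightarrow> \<tau> (\<phi> q x) = \<phi>' x"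
        unfolding ext_at_def by auto
      have "openin T (U' \<inter> V q)"
        unfolding V_def
        by (rule openin_Int[OF chartD(1)[OF c(1)] smooth_in_openin_less(1)]) (use loc qX in blast)
      then obtain W2 where W2: "open W2" "\<phi> q ` (U q \<inter> (U' \<inter> V q)) = W2 \<inter> half_space"
        using is_chart_image_open[OF smooth_charts_is_chart[OF cq]] by blast
      define O' where "O' = (W1 \<inter> W2) \<inter> \<tau> -` W"
      have oO: "open O'"
        unfolding O'_def using Cinf_open[OF t(1)] Cinf_open[OF h(1)] W2(1)
        by (intro continuous_open_preimage continuous_on_subset[OF Cinf_continuous_on[OF t(1)]] open_Int) auto
      have "\<tau> (\<phi> q p) = \<phi>' p" using t c(2) pq by blast
      then have pO: "\<phi> q p \<in> O'" using t(2) h(2) W2(2) pq c(2) q(2) by (auto simp: O'_def)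
      have Ck: "Cinf O' (\<lambda>y. h (\<tau> y))"
        by (rule Cinf_compose[OF Cinf_subset[OF t(1) oO] h(1)]) (auto simp: O'_def)
      have "frechet_derivative (\<lambda>y. h (\<tau> y)) (at (\<phi> q p)) (0, 1) = 0"
        using Cinf_frechet_derivative_compose[OF t(1) h(1) t(2), of "(0, 1)"] h(2) D0 \<open>\<tau> (\<phi> q p) = \<phi>' p\<close> by simp
      then have der: "((\<lambda>s. h (\<tau> (\<phi> q p + s *\<^sub>R (0, 1)))) has_real_derivative 0) (at 0)"
        using DERIV_along_line[OF Ck, of "\<phi> q p" 0 "(0, 1)"] pO by (simp only: scaleR_zero_left add_0_right)
      have k0: "h (\<tau> (\<phi> q p)) = 0" using \<open>\<tau> (\<phi> q p) = \<phi>' p\<close> h(4)[OF c(2) h(2)] dp by simp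
      have "((\<lambda>s. h (\<tau> (\<phi> q p + s *\<^sub>R (0, 1))) / s) \<longlongrightarrow> 0) (at 0)"
        using der unfolding DERIV_def by (simp only: add_0_left scaleR_zero_left add_0_right k0 diff_0_right)
      then have lim: "((\<lambda>s. h (\<tau> (\<phi> q p + s *\<^sub>R (0, 1))) / s) \<longlongrightarrow> 0) (at_right 0)"
        by (rule tendsto_mono[OF at_le, rotated]) auto
      have s0: "snd (\<phi> q p) = 0"
        using manifold_boundary_chart[OF cq pq] manifold_boundary_chart[OF c] p0 by blast
      have "((\<lambda>s. \<phi> q p + s *\<^sub>R (0, 1)) \<longlongrightarrow> \<phi> q p) (at_right 0)"
        by (auto intro!: tendsto_eq_intros simp: zero_prod_def)
      then have "\<forall>\<^sub>F s in at_right 0. \<phi> q p + s *\<^sub>R (0, 1) \<in> O'" by (rule topological_tendstoD[OF _ oO pO])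
      then have "\<forall>\<^sub>F s in at_right 0. 1 / 2 \<le> h (\<tau> (\<phi> q p + s *\<^sub>R (0, 1))) / s"
        using eventually_at_right_less[of 0]
      proof eventually_elim
        case (elim s)
        let ?y = "\<phi> q p + s *\<^sub>R (0, 1)"
        have sy: "snd ?y = s" using s0 by simp
        then have "?y \<in> W2 \<inter> half_space" using elim by (auto simp: O'_def half_space_def)
        then obtain x where x: "x \<in> U q" "x \<in> U'" "x \<in> V q" "?y = \<phi> q x" using W2(2) by blast
        have "\<tau> ?y = \<phi>' x" "\<tau> ?y \<in> W" using t(3)[OF x(2,1)] x(4) elim(1) by (auto simp: O'_def)
        then have "h (\<tau> ?y) = d x" using h(4)[OF x(2)] by simp
        moreover have "e q x \<le> d x" by (rule e_le_d[OF q(1)])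
        moreover have "e q x = \<beta> q x * s" using sy unfolding x(4) e_def by (simp only:)
        moreover have "1 / 2 * s \<le> \<beta> q x * s" using x(3) elim(2) by (intro mult_right_mono) (auto simp: V_def)
        ultimately have "1 / 2 * s \<le> h (\<tau> ?y)" by linarith
        then show ?case using elim(2) by (simp add: field_simps)
      qed
      from tendsto_lowerbound[OF lim this] show False by simp
    qed
    then have "?D v < 0" using D(1)[of v] D(2) v by (simp add: mult_neg_pos)
    then have "0 < frechet_derivative (\<lambda>y. - h y) (at (\<phi>' p)) v"
      using Cinf_frechet_derivative_minus[OF h(1,2)] by simp
    then show ?thesis
      by (intro upwardI[of p U' W "\<lambda>y. - h y" \<phi>'] c(2) Cinf_minus[OF h(1)] h(2)) (use h(4) in auto)
  qed
  show ?thesis using d d_nonneg d0 up by (intro exI[of _ d]) blast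
qed

end

section \<open>Critical points and boundary values\<close>

text \<open>The normal form of a boundary definite fold for \<open>k = 1\<close>, where the squares
  run over all coordinates but the last.\<close>

definition fold_form :: "'m::euclidean_space \<times> real \<Rightarrow> real" where
  "fold_form y = fst y \<bullet> fst y + snd y"

lemma Cinf_fold_form: "open W \<Longrightarrow> Cinf W fold_form"
  unfolding fold_form_def by (intro Cinf_intros)

lemma fold_form_has_derivative:
  "(fold_form has_derivative (\<lambda>w. 2 * (fst y \<bullet> fst w) + snd w)) (at y)"
  unfolding fold_form_def by (auto intro!: derivative_eq_intros simp: inner_commute)

text \<open>Here \<open>\<theta>\<close> is the inverse of the coordinate on the target line. Its
  positive derivative says that this coordinate preserves the orientation, and as the fold form is
  nonnegative on the half space, \<open>p\<close> is a local minimum. The opposite sign gives a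
  local maximum.\<close>

definition minimum_fold :: "('a, 'm::euclidean_space) manifold \<Rightarrow> ('a \<Rightarrow> real) \<Rightarrow> 'a \<Rightarrow> bool" where
  "minimum_fold N F p \<longleftrightarrow> (\<exists>(U, \<phi>)\<in>smooth_charts N. p \<in> U \<and> \<phi> p = 0 \<and> (\<exists>W \<theta>. Cinf W \<theta> \<and> 0 \<in> W \<and>
     (\<forall>t\<in>W. 0 < frechet_derivative \<theta> (at t) (1::real)) \<and>
     (\<forall>x\<in>U. fold_form (\<phi> x) \<in> W \<longrightarrow> F x = \<theta> (fold_form (\<phi> x)))))"

lemma frechet_derivative_real_compose:
  fixes \<theta> :: "real \<Rightarrow> real"
  assumes "Cinf W \<theta>" "g y \<in> W" "(g has_derivative g') (at y)"
  shows "((\<lambda>y. \<theta> (g y)) has_derivative (\<lambda>w. frechet_derivative \<theta> (at (g y)) 1 * g' w)) (at y)"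
proof -
  note d = Cinf_has_derivative[OF assms(1,2)]
  have "frechet_derivative \<theta> (at (g y)) t = frechet_derivative \<theta> (at (g y)) 1 * t" for t
    using linear_scale[OF has_derivative_linear[OF d], of t 1] by simp
  then show ?thesis
    by (intro has_derivative_eq_rhs[OF has_derivative_compose[OF assms(3) d]] ext)
qed

context compact_mfd
begin

lemma increasing_at_cong:
  assumes "increasing_at N g x" "openin T V" "x \<in> V" "\<And>y. y \<in> V \<Longrightarrow> g y = g' y"
  shows "increasing_at N g' x"
proof -
  obtain U \<phi> v where c: "(U, \<phi>) \<in> smooth_charts N" "upward U \<phi> v g x" "snd (\<phi> x) = 0 \<longrightarrow> snd v < 0"
    using assms(1) unfolding increasing_at_def by blast
  obtain W h where h: "x \<in> U" "Cinf W h" "\<phi> x \<in> W" "\<And>x. x \<in> U \<Longrightarrow> \<phi> x \<in> W \<Longrightarrow> h (\<phi> x) = g x"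
    "0 < frechet_derivative h (at (\<phi> x)) v"
    using c(2) unfolding upward_def by blast
  obtain W' where W': "open W'" "\<phi> ` (U \<inter> V) = W' \<inter> half_space"
    using is_chart_image_open[OF smooth_charts_is_chart[OF c(1)] assms(2)] by blast
  have "h (\<phi> y) = g' y" if y: "y \<in> U" "\<phi> y \<in> W \<inter> W'" for y
  proof -
    have "\<phi> y \<in> \<phi> ` (U \<inter> V)" using y W'(2) chartD(4)[OF c(1)] by auto
    then have "y \<in> V" using y chartD(3)[OF c(1)] by (auto dest: inj_onD)
    then show ?thesis using y h(4)[of y] assms(4)[of y] by auto
  qed
  moreover have "\<phi> x \<in> W \<inter> W'" using h W'(2) assms(3) by auto
  moreover have "Cinf (W \<inter> W') h" using Cinf_open[OF h(2)] W'(1) by (intro Cinf_subset[OF h(2)]) auto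
  ultimately have "upward U \<phi> v g' x"
    unfolding upward_def using h(1,5) by (intro conjI exI[of _ "W \<inter> W'"] exI[of _ h]) auto
  then show ?thesis using c unfolding increasing_at_def by blast
qed

lemma increasing_at_open:
  assumes "increasing_at N g p"
  shows "\<exists>V. openin T V \<and> p \<in> V \<and> (\<forall>x\<in>V. increasing_at N g x)"
proof -
  obtain U \<phi> v where c: "(U, \<phi>) \<in> smooth_charts N" "upward U \<phi> v g p" "snd (\<phi> p) = 0 \<longrightarrow> snd v < 0"
    using assms unfolding increasing_at_def by blast
  obtain W where W: "open W" "\<phi> p \<in> W" "\<And>x. x \<in> U \<Longrightarrow> \<phi> x \<in> W \<Longrightarrow> upward U \<phi> v g x"
    using upward_nbhd[OF c(2)] by blast
  have pU: "p \<in> U" using c(2) unfolding upward_def by blast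
  \<comment> \<open>At an interior point \<open>v\<close> may point anywhere, so the neighbourhood
    must avoid the boundary; at a boundary point \<open>v\<close> is outward and serves for all
    nearby points.\<close>
  define W' where "W' = (if snd (\<phi> p) = 0 then W else W \<inter> {y. 0 < snd y})"
  have oW': "open W'"
    unfolding W'_def using W(1) by (auto intro!: open_Int open_Collect_less continuous_intros)
  have "0 \<le> snd (\<phi> p)" using chartD(6)[OF c(1) pU] .
  then have pW': "\<phi> p \<in> W'" using W(2) by (auto simp: W'_def)
  have "increasing_at N g x" if x: "x \<in> {x \<in> U. \<phi> x \<in> W'}" for x
  proof -
    have "upward U \<phi> v g x" using x W(3)[of x] by (auto simp: W'_def split: if_splits)
    moreover have "snd (\<phi> x) = 0 \<longrightarrow> snd v < 0" using x c(3) by (auto simp: W'_def split: if_splits)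
    ultimately show ?thesis using c(1) unfolding increasing_at_def by blast
  qed
  then show ?thesis
    using chart_vimage_open[OF c(1) oW'] pW' pU by (intro exI[of _ "{x \<in> U. \<phi> x \<in> W'}"]) auto
qed

text \<open>Inside the fold chart the function is replaced by \<open>|y - (0, \<delta>)|\<^sup>2 + C\<close> for small values of the fold
  form, which moves the boundary minimum to an interior nondegenerate one. The interpolation creates no
  further critical points, as both functions increase along the rays from \<open>(0, \<delta>)\<close>.\<close>

lemma absorb_fold:
  assumes F: "smooth_in N X F" and C: "\<And>x. x \<in> X \<Longrightarrow> C + 1 \<le> F x"
    and c: "(U, \<phi>) \<in> smooth_charts N" "p \<in> U" "\<phi> p = 0" and V: "openin T V" "p \<in> V"
    and th: "Cinf W \<theta>" "0 \<in> W" "\<And>t. t \<in> W \<Longrightarrow> 0 < frechet_derivative \<theta> (at t) (1::real)"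
    and F\<theta>: "\<And>x. x \<in> U \<Longrightarrow> fold_form (\<phi> x) \<in> W \<Longrightarrow> F x = \<theta> (fold_form (\<phi> x))"
  shows "\<exists>\<Delta> K z r. smooth_in N X \<Delta> \<and> closedin T K \<and> K \<subseteq> U \<inter> V \<and> p \<in> K \<and> (\<forall>x. x \<notin> K \<longrightarrow> \<Delta> x = 0) \<and>
    (\<forall>x\<in>K - {z}. increasing_at N (\<lambda>x. F x + \<Delta> x) x) \<and> z \<in> U \<and> 0 < r \<and>
    cball (\<phi> z) r \<subseteq> \<phi> ` U \<inter> {y. 0 < snd y} \<and>
    (\<forall>x\<in>U. \<phi> x \<in> cball (\<phi> z) r \<longrightarrow> x \<in> K \<and> F x + \<Delta> x = (dist (\<phi> z) (\<phi> x))\<^sup>2 + C)"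
proof -
  obtain r0 where r0: "0 < r0" "cball (\<phi> p) r0 \<inter> half_space \<subseteq> \<phi> ` (U \<inter> V)"
    using chart_ball[OF c(1,2) V] by blast
  obtain \<kappa> where \<kappa>: "0 < \<kappa>" "ball 0 \<kappa> \<subseteq> W" using th(2) Cinf_open[OF th(1)] open_contains_ball by metis
  \<comment> \<open>The modification takes place where the fold form is at most
    \<open>3 * \<delta>\<close>. The bound \<open>1 / 5\<close> yields
    \<open>Q \<le> 5 * \<delta> \<le> 1\<close> there. Where the form is at most
    \<open>4 * \<delta>\<close>, the squared norm is at most
    \<open>4 * \<delta> + (4 * \<delta>)^2 \<le> 8 * \<delta>\<close>, so \<open>r0^2 / 8\<close>
    keeps these points in the chart; \<open>\<kappa> / 8\<close> keeps their fold values in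
    \<open>W\<close>.\<close>
  define \<delta> where "\<delta> = min (1 / 5) (min (r0\<^sup>2 / 8) (\<kappa> / 8))"
  have \<delta>: "0 < \<delta>" "\<delta> \<le> 1 / 5" "8 * \<delta> \<le> r0\<^sup>2" "8 * \<delta> \<le> \<kappa>"
    using r0(1) \<kappa>(1) by (auto simp: \<delta>_def)
  define a :: "'m \<times> real" where "a = (0, \<delta>)"
  have coord: "fst y \<bullet> fst y \<le> fold_form y" "snd y \<le> fold_form y" "0 \<le> fold_form y" if "0 \<le> snd y" for y :: "'m \<times> real"
    using that by (auto simp: fold_form_def)
  have norm_bound: "norm y \<le> r0" if y: "0 \<le> snd y" "fold_form y \<le> 4 * \<delta>" for y :: "'m \<times> real"
  proof -
    have "(norm y)\<^sup>2 = fst y \<bullet> fst y + (snd y)\<^sup>2"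
      by (simp add: norm_prod_def dot_square_norm)
    moreover have "(snd y)\<^sup>2 \<le> (4 * \<delta>)\<^sup>2" using coord(2)[OF y(1)] y by (intro power_mono) auto
    moreover have "(4 * \<delta>)\<^sup>2 \<le> 4 * \<delta>"
      using mult_right_mono[of "4 * \<delta>" 1 "4 * \<delta>"] \<delta> by (simp add: power2_eq_square)
    ultimately have "(norm y)\<^sup>2 \<le> r0\<^sup>2" using coord(1)[OF y(1)] y(2) \<delta>(3) by linarith
    then show ?thesis using r0(1) power2_le_imp_le by fastforce
  qed
  have in_chart: "y \<in> \<phi> ` (U \<inter> V)" if "0 \<le> snd y" "fold_form y \<le> 4 * \<delta>" for y
    using norm_bound[OF that] that(1) subsetD[OF r0(2), of y] c(3) by (simp add: half_space_def)
  have in_W: "fold_form y \<in> W" if "0 \<le> snd y" "fold_form y \<le> 4 * \<delta>" for y :: "'m \<times> real"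
    using coord(3)[OF that(1)] that(2) \<delta>(1,4) \<kappa> by (auto simp: subset_iff)
  \<comment> \<open>The switch happens between the values \<open>2 * \<delta>\<close> and
    \<open>3 * \<delta>\<close> of the fold form, well beyond the value \<open>\<delta>\<close> at
    the new minimum \<open>a\<close>. There the fold form has positive derivative along the ray from
    \<open>a\<close>.\<close>
  define \<eta> where "\<eta> t = smooth_step ((t - 2 * \<delta>) / \<delta>)" for t
  define \<eta>' where "\<eta>' t = smooth_step' ((t - 2 * \<delta>) / \<delta>) * (1 / \<delta>)" for t
  have \<eta>: "0 \<le> \<eta> t" "\<eta> t \<le> 1" "0 \<le> \<eta>' t" for t
    using \<delta>(1) by (auto simp: \<eta>_def \<eta>'_def smooth_step_nonneg smooth_step_le_1 smooth_step'_nonneg)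
  have \<eta>0: "\<eta> t = 0" if "t \<le> 2 * \<delta>" for t
    using that \<delta>(1) unfolding \<eta>_def by (intro smooth_step_0) (simp add: divide_le_0_iff)
  have \<eta>1: "\<eta> t = 1" if "3 * \<delta> \<le> t" for t
    using that \<delta>(1) unfolding \<eta>_def by (intro smooth_step_1) (simp add: field_simps)
  have \<eta>_der: "(\<eta> has_real_derivative \<eta>' t) (at t)" for t
    unfolding \<eta>_def \<eta>'_def
    by (rule DERIV_chain2[OF smooth_step_has_derivative]) (use \<delta>(1) in \<open>auto intro!: derivative_eq_intros\<close>)
  have \<eta>_smooth: "Cinf UNIV (\<lambda>y. \<eta> (fold_form y))"
    unfolding \<eta>_def divide_inverse
    by (intro Cinf_smooth_step Cinf_intros Cinf_fold_form open_UNIV)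
  define Q where "Q y = (y - a) \<bullet> (y - a)" for y
  have Q_smooth: "Cinf UNIV Q" unfolding Q_def by (intro Cinf_intros open_UNIV)
  define \<Delta> where "\<Delta> x = (if x \<in> U then (1 - \<eta> (fold_form (\<phi> x))) * (Q (\<phi> x) + C - F x) else 0)" for x
  define B where "B = {y :: 'm \<times> real. 0 \<le> snd y \<and> fold_form y \<le> 3 * \<delta>}"
  define K where "K = {x \<in> U. \<phi> x \<in> B}"
  have B: "compact B"
  proof -
    have "closed B"
      unfolding B_def fold_form_def by (intro closed_Collect_conj closed_Collect_le continuous_intros)
    moreover have "B \<subseteq> cball 0 r0"
    proof
      fix y assume "y \<in> B"
      then have "0 \<le> snd y" "fold_form y \<le> 4 * \<delta>" using \<delta>(1) by (auto simp: B_def)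
      then show "y \<in> cball 0 r0" using norm_bound[of y] by simp
    qed
    ultimately show ?thesis using compact_Int_closed[of "cball 0 r0" B] by (simp add: Int_absorb1)
  qed
  have B_sub: "B \<subseteq> \<phi> ` (U \<inter> V)" using in_chart \<delta>(1) by (force simp: B_def)
  have K: "closedin T K"
    unfolding K_def by (rule chart_vimage_closedin[OF c(1) B]) (use B_sub in blast)
  have KUV: "K \<subseteq> U \<inter> V"
  proof
    fix x assume x: "x \<in> K"
    then have "\<phi> x \<in> \<phi> ` (U \<inter> V)" using B_sub by (auto simp: K_def)
    then show "x \<in> U \<inter> V" using x chartD(3)[OF c(1)] by (auto simp: K_def dest: inj_onD)
  qed
  have pK: "p \<in> K" using c \<delta>(1) by (simp add: K_def B_def fold_form_def)
  have \<Delta>0: "\<Delta> x = 0" if "x \<notin> K" for x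
  proof (cases "x \<in> U")
    case True
    then have "3 * \<delta> \<le> fold_form (\<phi> x)" using that chartD(6)[OF c(1) True] by (auto simp: K_def B_def)
    then show ?thesis using \<eta>1 by (simp add: \<Delta>_def)
  qed (simp add: \<Delta>_def)
  have "smooth_in N U (\<lambda>x. (1 - \<eta> (fold_form (\<phi> x))) * (Q (\<phi> x) + C - F x))"
  proof (intro smooth_in_mult smooth_in_diff[of U "\<lambda>x. Q (\<phi> x) + C"])
    show "smooth_in N U (\<lambda>x. 1 - \<eta> (fold_form (\<phi> x)))"
      by (rule smooth_in_chart_compose[OF c(1), of UNIV "\<lambda>y. 1 - \<eta> (fold_form y)"])
         (auto intro!: Cinf_smooth_on[of UNIV] Cinf_diff Cinf_const \<eta>_smooth)
    show "smooth_in N U (\<lambda>x. Q (\<phi> x) + C)"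
      by (rule smooth_in_chart_compose[OF c(1), of UNIV "\<lambda>y. Q y + C"])
         (auto intro!: Cinf_smooth_on[of UNIV] Cinf_add Cinf_const Q_smooth)
    show "smooth_in N U F" by (rule smooth_in_subset[OF F chartD(2)[OF c(1)]])
  qed
  then have "smooth_in N U \<Delta>"
    unfolding smooth_in_def
    using smooth_at_local[of U "\<lambda>x. (1 - \<eta> (fold_form (\<phi> x))) * (Q (\<phi> x) + C - F x)" _ U U \<Delta>] chartD(1)[OF c(1)]
    by (simp add: \<Delta>_def)
  then have \<Delta>_smooth: "smooth_in N X \<Delta>"
    by (rule smooth_in_extend_zero[OF chartD(1)[OF c(1)] _ K]) (use KUV \<Delta>0 in auto)
  have G: "F x + \<Delta> x = (1 - \<eta> (fold_form (\<phi> x))) * (Q (\<phi> x) + C) + \<eta> (fold_form (\<phi> x)) * F x" if "x \<in> U" for x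
    using that by (simp add: \<Delta>_def algebra_simps)
  have "a \<in> \<phi> ` (U \<inter> V)" using \<delta>(1) by (intro in_chart) (auto simp: a_def fold_form_def)
  then obtain z where z: "z \<in> U" "\<phi> z = a" by auto
  have inc: "increasing_at N (\<lambda>x. F x + \<Delta> x) x" if x: "x \<in> K - {z}" for x
  proof -
    define y where "y = \<phi> x"
    \<comment> \<open>The radial direction from the new minimum. At boundary points its last
      component is \<open>- \<delta>\<close>, so it points outwards.\<close>
    define v where "v = y - a"
    have xU: "x \<in> U" and y: "0 \<le> snd y" "fold_form y \<le> 3 * \<delta>" using x by (auto simp: K_def B_def y_def)
    have "y \<noteq> a" using x xU z chartD(3)[OF c(1)] by (auto simp: y_def dest: inj_onD)
    then have v0: "0 < v \<bullet> v" by (simp add: v_def)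
    have v_bd: "snd (\<phi> x) = 0 \<longrightarrow> snd v < 0" using \<delta>(1) by (auto simp: v_def a_def y_def[symmetric])
    have Q_der: "(Q has_derivative (\<lambda>w. 2 * (v \<bullet> w))) (at y)"
      unfolding Q_def v_def by (auto intro!: derivative_eq_intros simp: inner_commute)
    have "upward U \<phi> v (\<lambda>x. F x + \<Delta> x) x"
    proof (cases "fold_form y < 2 * \<delta>")
      case True
      let ?W = "{y :: 'm \<times> real. fold_form y < 2 * \<delta>}"
      have o: "open ?W" unfolding fold_form_def by (intro open_Collect_less continuous_intros)
      have "((\<lambda>y. Q y + C) has_derivative (\<lambda>w. 2 * (v \<bullet> w))) (at y)"
        using has_derivative_add[OF Q_der has_derivative_const] by simp
      then have "0 < frechet_derivative (\<lambda>y. Q y + C) (at y) v"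
        using frechet_derivativeI v0 by fastforce
      moreover have "Cinf ?W (\<lambda>y. Q y + C)"
        by (intro Cinf_add Cinf_const o Cinf_subset[OF Q_smooth]) auto
      moreover have "Q (\<phi> u) + C = F u + \<Delta> u" if "u \<in> U" "\<phi> u \<in> ?W" for u
        using that G[OF that(1)] \<eta>0[of "fold_form (\<phi> u)"] by simp
      ultimately show ?thesis
        using True by (intro upwardI[of x U ?W "\<lambda>y. Q y + C" \<phi>]) (auto simp: y_def xU)
    next
      case False
      let ?W = "fold_form -` W \<inter> (UNIV :: ('m \<times> real) set)"
      let ?h = "\<lambda>y. (1 - \<eta> (fold_form y)) * (Q y + C) + \<eta> (fold_form y) * \<theta> (fold_form y)"
      have o: "open ?W"
        using Cinf_open[OF th(1)] unfolding fold_form_def by (auto intro!: open_vimage continuous_intros)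
      have yW: "fold_form y \<in> W" using in_W y \<delta>(1) by simp
      define D\<rho> where "D\<rho> w = 2 * (fst y \<bullet> fst w) + snd w" for w :: "'m \<times> real"
      have \<rho>_der: "(fold_form has_derivative D\<rho>) (at y)" unfolding D\<rho>_def by (rule fold_form_has_derivative)
      let ?\<theta>' = "frechet_derivative \<theta> (at (fold_form y)) 1"
      have \<theta>_der: "((\<lambda>y. \<theta> (fold_form y)) has_derivative (\<lambda>w. ?\<theta>' * D\<rho> w)) (at y)"
        by (rule frechet_derivative_real_compose[OF th(1) yW \<rho>_der])
      have c_der: "((\<lambda>y. \<eta> (fold_form y)) has_derivative (\<lambda>w. \<eta>' (fold_form y) * D\<rho> w)) (at y)"
        using has_derivative_compose[OF \<rho>_der \<eta>_der[unfolded has_field_derivative_def]] .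
      have h_der: "(?h has_derivative (\<lambda>w. (1 - \<eta> (fold_form y)) * (2 * (v \<bullet> w)) - \<eta>' (fold_form y) * D\<rho> w * (Q y + C)
          + (\<eta> (fold_form y) * (?\<theta>' * D\<rho> w) + \<eta>' (fold_form y) * D\<rho> w * \<theta> (fold_form y)))) (at y)"
        by (rule has_derivative_eq_rhs,
            rule has_derivative_add[OF has_derivative_mult[OF has_derivative_diff[OF has_derivative_const c_der]
              has_derivative_add[OF Q_der has_derivative_const]] has_derivative_mult[OF c_der \<theta>_der]])
           (auto simp: algebra_simps)
      have "D\<rho> v = fst y \<bullet> fst y + fold_form y - \<delta>"
        by (simp add: D\<rho>_def v_def a_def fold_form_def algebra_simps)
      then have D\<rho>: "0 < D\<rho> v" using False \<delta>(1) inner_ge_zero[of "fst y"] by linarith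
      have \<theta>F: "C + 1 \<le> \<theta> (fold_form y)" using F\<theta>[OF xU] yW C[of x] xU chartD(2)[OF c(1)] by (auto simp: y_def)
      have "Q y = fst y \<bullet> fst y + (snd y - \<delta>)\<^sup>2"
        by (simp add: Q_def a_def inner_prod_def power2_eq_square)
      moreover have "(snd y - \<delta>)\<^sup>2 \<le> (2 * \<delta>)\<^sup>2"
        using y coord(2)[OF y(1)] \<delta>(1) by (intro abs_le_square_iff[THEN iffD1]) auto
      moreover have "(2 * \<delta>)\<^sup>2 \<le> 2 * \<delta>"
        using mult_right_mono[of "2 * \<delta>" 1 "2 * \<delta>"] \<delta> by (simp add: power2_eq_square)
      ultimately have Q1: "Q y \<le> 1" using coord(1)[OF y(1)] y(2) \<delta>(2) by linarith
      have th': "0 < ?\<theta>'" using th(3) yW by blast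
      have "0 < (1 - \<eta> (fold_form y)) * (2 * (v \<bullet> v)) + \<eta> (fold_form y) * (?\<theta>' * D\<rho> v)"
      proof (cases "\<eta> (fold_form y) = 0")
        case True
        then show ?thesis using v0 by simp
      next
        case False
        then have "0 < \<eta> (fold_form y)" using \<eta>(1) by (simp add: order_less_le)
        then have "0 < \<eta> (fold_form y) * (?\<theta>' * D\<rho> v)" using th' D\<rho> by simp
        moreover have "0 \<le> (1 - \<eta> (fold_form y)) * (2 * (v \<bullet> v))" using \<eta>(2) by simp
        ultimately show ?thesis by linarith
      qed
      \<comment> \<open>The derivative of the cutoff contributes with the right sign because the old
        function lies above the new one: \<open>Q \<le> 1\<close>, and \<open>C\<close> is at least
        1 below \<open>F\<close>.\<close>
      moreover have "0 \<le> \<eta>' (fold_form y) * D\<rho> v * (\<theta> (fold_form y) - (Q y + C))"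
        using \<eta>(3) D\<rho> \<theta>F Q1 by (intro mult_nonneg_nonneg) auto
      ultimately have "0 < (1 - \<eta> (fold_form y)) * (2 * (v \<bullet> v)) - \<eta>' (fold_form y) * D\<rho> v * (Q y + C)
          + (\<eta> (fold_form y) * (?\<theta>' * D\<rho> v) + \<eta>' (fold_form y) * D\<rho> v * \<theta> (fold_form y))"
        by (simp add: algebra_simps)
      then have pos: "0 < frechet_derivative ?h (at y) v" unfolding frechet_derivativeI[OF h_der] .
      have "Cinf ?W (\<lambda>y. \<theta> (fold_form y))"
        by (rule Cinf_compose[OF Cinf_fold_form[OF o] th(1)]) auto
      then have "Cinf ?W ?h"
        by (intro Cinf_add Cinf_mult Cinf_diff Cinf_const o Cinf_subset[OF Q_smooth] Cinf_subset[OF \<eta>_smooth]) auto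
      moreover have "?h (\<phi> u) = F u + \<Delta> u" if "u \<in> U" "\<phi> u \<in> ?W" for u
        using that G[OF that(1)] F\<theta>[OF that(1)] by simp
      ultimately show ?thesis
        using yW pos by (intro upwardI[of x U ?W ?h \<phi>]) (auto simp: y_def xU)
    qed
    then show ?thesis using c(1) v_bd unfolding increasing_at_def by blast
  qed
  \<comment> \<open>On the ball of radius \<open>\<delta> / 2\<close> the fold form is at most
    \<open>\<delta> / 4 + 3 * \<delta> / 2\<close>, which is below the switching range; the new
    function is exactly quadratic there.\<close>
  have ball: "0 < snd y \<and> fold_form y < 2 * \<delta>" if y: "y \<in> cball a (\<delta> / 2)" for y
  proof -
    have n: "norm (y - a) \<le> \<delta> / 2" using y by (simp add: dist_norm norm_minus_commute)
    have "norm (fst (y - a)) \<le> \<delta> / 2" "norm (snd (y - a)) \<le> \<delta> / 2"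
      using norm_fst_le[of "fst (y - a)" "snd (y - a)"] norm_snd_le[of "snd (y - a)" "fst (y - a)"] n
      unfolding prod.collapse by linarith+
    then have "norm (fst y) \<le> \<delta> / 2" and s: "\<bar>snd y - \<delta>\<bar> \<le> \<delta> / 2" by (simp_all add: a_def)
    then have "fst y \<bullet> fst y \<le> (\<delta> / 2)\<^sup>2" by (simp add: dot_square_norm power_mono)
    also have "\<dots> \<le> \<delta> / 4"
      using mult_right_mono[of \<delta> 1 \<delta>] \<delta> by (simp add: power2_eq_square)
    finally show ?thesis using s \<delta>(1) unfolding fold_form_def by linarith
  qed
  have "cball a (\<delta> / 2) \<subseteq> \<phi> ` U \<inter> {y. 0 < snd y}"
  proof
    fix y assume "y \<in> cball a (\<delta> / 2)"
    then have y: "0 < snd y" "fold_form y < 2 * \<delta>" using ball by auto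
    then have "y \<in> \<phi> ` (U \<inter> V)" using \<delta>(1) by (intro in_chart) auto
    then show "y \<in> \<phi> ` U \<inter> {y. 0 < snd y}" using y(1) by auto
  qed
  moreover have "x \<in> K \<and> F x + \<Delta> x = (dist a (\<phi> x))\<^sup>2 + C" if x: "x \<in> U" "\<phi> x \<in> cball a (\<delta> / 2)" for x
  proof
    have b: "0 < snd (\<phi> x)" "fold_form (\<phi> x) < 2 * \<delta>" using ball[OF x(2)] by auto
    then show "x \<in> K" using x(1) \<delta>(1) by (auto simp: K_def B_def)
    have "Q (\<phi> x) = (dist a (\<phi> x))\<^sup>2"
      by (simp add: Q_def dot_square_norm dist_norm norm_minus_commute)
    then show "F x + \<Delta> x = (dist a (\<phi> x))\<^sup>2 + C" using G[OF x(1)] b(2) \<eta>0 by simp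
  qed
  ultimately show ?thesis
    using \<Delta>_smooth K KUV pK \<Delta>0 inc z \<delta>(1)
    by (intro exI[of _ \<Delta>] exI[of _ K] exI[of _ z] exI[of _ "\<delta> / 2"]) (auto simp: z(2))
qed

end

context compact_mfd
begin

text \<open>The fold points are isolated: near one, the tangential derivative of the fold form does not vanish
  at the other boundary points.\<close>

lemma minimum_fold_isolated:
  assumes "minimum_fold N F p"
  shows "\<exists>V. openin T V \<and> p \<in> V \<and> (\<forall>x\<in>V - {p}. x \<in> manifold_boundary N \<longrightarrow> increasing_at N F x)"
proof -
  obtain U \<phi> W \<theta> where c: "(U, \<phi>) \<in> smooth_charts N" "p \<in> U" "\<phi> p = 0"
    and th: "Cinf W \<theta>" "0 \<in> W" "\<And>t. t \<in> W \<Longrightarrow> 0 < frechet_derivative \<theta> (at t) (1::real)"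
    and F: "\<And>x. x \<in> U \<Longrightarrow> fold_form (\<phi> x) \<in> W \<Longrightarrow> F x = \<theta> (fold_form (\<phi> x))"
    using assms unfolding minimum_fold_def by blast
  let ?W = "fold_form -` W \<inter> (UNIV :: ('m \<times> real) set)"
  have o: "open ?W"
    using Cinf_open[OF th(1)] unfolding fold_form_def by (auto intro!: open_vimage continuous_intros)
  have "increasing_at N F x" if x: "x \<in> {x \<in> U. \<phi> x \<in> ?W}" "x \<noteq> p" "x \<in> manifold_boundary N" for x
  proof -
    define y where "y = \<phi> x"
    have xU: "x \<in> U" and yW: "fold_form y \<in> W" using x(1) by (auto simp: y_def)
    have y0: "snd y = 0" using manifold_boundary_chart[OF c(1) xU] x(3) by (simp add: y_def)
    have "y \<noteq> 0" using x(2) inj_onD[OF chartD(3)[OF c(1)] _ xU c(2)] c(3) by (auto simp: y_def)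
    then have fy: "fst y \<bullet> fst y \<noteq> 0" using y0 by (auto simp: prod_eq_iff)
    \<comment> \<open>The tangential part is scaled so that it contributes 2 to the derivative of
      the fold form, which outweighs the \<open>-1\<close> from the outward part.\<close>
    define v where "v = ((1 / (fst y \<bullet> fst y)) *\<^sub>R fst y, - 1 :: real)"
    have D: "((\<lambda>y. \<theta> (fold_form y)) has_derivative
        (\<lambda>w. frechet_derivative \<theta> (at (fold_form y)) 1 * (2 * (fst y \<bullet> fst w) + snd w))) (at y)"
      by (rule frechet_derivative_real_compose[OF th(1) yW fold_form_has_derivative])
    have "2 * (fst y \<bullet> fst v) + snd v = 1" using fy by (simp add: v_def)
    then have "0 < frechet_derivative (\<lambda>y. \<theta> (fold_form y)) (at y) v"
      unfolding frechet_derivativeI[OF D] using th(3)[OF yW] by simp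
    moreover have "Cinf ?W (\<lambda>y. \<theta> (fold_form y))"
      by (rule Cinf_compose[OF Cinf_fold_form[OF o] th(1)]) auto
    ultimately have "upward U \<phi> v F x"
      using xU yW F by (intro upwardI[of x U ?W "\<lambda>y. \<theta> (fold_form y)" \<phi>]) (auto simp: y_def)
    then show ?thesis using c(1) unfolding increasing_at_def v_def by fastforce
  qed
  then show ?thesis
    using chart_vimage_open[OF c(1) o] c th(2) by (intro exI[of _ "{x \<in> U. \<phi> x \<in> ?W}"]) (auto simp: fold_form_def)
qed

lemma finite_separation:
  assumes M: "finite M" "M \<subseteq> X"
  shows "\<exists>O'. (\<forall>p\<in>M. openin T (O' p) \<and> p \<in> O' p) \<and> (\<forall>p\<in>M. \<forall>q\<in>M. p \<noteq> q \<longrightarrow> O' p \<inter> O' q = {})"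
proof -
  have H: "Hausdorff_space T" using mfd by (simp add: smooth_manifold_def)
  have "\<forall>p q. \<exists>A B. p \<in> X \<and> q \<in> X \<and> p \<noteq> q \<longrightarrow> openin T A \<and> openin T B \<and> p \<in> A \<and> q \<in> B \<and> A \<inter> B = {}"
    using H unfolding Hausdorff_space_def disjnt_def by metis
  then obtain A B where AB: "\<And>p q. p \<in> X \<Longrightarrow> q \<in> X \<Longrightarrow> p \<noteq> q \<Longrightarrow>
      openin T (A p q) \<and> openin T (B p q) \<and> p \<in> A p q \<and> q \<in> B p q \<and> A p q \<inter> B p q = {}"
    by metis
  \<comment> \<open>Both roles of \<open>p\<close> in a separated pair are intersected:
    \<open>O' p\<close> lies in \<open>A p q\<close> and \<open>O' q\<close> in
    \<open>B p q\<close>, and these are disjoint.\<close>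
  define O' where "O' p = X \<inter> (\<Inter>q\<in>M - {p}. A p q \<inter> B q p)" for p
  have "openin T (O' p)" "p \<in> O' p" if p: "p \<in> M" for p
  proof -
    have AB': "openin T (A p q \<inter> B q p)" "p \<in> A p q \<inter> B q p" if "q \<in> M - {p}" for q
      using AB[of p q] AB[of q p] that p M(2) by auto
    show "openin T (O' p)"
    proof (cases "M - {p} = {}")
      case True
      show ?thesis unfolding O'_def True by simp
    next
      case False
      then have "openin T (\<Inter>q\<in>M - {p}. A p q \<inter> B q p)"
        using M(1) AB'(1) by (intro openin_INT2) auto
      then show ?thesis unfolding O'_def by (rule openin_Int[OF openin_topspace])
    qed
    show "p \<in> O' p" using AB'(2) p M(2) unfolding O'_def by blast
  qed
  moreover have "O' p \<inter> O' q = {}" if "p \<in> M" "q \<in> M" "p \<noteq> q" for p q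
  proof -
    have "O' p \<subseteq> A p q" "O' q \<subseteq> B p q" using that by (auto simp: O'_def)
    then show ?thesis using AB[of p q] that M(2) by blast
  qed
  ultimately show ?thesis by blast
qed

lemma remove_folds:
  assumes F: "smooth_in N X F" and X: "X \<noteq> {}"
    and inc: "\<And>p. p \<in> X \<Longrightarrow> increasing_at N F p \<or> (p \<in> manifold_boundary N \<and> minimum_fold N F p)"
  shows "\<exists>(G::'a \<Rightarrow> real) Z C. smooth_in N X G \<and> finite Z \<and> Z \<subseteq> X \<and> (\<forall>x\<in>X - Z. increasing_at N G x) \<and>
    (\<forall>z\<in>Z. \<exists>U \<phi> r. (U, \<phi>) \<in> smooth_charts N \<and> z \<in> U \<and> 0 < r \<and> cball (\<phi> z) r \<subseteq> \<phi> ` U \<inter> {y. 0 < snd y} \<and>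
      (\<forall>x\<in>U. \<phi> x \<in> cball (\<phi> z) r \<longrightarrow> G x = (dist (\<phi> z) (\<phi> x))\<^sup>2 + C))"
proof -
  obtain x0 where x0: "x0 \<in> X" "\<And>y. y \<in> X \<Longrightarrow> F x0 \<le> F y"
    using continuous_attains_inf[OF F closedin_topspace X] by blast
  \<comment> \<open>One constant below the global minimum serves all folds, so all new minima have
    the same value. The gap of 1 is what \<open>absorb_fold\<close> needs to dominate its quadratic
    function.\<close>
  define C where "C = F x0 - 1"
  have C: "C + 1 \<le> F x" if "x \<in> X" for x using x0(2)[OF that] by (simp add: C_def)
  define M where "M = {p \<in> X. \<not> increasing_at N F p}"
  have M: "p \<in> manifold_boundary N" "minimum_fold N F p" if "p \<in> M" for p
    using that inc by (auto simp: M_def)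
  have "\<exists>V. openin T V \<and> p \<in> V \<and> V \<inter> M \<subseteq> {p}" if p: "p \<in> X" for p
  proof (cases "p \<in> M")
    case True
    obtain V where V: "openin T V" "p \<in> V" "\<forall>x\<in>V - {p}. x \<in> manifold_boundary N \<longrightarrow> increasing_at N F x"
      using minimum_fold_isolated[OF M(2)[OF True]] by blast
    have "V \<inter> M \<subseteq> {p}"
    proof
      fix x assume x: "x \<in> V \<inter> M"
      then have "\<not> increasing_at N F x" "x \<in> manifold_boundary N" using M(1) by (auto simp: M_def)
      then show "x \<in> {p}" using x V(3) by blast
    qed
    then show ?thesis using V by blast
  next
    case False
    then have "increasing_at N F p" using p by (simp add: M_def)
    then obtain V where "openin T V" "p \<in> V" "\<forall>x\<in>V. increasing_at N F x"
      using increasing_at_open by blast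
    then show ?thesis unfolding M_def by blast
  qed
  then obtain V where V: "\<And>p. p \<in> X \<Longrightarrow> openin T (V p) \<and> p \<in> V p \<and> V p \<inter> M \<subseteq> {p}" by metis
  obtain I where I: "finite I" "I \<subseteq> X" "X \<subseteq> (\<Union>p\<in>I. V p)"
    using closedin_finite_cover[OF closedin_topspace, of V] V by auto
  \<comment> \<open>Each \<open>V p\<close> contains no point of \<open>M\<close> except possibly
    \<open>p\<close>; hence a point of \<open>M\<close> covered by \<open>V p\<close> is the index
    \<open>p\<close> itself.\<close>
  have "M \<subseteq> I" using I V by (fastforce simp: M_def)
  then have finM: "finite M" using I(1) finite_subset by blast
  have MX: "M \<subseteq> X" by (auto simp: M_def)
  obtain O' where O'_all: "\<forall>p\<in>M. openin T (O' p) \<and> p \<in> O' p"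
      "\<forall>p\<in>M. \<forall>q\<in>M. p \<noteq> q \<longrightarrow> O' p \<inter> O' q = {}"
    using finite_separation[OF finM MX] by (elim exE conjE)
  have O': "openin T (O' p)" "p \<in> O' p" "q \<in> M \<Longrightarrow> p \<noteq> q \<Longrightarrow> O' p \<inter> O' q = {}" if "p \<in> M" for p q
    using O'_all that by simp_all
  define P where "P p \<Delta> K z U \<phi> r \<longleftrightarrow> smooth_in N X \<Delta> \<and> closedin T K \<and> K \<subseteq> U \<inter> O' p \<and> p \<in> K \<and> (\<forall>x. x \<notin> K \<longrightarrow> \<Delta> x = 0) \<and>
    (\<forall>x\<in>K - {z}. increasing_at N (\<lambda>x. F x + \<Delta> x) x) \<and> z \<in> U \<and> 0 < r \<and> (U, \<phi>) \<in> smooth_charts N \<and>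
    cball (\<phi> z) r \<subseteq> \<phi> ` U \<inter> {y. 0 < snd y} \<and>
    (\<forall>x\<in>U. \<phi> x \<in> cball (\<phi> z) r \<longrightarrow> x \<in> K \<and> F x + \<Delta> x = (dist (\<phi> z) (\<phi> x))\<^sup>2 + C)"
    for p \<Delta> K z U and \<phi> :: "'a \<Rightarrow> 'm \<times> real" and r
  have "\<exists>\<Delta> K z U \<phi> r. P p \<Delta> K z U \<phi> r" if p: "p \<in> M" for p
  proof -
    obtain U \<phi> W \<theta> where c: "(U, \<phi>) \<in> smooth_charts N" "p \<in> U" "\<phi> p = 0"
      and th: "Cinf W \<theta>" "0 \<in> W" "\<And>t. t \<in> W \<Longrightarrow> 0 < frechet_derivative \<theta> (at t) (1::real)"
      and F\<theta>: "\<And>x. x \<in> U \<Longrightarrow> fold_form (\<phi> x) \<in> W \<Longrightarrow> F x = \<theta> (fold_form (\<phi> x))"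
      using M(2)[OF p] unfolding minimum_fold_def by blast
    from absorb_fold[OF F C c O'(1,2)[OF p] th F\<theta>] c(1)
    show ?thesis unfolding P_def by blast
  qed
  then obtain \<Delta> K z U \<phi> r where P: "\<And>p. p \<in> M \<Longrightarrow> P p (\<Delta> p) (K p) (z p) (U p) (\<phi> p) (r p)" by metis
  note P = P[unfolded P_def]
  define G where "G x = F x + (\<Sum>p\<in>M. \<Delta> p x)" for x
  have G: "smooth_in N X G"
    unfolding G_def
  proof (intro smooth_in_add F)
    show "smooth_in N X (\<lambda>x. \<Sum>p\<in>M. \<Delta> p x)" by (rule smooth_in_sum) (use P in auto)
  qed
  \<comment> \<open>The corrections live in the pairwise disjoint sets \<open>O' p\<close>, so at
    most one of them is active at a point and each fold can be treated on its own.\<close>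
  have GO: "G x = F x + \<Delta> p x" if "p \<in> M" "x \<in> O' p" for p x
  proof -
    have "\<Delta> q x = 0" if "q \<in> M - {p}" for q
    proof -
      have "x \<notin> K q" using O'(3)[of p q] P[of q] that \<open>p \<in> M\<close> \<open>x \<in> O' p\<close> by blast
      then show ?thesis using P[of q] that by blast
    qed
    then have "(\<Sum>q\<in>M - {p}. \<Delta> q x) = 0" by simp
    then show ?thesis using that(1) finM by (simp add: G_def sum.remove)
  qed
  have zK: "z p \<in> K p" if "p \<in> M" for p
    using P[OF that] by auto
  have KX: "K p \<subseteq> X" if "p \<in> M" for p using P[OF that] closedin_subset by blast
  have "increasing_at N G x" if x: "x \<in> X - z ` M" for x
  proof (cases "\<exists>p\<in>M. x \<in> K p")
    case True
    then obtain p where p: "p \<in> M" "x \<in> K p" by blast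
    then have "increasing_at N (\<lambda>x. F x + \<Delta> p x) x" using P[OF p(1)] x by blast
    then show ?thesis
      by (rule increasing_at_cong[OF _ O'(1)[OF p(1)]]) (use P[OF p(1)] p GO in auto)
  next
    case False
    then have "x \<notin> M" using P by blast
    then have "increasing_at N F x" using x by (auto simp: M_def)
    moreover have "openin T (X - (\<Union>p\<in>M. K p))"
      by (intro openin_diff openin_topspace closedin_Union) (use finM P in auto)
    ultimately show ?thesis
    proof (rule increasing_at_cong)
      show "x \<in> X - (\<Union>p\<in>M. K p)" using False x by blast
      show "F y = G y" if "y \<in> X - (\<Union>p\<in>M. K p)" for y
      proof -
        have "\<Delta> p y = 0" if "p \<in> M" for p using P[OF that] that \<open>y \<in> X - (\<Union>p\<in>M. K p)\<close> by blast
        then show ?thesis by (simp add: G_def)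
      qed
    qed
  qed
  moreover have "\<exists>U \<phi> r. (U, \<phi>) \<in> smooth_charts N \<and> z' \<in> U \<and> 0 < r \<and> cball (\<phi> z') r \<subseteq> \<phi> ` U \<inter> {y. 0 < snd y} \<and>
      (\<forall>x\<in>U. \<phi> x \<in> cball (\<phi> z') r \<longrightarrow> G x = (dist (\<phi> z') (\<phi> x))\<^sup>2 + C)" if z': "z' \<in> z ` M" for z'
  proof -
    obtain p where p: "p \<in> M" "z' = z p" using z' by blast
    have "G x = (dist (\<phi> p z') (\<phi> p x))\<^sup>2 + C" if "x \<in> U p" "\<phi> p x \<in> cball (\<phi> p z') (r p)" for x
    proof -
      have "x \<in> K p" "F x + \<Delta> p x = (dist (\<phi> p z') (\<phi> p x))\<^sup>2 + C" using P[OF p(1)] p(2) that by blast+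
      moreover from this have "x \<in> O' p" using P[OF p(1)] by blast
      ultimately show ?thesis using GO[OF p(1)] by simp
    qed
    then show ?thesis using P[OF p(1)] p(2) by (intro exI[of _ "U p"] exI[of _ "\<phi> p"] exI[of _ "r p"]) auto
  qed
  moreover have "finite (z ` M)" "z ` M \<subseteq> X" using finM zK KX by auto
  ultimately show ?thesis using G by (intro exI[of _ G] exI[of _ "z ` M"] exI[of _ C]) blast
qed

end

section \<open>Damping a function to zero at the boundary\<close>

lemma upward_diff_const:
  assumes "upward U \<phi> v g x" shows "upward U \<phi> v (\<lambda>x. g x - c) x"
proof -
  obtain W h where h: "x \<in> U" "Cinf W h" "\<phi> x \<in> W" "\<And>x. x \<in> U \<Longrightarrow> \<phi> x \<in> W \<Longrightarrow> h (\<phi> x) = g x"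
    "0 < frechet_derivative h (at (\<phi> x)) v"
    using assms unfolding upward_def by blast
  have "((\<lambda>y. h y - c) has_derivative frechet_derivative h (at (\<phi> x))) (at (\<phi> x))"
    using has_derivative_diff[OF Cinf_has_derivative[OF h(2,3)] has_derivative_const[of c]] by simp
  then have "0 < frechet_derivative (\<lambda>y. h y - c) (at (\<phi> x)) v"
    using h(5) frechet_derivativeI by metis
  then show ?thesis
    by (intro upwardI[of x U W "\<lambda>y. h y - c" \<phi>] Cinf_diff Cinf_const Cinf_open[OF h(2)] h(1-3)) (use h(4) in auto)
qed

text \<open>The product is increasing because a negative factor is damped towards the boundary \<open>d = 0\<close>.\<close>

lemma upward_ramp:
  assumes g: "upward U \<phi> v g x" "g x < 0" and d: "upward U \<phi> v (\<lambda>x. - d x) x" "0 \<le> d x" and r: "0 < r"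
  shows "upward U \<phi> v (\<lambda>x. ramp (d x / r) * g x) x"
proof -
  obtain W h where h: "x \<in> U" "Cinf W h" "\<phi> x \<in> W" "\<And>x. x \<in> U \<Longrightarrow> \<phi> x \<in> W \<Longrightarrow> h (\<phi> x) = g x"
    "0 < frechet_derivative h (at (\<phi> x)) v"
    using g unfolding upward_def by blast
  obtain V k where k: "Cinf V k" "\<phi> x \<in> V" "\<And>x. x \<in> U \<Longrightarrow> \<phi> x \<in> V \<Longrightarrow> k (\<phi> x) = - d x"
    "0 < frechet_derivative k (at (\<phi> x)) v"
    using d unfolding upward_def by blast
  let ?h' = "frechet_derivative h (at (\<phi> x))" and ?k' = "frechet_derivative k (at (\<phi> x))"
  have o: "open (W \<inter> V)" by (intro open_Int Cinf_open[OF h(2)] Cinf_open[OF k(1)])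
  let ?f = "\<lambda>y. ramp ((- 1 / r) * k y) * h y"
  have C: "Cinf (W \<inter> V) ?f"
    by (intro Cinf_mult Cinf_ramp Cinf_const o Cinf_subset[OF h(2) o] Cinf_subset[OF k(1) o]) auto
  have hx: "h (\<phi> x) = g x" and kx: "k (\<phi> x) = - d x" using h k by auto
  have "((\<lambda>y. ramp ((- 1 / r) * k y)) has_derivative (\<lambda>w. ramp' (d x / r) * ((- 1 / r) * ?k' w))) (at (\<phi> x))"
    using has_derivative_compose[OF has_derivative_mult_right[OF Cinf_has_derivative[OF k(1,2)], of "- 1 / r"]
        ramp_has_derivative[unfolded has_field_derivative_def]] by (simp add: kx)
  from has_derivative_mult[OF this Cinf_has_derivative[OF h(2,3)]]
  have "frechet_derivative ?f (at (\<phi> x)) v = ramp (d x / r) * ?h' v + ramp' (d x / r) * ((- 1 / r) * ?k' v) * g x"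
    by (subst frechet_derivativeI) (simp_all add: hx kx)
  moreover have "0 \<le> ramp (d x / r) * ?h' v" using d r h(5) by (simp add: ramp_nonneg)
  moreover have "(- 1 / r) * ?k' v < 0" using r k(4) by simp
  note nn = mult_neg_neg[OF this g(2)]
  moreover have "0 \<le> ramp' (d x / r) * (((- 1 / r) * ?k' v) * g x)"
    using mult_nonneg_nonneg[OF ramp'_nonneg less_imp_le[OF nn]] .
  \<comment> \<open>The two nonnegative terms are never zero together: on the boundary
    \<open>ramp\<close> vanishes but its derivative at 0 is positive, and elsewhere
    \<open>ramp\<close> is positive.\<close>
  moreover have "0 < ramp (d x / r) * ?h' v \<or> 0 < ramp' (d x / r) * (((- 1 / r) * ?k' v) * g x)"
  proof (cases "d x = 0")
    case True
    then show ?thesis using mult_pos_pos[OF ramp'_pos[of 0] nn] by simp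
  next
    case False
    then show ?thesis using ramp_pos[of "d x / r"] d r h(5) by auto
  qed
  ultimately have pos: "0 < frechet_derivative ?f (at (\<phi> x)) v" by (simp only: mult.assoc) linarith
  show ?thesis
    by (rule upwardI[of x U "W \<inter> V" ?f \<phi>, OF h(1) C _ _ pos]) (use h k in auto)
qed

context compact_mfd
begin

text \<open>The chart ball avoids the boundary, so \<open>z\<close> is an interior point and low
  sublevel sets near it are full round balls. The level \<open>C\<close> is a parameter so that it
  can be shared by all minima.\<close>

definition standard_minimum :: "('a \<Rightarrow> real) \<Rightarrow> real \<Rightarrow> 'a \<Rightarrow> bool" where
  "standard_minimum f C z \<longleftrightarrow> (\<exists>U \<phi> r. (U, \<phi>) \<in> smooth_charts N \<and> z \<in> U \<and> 0 < r \<and>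
     cball (\<phi> z) r \<subseteq> \<phi> ` U \<inter> {y. 0 < snd y} \<and>
     (\<forall>x\<in>U. \<phi> x \<in> cball (\<phi> z) r \<longrightarrow> f x = (dist (\<phi> z) (\<phi> x))\<^sup>2 + C))"

lemma standard_minimum_not_boundary:
  assumes "standard_minimum f C z" shows "z \<in> X - manifold_boundary N"
proof -
  obtain U \<phi> r where c: "(U, \<phi>) \<in> smooth_charts N" "z \<in> U" "0 < r" "cball (\<phi> z) r \<subseteq> \<phi> ` U \<inter> {y. 0 < snd y}"
    using assms unfolding standard_minimum_def by blast
  have "\<phi> z \<in> cball (\<phi> z) r" using c(3) by simp
  then have "0 < snd (\<phi> z)" using c(4) by blast
  then show ?thesis using manifold_boundary_chart[OF c(1,2)] chartD(2)[OF c(1)] c(2) by auto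
qed

lemma standard_minimum_local:
  assumes m: "standard_minimum f C z" and V: "openin T V" "z \<in> V" "\<And>x. x \<in> V \<Longrightarrow> f' x = f x - c"
  shows "standard_minimum f' (C - c) z"
proof -
  obtain U \<phi> r where c: "(U, \<phi>) \<in> smooth_charts N" "z \<in> U" "0 < r" "cball (\<phi> z) r \<subseteq> \<phi> ` U \<inter> {y. 0 < snd y}"
    "\<And>x. x \<in> U \<Longrightarrow> \<phi> x \<in> cball (\<phi> z) r \<Longrightarrow> f x = (dist (\<phi> z) (\<phi> x))\<^sup>2 + C"
    using m unfolding standard_minimum_def by blast
  obtain s where s: "0 < s" "cball (\<phi> z) s \<inter> half_space \<subseteq> \<phi> ` (U \<inter> V)"
    using chart_ball[OF c(1,2) V(1,2)] by blast
  have "f' x = (dist (\<phi> z) (\<phi> x))\<^sup>2 + (C - c)" if x: "x \<in> U" "\<phi> x \<in> cball (\<phi> z) (min r s)" for x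
  proof -
    have "\<phi> x \<in> \<phi> ` (U \<inter> V)" using x subsetD[OF s(2), of "\<phi> x"] chartD(4)[OF c(1)] by auto
    then have "x \<in> V" using x(1) chartD(3)[OF c(1)] by (auto dest: inj_onD)
    then show ?thesis using V(3) c(5)[OF x(1)] x(2) by simp
  qed
  moreover have "cball (\<phi> z) (min r s) \<subseteq> \<phi> ` U \<inter> {y. 0 < snd y}"
    using c(4) subset_cball[of "min r s" r "\<phi> z"] by (meson min.cobounded1 order_trans)
  ultimately show ?thesis
    unfolding standard_minimum_def using c(1-3) s(1)
    by (intro exI[of _ U] exI[of _ \<phi>] exI[of _ "min r s"]) auto
qed

theorem constant_on_boundary:
  assumes G: "smooth_in N X (G :: 'a \<Rightarrow> real)" and X: "X \<noteq> {}" and Z: "finite Z"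
    and inc: "\<And>x. x \<in> X - Z \<Longrightarrow> increasing_at N G x" and min: "\<And>z. z \<in> Z \<Longrightarrow> standard_minimum G C z"
  shows "\<exists>f C'. smooth_in N X f \<and> (\<forall>x\<in>X. f x \<le> 0) \<and> (\<forall>x\<in>X. f x = 0 \<longleftrightarrow> x \<in> manifold_boundary N) \<and>
    (\<forall>x\<in>X - Z. increasing_at N f x) \<and> (\<forall>z\<in>Z. standard_minimum f C' z)"
proof -
  obtain d :: "'a \<Rightarrow> real" where d: "smooth_in N X d" "\<And>x. x \<in> X \<Longrightarrow> 0 \<le> d x"
    "\<And>x. x \<in> X \<Longrightarrow> d x = 0 \<longleftrightarrow> x \<in> manifold_boundary N"
    "\<And>U \<phi> p v. (U, \<phi>) \<in> smooth_charts N \<Longrightarrow> p \<in> U \<Longrightarrow> snd (\<phi> p) = 0 \<Longrightarrow> snd v < 0 \<Longrightarrow> upward U \<phi> v (\<lambda>x. - d x) p"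
    using boundary_function by auto
  have "smooth_in N X (\<lambda>x. 0 - G x)" by (intro smooth_in_diff smooth_in_const G) auto
  then obtain xm where xm: "xm \<in> X" "\<And>y. y \<in> X \<Longrightarrow> G y \<le> G xm"
    using continuous_attains_inf[OF _ closedin_topspace X, of "\<lambda>x. 0 - G x"] by auto
  \<comment> \<open>Here \<open>xm\<close> is a maximum point, so \<open>g\<close> is negative
    everywhere; damping a negative function towards 0 at the boundary makes it grow
    outwards.\<close>
  define m where "m = G xm + 1"
  define g where "g x = G x - m" for x
  have g_neg: "g x < 0" if "x \<in> X" for x using xm(2)[OF that] by (simp add: g_def m_def)
  have g: "smooth_in N X g" unfolding g_def by (intro smooth_in_diff smooth_in_const G) auto
  \<comment> \<open>The points where a single vector increases both \<open>g\<close> and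
    \<open>- d\<close>. It contains a neighbourhood of the boundary, because the vector supplied
    there by \<open>G\<close> points outwards and \<open>boundary_function\<close> then makes it
    increase \<open>- d\<close> as well.\<close>
  define V where "V = {x \<in> X. \<exists>U \<phi> v. (U, \<phi>) \<in> smooth_charts N \<and> snd v < 0 \<and> upward U \<phi> v g x \<and> upward U \<phi> v (\<lambda>x. - d x) x}"
  have bdV: "\<exists>A. openin T A \<and> p \<in> A \<and> A \<subseteq> V" if p: "p \<in> manifold_boundary N" for p
  proof -
    have "p \<in> X - Z" using p manifold_boundary_subset standard_minimum_not_boundary min by blast
    then obtain U \<phi> v where u: "(U, \<phi>) \<in> smooth_charts N" "upward U \<phi> v G p" "snd (\<phi> p) = 0 \<longrightarrow> snd v < 0"
      using inc unfolding increasing_at_def by blast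
    have pU: "p \<in> U" using u(2) unfolding upward_def by blast
    have v: "snd v < 0" "snd (\<phi> p) = 0" using u(3) manifold_boundary_chart[OF u(1) pU] p by auto
    have ug: "upward U \<phi> v g p" unfolding g_def by (rule upward_diff_const[OF u(2)])
    obtain W1 where W1: "open W1" "\<phi> p \<in> W1" "\<And>x. x \<in> U \<Longrightarrow> \<phi> x \<in> W1 \<Longrightarrow> upward U \<phi> v g x"
      using upward_nbhd[OF ug] by blast
    obtain W2 where W2: "open W2" "\<phi> p \<in> W2" "\<And>x. x \<in> U \<Longrightarrow> \<phi> x \<in> W2 \<Longrightarrow> upward U \<phi> v (\<lambda>x. - d x) x"
      using upward_nbhd[OF d(4)[OF u(1) pU v(2,1)]] by blast
    have "openin T {x \<in> U. \<phi> x \<in> W1 \<inter> W2}" using chart_vimage_open[OF u(1)] W1(1) W2(1) by blast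
    moreover have "{x \<in> U. \<phi> x \<in> W1 \<inter> W2} \<subseteq> V"
      unfolding V_def using W1(3) W2(3) u(1) v(1) chartD(2)[OF u(1)] by blast
    ultimately show ?thesis using pU W1(2) W2(2) by blast
  qed
  \<comment> \<open>On the complement of an open neighbourhood of the boundary inside
    \<open>V\<close>, which is compact, \<open>d\<close> attains a positive minimum; smaller values
    of \<open>d\<close> therefore occur only in \<open>V\<close>.\<close>
  obtain \<eta>1 where \<eta>1: "0 < \<eta>1" "\<And>x. x \<in> X \<Longrightarrow> d x < \<eta>1 \<Longrightarrow> x \<in> V"
  proof -
    define V' where "V' = \<Union>{A. openin T A \<and> A \<subseteq> V}"
    have V': "openin T V'" "V' \<subseteq> V" "manifold_boundary N \<subseteq> V'"
      unfolding V'_def using bdV by (auto intro!: openin_Union)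
    have K: "closedin T (X - V')" using V'(1) by blast
    show ?thesis
    proof (cases "X - V' = {}")
      case True
      then show ?thesis using V'(2) that[of 1] by auto
    next
      case False
      then obtain x where x: "x \<in> X - V'" "\<And>y. y \<in> X - V' \<Longrightarrow> d x \<le> d y"
        using continuous_attains_inf[OF d(1) K] by blast
      then have "d x \<noteq> 0" using d(3) V'(3) by blast
      then have "0 < d x" using d(2)[of x] x(1) by auto
      then show ?thesis using that[of "d x"] x(2) V'(2) by fastforce
    qed
  qed
  have dZ: "0 < d z" if "z \<in> Z" for z
    using standard_minimum_not_boundary[OF min[OF that]] d(2,3)[of z] by force
  obtain \<eta>2 where \<eta>2: "0 < \<eta>2" "\<And>z. z \<in> Z \<Longrightarrow> \<eta>2 < d z"
  proof (cases "Z = {}")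
    case True
    then show ?thesis using that[of 1] by auto
  next
    case False
    then have "0 < Min (d ` Z)" "\<And>z. z \<in> Z \<Longrightarrow> Min (d ` Z) \<le> d z" using Z dZ by auto
    then show ?thesis using that[of "Min (d ` Z) / 2"] by fastforce
  qed
  \<comment> \<open>The damping acts only where \<open>d\<close> is at most \<open>\<eta>\<close>:
    inside \<open>V\<close>, and away from the minima, near which the function is merely shifted by
    a constant.\<close>
  define \<eta> where "\<eta> = min \<eta>1 \<eta>2 / 2"
  have \<eta>: "0 < \<eta>" "\<eta> < \<eta>1" "\<eta> < \<eta>2" using \<eta>1(1) \<eta>2(1) by (auto simp: \<eta>_def min_def)
  define f where "f x = ramp (d x / \<eta>) * g x" for x
  have f_far: "f x = g x" if "\<eta> < d x" for x
    using that \<eta>(1) by (simp add: f_def ramp_1)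
  have oA: "openin T {x \<in> X. \<eta> < d x}" by (rule smooth_in_openin_less(1)[OF d(1)])
  have "Cinf UNIV (\<lambda>s. ramp (s / \<eta>))"
    unfolding divide_inverse by (intro Cinf_ramp Cinf_intros open_UNIV)
  then have "smooth_in N X (\<lambda>x. ramp (d x / \<eta>))" by (rule smooth_in_compose[OF d(1)]) simp
  then have f: "smooth_in N X f" unfolding f_def using g by (rule smooth_in_mult)
  have f0: "f x = 0 \<longleftrightarrow> x \<in> manifold_boundary N" if x: "x \<in> X" for x
  proof -
    have "f x = 0 \<longleftrightarrow> ramp (d x / \<eta>) = 0" using g_neg[OF x] by (simp add: f_def)
    also have "\<dots> \<longleftrightarrow> d x = 0"
      using ramp_pos[of "d x / \<eta>"] d(2)[OF x] \<eta>(1) ramp_0 by (cases "d x = 0") auto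
    finally show ?thesis using d(3)[OF x] by simp
  qed
  have f_nonpos: "f x \<le> 0" if x: "x \<in> X" for x
    using ramp_nonneg[of "d x / \<eta>"] d(2)[OF x] \<eta>(1) g_neg[OF x] unfolding f_def
    by (intro mult_nonneg_nonpos) auto
  have f_inc: "increasing_at N f x" if x: "x \<in> X - Z" for x
  proof (cases "\<eta> < d x")
    case True
    obtain U \<phi> v where u: "(U, \<phi>) \<in> smooth_charts N" "upward U \<phi> v G x" "snd (\<phi> x) = 0 \<longrightarrow> snd v < 0"
      using inc[OF x] unfolding increasing_at_def by blast
    have "upward U \<phi> v g x" unfolding g_def by (rule upward_diff_const[OF u(2)])
    then have "increasing_at N g x"
      unfolding increasing_at_def using u(1,3) by blast
    then show ?thesis by (rule increasing_at_cong[OF _ oA]) (use x True f_far in auto)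
  next
    case False
    then have "x \<in> V" using \<eta>1(2)[of x] \<eta>(2) x by auto
    then obtain U \<phi> v where u: "(U, \<phi>) \<in> smooth_charts N" "snd v < 0" "upward U \<phi> v g x" "upward U \<phi> v (\<lambda>x. - d x) x"
      unfolding V_def by blast
    then have "upward U \<phi> v f x"
      unfolding f_def using x by (intro upward_ramp u g_neg d(2) \<eta>(1)) auto
    then show ?thesis unfolding increasing_at_def using u(1,2) by blast
  qed
  have "standard_minimum f (C - m) z" if z: "z \<in> Z" for z
  proof (rule standard_minimum_local[OF min[OF z] oA])
    show "z \<in> {x \<in> X. \<eta> < d x}" using \<eta>2(2)[OF z] \<eta>(3) standard_minimum_not_boundary[OF min[OF z]] by auto
    show "f x = G x - m" if "x \<in> {x \<in> X. \<eta> < d x}" for x using f_far that by (simp add: g_def)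
  qed
  then show ?thesis using f f0 f_nonpos f_inc by (intro exI[of _ f] exI[of _ "C - m"]) blast
qed

end

section \<open>Sweeping out the manifold\<close>

lemma upward_scale:
  fixes v :: "'c::real_normed_vector"
  assumes "upward U \<phi> v g x" "0 < c" shows "upward U \<phi> (c *\<^sub>R v) g x"
proof -
  obtain W h where h: "x \<in> U" "Cinf W h" "\<phi> x \<in> W" "\<And>x. x \<in> U \<Longrightarrow> \<phi> x \<in> W \<Longrightarrow> h (\<phi> x) = g x"
    "0 < frechet_derivative h (at (\<phi> x)) v"
    using assms(1) unfolding upward_def by blast
  have "frechet_derivative h (at (\<phi> x)) (c *\<^sub>R v) = c *\<^sub>R frechet_derivative h (at (\<phi> x)) v"
    by (rule linear_scale[OF has_derivative_linear[OF Cinf_has_derivative[OF h(2,3)]]])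
  then have "0 < frechet_derivative h (at (\<phi> x)) (c *\<^sub>R v)" using h(5) assms(2) by simp
  then show ?thesis using upwardI[of x U W h \<phi>] h(1-4) by blast
qed

lemma upward_nonzero: "upward U \<phi> v g x \<Longrightarrow> v \<noteq> 0"
  unfolding upward_def using linear_0[OF has_derivative_linear[OF Cinf_has_derivative]] by force

section \<open>Diffeomorphisms between subsets\<close>

context compact_mfd
begin

text \<open>The test functions take values in the fixed space \<open>'m \<times> real\<close> since
  a definition cannot quantify over types. Chart maps have this target, and a real function can be
  tested as its second component.\<close>

definition diffeo_between :: "'a set \<Rightarrow> 'a set \<Rightarrow> bool" where
  "diffeo_between A B \<longleftrightarrow> (\<exists>E E'. (\<forall>x\<in>A. E x \<in> B \<and> E' (E x) = x) \<and> (\<forall>y\<in>B. E' y \<in> A \<and> E (E' y) = y) \<and>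
     (\<forall>g::'a \<Rightarrow> 'm \<times> real. smooth_in N B g \<longrightarrow> smooth_in N A (\<lambda>x. g (E x))) \<and>
     (\<forall>g::'a \<Rightarrow> 'm \<times> real. smooth_in N A g \<longrightarrow> smooth_in N B (\<lambda>x. g (E' x))))"

lemma diffeo_between_refl: "diffeo_between A A"
  unfolding diffeo_between_def by (rule exI[of _ "\<lambda>x. x"], rule exI[of _ "\<lambda>x. x"]) simp

lemma diffeo_between_trans:
  assumes "diffeo_between A B" "diffeo_between B C" shows "diffeo_between A C"
proof -
  obtain E E' where E: "\<forall>x\<in>A. E x \<in> B \<and> E' (E x) = x" "\<forall>y\<in>B. E' y \<in> A \<and> E (E' y) = y"
     "\<forall>g::'a \<Rightarrow> 'm \<times> real. smooth_in N B g \<longrightarrow> smooth_in N A (\<lambda>x. g (E x))"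
     "\<forall>g::'a \<Rightarrow> 'm \<times> real. smooth_in N A g \<longrightarrow> smooth_in N B (\<lambda>x. g (E' x))"
    using assms(1) unfolding diffeo_between_def by blast
  obtain D D' where D: "\<forall>x\<in>B. D x \<in> C \<and> D' (D x) = x" "\<forall>y\<in>C. D' y \<in> B \<and> D (D' y) = y"
     "\<forall>g::'a \<Rightarrow> 'm \<times> real. smooth_in N C g \<longrightarrow> smooth_in N B (\<lambda>x. g (D x))"
     "\<forall>g::'a \<Rightarrow> 'm \<times> real. smooth_in N B g \<longrightarrow> smooth_in N C (\<lambda>x. g (D' x))"
    using assms(2) unfolding diffeo_between_def by blast
  have "smooth_in N A (\<lambda>x. g (D (E x)))" if "smooth_in N C g" for g :: "'a \<Rightarrow> 'm \<times> real"
    using E(3)[rule_format, of "\<lambda>x. g (D x)"] D(3)[rule_format, OF that] by blast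
  moreover have "smooth_in N C (\<lambda>x. g (E' (D' x)))" if "smooth_in N A g" for g :: "'a \<Rightarrow> 'm \<times> real"
    using D(4)[rule_format, of "\<lambda>x. g (E' x)"] E(4)[rule_format, OF that] by blast
  ultimately show ?thesis
    unfolding diffeo_between_def using E(1,2) D(1,2)
    by (intro exI[of _ "\<lambda>x. D (E x)"] exI[of _ "\<lambda>x. E' (D' x)"]) simp
qed

lemma smooth_on_chart_inverse:
  assumes c: "(U, \<phi>) \<in> smooth_charts N" and g: "smooth_in N B g"
  shows "smooth_on (\<phi> ` (B \<inter> U)) (\<lambda>y. g (inv_into U \<phi> y))"
  unfolding smooth_on_Cinf
proof
  fix y assume "y \<in> \<phi> ` (B \<inter> U)"
  then obtain x where x: "x \<in> B" "x \<in> U" "y = \<phi> x" by blast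
  have "ext_at U \<phi> B g x" using smooth_at_chart[OF _ c x(2)] g x(1) unfolding smooth_in_def by blast
  then obtain W h where h: "Cinf W h" "\<phi> x \<in> W" "\<And>x. x \<in> B \<inter> U \<Longrightarrow> \<phi> x \<in> W \<Longrightarrow> h (\<phi> x) = g x"
    unfolding ext_at_def by blast
  have "h z = g (inv_into U \<phi> z)" if "z \<in> \<phi> ` (B \<inter> U) \<inter> W" for z
    using that h(3) chartD(5)[OF c] by auto
  then show "\<exists>W h. Cinf W h \<and> y \<in> W \<and> (\<forall>z\<in>\<phi> ` (B \<inter> U) \<inter> W. h z = g (inv_into U \<phi> z))"
    using h(1,2) x(3) by blast
qed

text \<open>As \<open>e\<close> is the identity outside the ball of radius \<open>r / 2\<close>, two
  open sets suffice: the part of the chart over the open ball of radius \<open>r\<close>, where the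
  map is \<open>e\<close>, and the complement of the closed ball of half the radius, where it is the
  identity.\<close>

lemma smooth_in_chart_map:
  fixes a :: "'m \<times> real" and g :: "'a \<Rightarrow> 'm \<times> real"
  assumes c: "(U, \<phi>) \<in> smooth_charts N" and r: "0 < r" and R: "cball a r \<inter> half_space \<subseteq> \<phi> ` U"
    and AB: "A \<subseteq> X" "\<And>x. x \<in> A \<Longrightarrow> \<not> (x \<in> U \<and> \<phi> x \<in> ball a (r / 2)) \<Longrightarrow> x \<in> B"
    and e: "smooth_on (\<phi> ` (A \<inter> U) \<inter> cball a r) e"
      "\<And>x. x \<in> A \<inter> U \<Longrightarrow> \<phi> x \<in> cball a r \<Longrightarrow> e (\<phi> x) \<in> \<phi> ` (B \<inter> U)"
      "\<And>x. x \<in> A \<inter> U \<Longrightarrow> \<phi> x \<in> cball a r \<Longrightarrow> \<phi> x \<notin> ball a (r / 2) \<Longrightarrow> e (\<phi> x) = \<phi> x"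
    and g: "smooth_in N B g"
  shows "smooth_in N A (\<lambda>x. g (if x \<in> U \<and> \<phi> x \<in> cball a r then inv_into U \<phi> (e (\<phi> x)) else x))"
    (is "smooth_in N A (\<lambda>x. g (?E x))")
  unfolding smooth_in_def
proof
  fix x assume x: "x \<in> A"
  show "smooth_at N A (\<lambda>x. g (?E x)) x"
  proof (cases "x \<in> U \<and> \<phi> x \<in> ball a r")
    case True
    define V where "V = {x \<in> U. \<phi> x \<in> ball a r}"
    have V: "openin T V" unfolding V_def by (rule chart_vimage_open[OF c open_ball])
    have "smooth_on (\<phi> ` (A \<inter> U) \<inter> cball a r) (\<lambda>y. g (inv_into U \<phi> (e y)))"
      by (rule smooth_on_compose[OF e(1) smooth_on_chart_inverse[OF c g]]) (use e(2) in auto)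
    then have "smooth_in N (A \<inter> V) (\<lambda>x. g (inv_into U \<phi> (e (\<phi> x))))"
      by (rule smooth_in_chart_compose[OF c]) (auto simp: V_def)
    then have "smooth_at N (A \<inter> V) (\<lambda>x. g (inv_into U \<phi> (e (\<phi> x)))) x"
      using x True by (auto simp: smooth_in_def V_def)
    then show ?thesis
      by (rule smooth_at_local[OF _ V]) (use True in \<open>auto simp: V_def\<close>)
  next
    case False
    define K where "K = {x \<in> U. \<phi> x \<in> cball a (r / 2) \<inter> half_space}"
    have sub: "cball a (r / 2) \<subseteq> cball a r" using r by (intro subset_cball) simp
    have "closedin T K"
      unfolding K_def using R sub
      by (intro chart_vimage_closedin[OF c] compact_Int_closed closed_half_space) auto
    then have V: "openin T (X - K)" by blast
    have xV: "x \<in> X - K"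
    proof -
      have "cball a (r / 2) \<subseteq> ball a r" using r by (simp add: cball_subset_ball_iff)
      then show ?thesis using False x AB(1) by (auto simp: K_def)
    qed
    have off: "?E y = y \<and> y \<in> B" if y: "y \<in> A \<inter> (X - K)" for y
    proof
      have nb: "\<not> (y \<in> U \<and> \<phi> y \<in> ball a (r / 2))" using y chartD(4)[OF c] by (auto simp: K_def)
      then show "y \<in> B" using AB(2) y by blast
      show "?E y = y" using e(3)[of y] y nb chartD(5)[OF c, of y] by auto
    qed
    have "smooth_at N B g x" using off[of x] x xV g unfolding smooth_in_def by blast
    then show ?thesis by (rule smooth_at_local[OF _ V xV]) (use off in auto)
  qed
qed

text \<open>Carries \<open>half_ball_push\<close> into a chart and continues it by the identity.
  Where the push does not act, \<open>w0\<close> and \<open>w1\<close> agree, so both sublevel sets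
  consist of the same points there.\<close>

lemma push_in_chart:
  fixes a v :: "'m \<times> real" and w0 w1 :: "'a \<Rightarrow> real"
  assumes c: "(U, \<phi>) \<in> smooth_charts N" and r: "0 < r" and v: "norm v = 1"
    and R: "cball a r \<inter> half_space \<subseteq> \<phi> ` U" and dir: "cball a r \<subseteq> {x. 0 < snd x} \<or> snd v \<le> 0"
    and up: "\<And>x. x \<in> U \<Longrightarrow> \<phi> x \<in> cball a r \<Longrightarrow> upward U \<phi> v w0 x \<and> upward U \<phi> v w1 x"
    and le: "\<And>x. x \<in> X \<Longrightarrow> w0 x \<le> w1 x"
    and eq: "\<And>x. x \<in> X \<Longrightarrow> \<not> (x \<in> U \<and> \<phi> x \<in> ball a (r / 2)) \<Longrightarrow> w0 x = w1 x"
    and bd: "\<And>x. x \<in> manifold_boundary N \<Longrightarrow> 0 \<le> w0 x"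
  shows "diffeo_between {x \<in> X. w0 x \<le> 0} {x \<in> X. w1 x \<le> 0}"
proof -
  let ?R = "cball a r \<inter> half_space"
  define \<omega>0 where "\<omega>0 y = w0 (inv_into U \<phi> y)" for y
  define \<omega>1 where "\<omega>1 y = w1 (inv_into U \<phi> y)" for y
  have om: "\<omega>0 (\<phi> x) = w0 x" "\<omega>1 (\<phi> x) = w1 x" if "x \<in> U" for x
    using chartD(5)[OF c that] by (simp_all add: \<omega>0_def \<omega>1_def)
  have Rx: "\<exists>x\<in>U. y = \<phi> x \<and> x \<in> X" if "y \<in> ?R" for y using R that chartD(2)[OF c] by blast
  have inc: "increasing_along ?R v \<omega>" if u: "\<And>x. x \<in> U \<Longrightarrow> \<phi> x \<in> cball a r \<Longrightarrow> upward U \<phi> v w x"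
    and om': "\<And>x. x \<in> U \<Longrightarrow> \<omega> (\<phi> x) = w x" for w \<omega>
    unfolding increasing_along_def
  proof
    fix y assume y: "y \<in> ?R"
    obtain x where x: "x \<in> U" "y = \<phi> x" using Rx[OF y] by blast
    obtain W h where h: "Cinf W h" "\<phi> x \<in> W" "\<And>x. x \<in> U \<Longrightarrow> \<phi> x \<in> W \<Longrightarrow> h (\<phi> x) = w x"
      "0 < frechet_derivative h (at (\<phi> x)) v"
      using u[of x] x y unfolding upward_def by blast
    have "h z = \<omega> z" if "z \<in> ?R \<inter> W" for z
      using Rx[of z] that h(3) om' by auto
    then show "\<exists>W h. Cinf W h \<and> y \<in> W \<and> (\<forall>z\<in>?R \<inter> W. h z = \<omega> z) \<and> 0 < frechet_derivative h (at y) v"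
      using h x(2) by blast
  qed
  have i0: "increasing_along ?R v \<omega>0" by (rule inc[of w0]) (use up om in auto)
  have i1: "increasing_along ?R v \<omega>1" by (rule inc[of w1]) (use up om in auto)
  have le': "\<omega>0 y \<le> \<omega>1 y" if "y \<in> ?R" for y using Rx[OF that] om le by auto
  have eq': "\<omega>0 y = \<omega>1 y" if y: "y \<in> ?R" "y \<notin> ball a (r / 2)" for y
  proof -
    obtain x where "x \<in> U" "y = \<phi> x" "x \<in> X" using Rx[OF y(1)] by blast
    then show ?thesis using eq[of x] y(2) om[of x] by simp
  qed
  have bd': "0 \<le> \<omega>0 y" if y: "y \<in> ?R" "snd y = 0" for y
  proof -
    obtain x where "x \<in> U" "y = \<phi> x" "x \<in> X" using Rx[OF y(1)] by blast
    then show ?thesis using bd[of x] y(2) om[of x] manifold_boundary_chart[OF c] by simp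
  qed
  let ?A = "{x \<in> X. w0 x \<le> 0}" and ?B = "{x \<in> X. w1 x \<le> 0}"
  have "\<exists>e t. smooth_on {y \<in> ?R. \<omega>0 y \<le> 0} e \<and> smooth_on {y \<in> ?R. \<omega>1 y \<le> 0} t \<and>
    (\<forall>y\<in>{y \<in> ?R. \<omega>0 y \<le> 0}. e y \<in> {y \<in> ?R. \<omega>1 y \<le> 0} \<and> t (e y) = y \<and> (\<omega>0 y = \<omega>1 y \<longrightarrow> e y = y)) \<and>
    (\<forall>x\<in>{y \<in> ?R. \<omega>1 y \<le> 0}. t x \<in> {y \<in> ?R. \<omega>0 y \<le> 0} \<and> e (t x) = x \<and> (\<omega>0 x = \<omega>1 x \<longrightarrow> t x = x))"
    by (rule half_ball_push[OF r v dir i0 i1]) (fact le' eq' bd')+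
  then obtain e t where et: "smooth_on {y \<in> ?R. \<omega>0 y \<le> 0} e" "smooth_on {y \<in> ?R. \<omega>1 y \<le> 0} t"
    "\<forall>y\<in>{y \<in> ?R. \<omega>0 y \<le> 0}. e y \<in> {y \<in> ?R. \<omega>1 y \<le> 0} \<and> t (e y) = y \<and> (\<omega>0 y = \<omega>1 y \<longrightarrow> e y = y)"
    "\<forall>x\<in>{y \<in> ?R. \<omega>1 y \<le> 0}. t x \<in> {y \<in> ?R. \<omega>0 y \<le> 0} \<and> e (t x) = x \<and> (\<omega>0 x = \<omega>1 x \<longrightarrow> t x = x)"
    by (elim exE conjE)
  have A': "{y \<in> ?R. \<omega>0 y \<le> 0} = \<phi> ` (?A \<inter> U) \<inter> cball a r"
  proof (intro equalityI subsetI)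
    fix y assume y: "y \<in> {y \<in> ?R. \<omega>0 y \<le> 0}"
    then obtain x where "x \<in> U" "y = \<phi> x" "x \<in> X" using Rx[of y] by blast
    then show "y \<in> \<phi> ` (?A \<inter> U) \<inter> cball a r" using y om by auto
  qed (use om chartD(4)[OF c] in auto)
  have B': "{y \<in> ?R. \<omega>1 y \<le> 0} = \<phi> ` (?B \<inter> U) \<inter> cball a r"
  proof (intro equalityI subsetI)
    fix y assume y: "y \<in> {y \<in> ?R. \<omega>1 y \<le> 0}"
    then obtain x where "x \<in> U" "y = \<phi> x" "x \<in> X" using Rx[of y] by blast
    then show "y \<in> \<phi> ` (?B \<inter> U) \<inter> cball a r" using y om by auto
  qed (use om chartD(4)[OF c] in auto)
  have e: "e (\<phi> x) \<in> \<phi> ` (?B \<inter> U) \<inter> cball a r" "t (e (\<phi> x)) = \<phi> x" "w0 x = w1 x \<longrightarrow> e (\<phi> x) = \<phi> x"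
    if "x \<in> ?A \<inter> U" "\<phi> x \<in> cball a r" for x
  proof -
    have "\<phi> x \<in> {y \<in> ?R. \<omega>0 y \<le> 0}" unfolding A' using that by blast
    from et(3)[rule_format, OF this] om[of x] that(1)
    show "e (\<phi> x) \<in> \<phi> ` (?B \<inter> U) \<inter> cball a r" "t (e (\<phi> x)) = \<phi> x" "w0 x = w1 x \<longrightarrow> e (\<phi> x) = \<phi> x"
      unfolding B'[symmetric] by auto
  qed
  have t: "t (\<phi> x) \<in> \<phi> ` (?A \<inter> U) \<inter> cball a r" "e (t (\<phi> x)) = \<phi> x" "w0 x = w1 x \<longrightarrow> t (\<phi> x) = \<phi> x"
    if "x \<in> ?B \<inter> U" "\<phi> x \<in> cball a r" for x
  proof -
    have "\<phi> x \<in> {y \<in> ?R. \<omega>1 y \<le> 0}" unfolding B' using that by blast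
    from et(4)[rule_format, OF this] om[of x] that(1)
    show "t (\<phi> x) \<in> \<phi> ` (?A \<inter> U) \<inter> cball a r" "e (t (\<phi> x)) = \<phi> x" "w0 x = w1 x \<longrightarrow> t (\<phi> x) = \<phi> x"
      unfolding A'[symmetric] by auto
  qed
  define E where "E x = (if x \<in> U \<and> \<phi> x \<in> cball a r then inv_into U \<phi> (e (\<phi> x)) else x)" for x
  define E' where "E' x = (if x \<in> U \<and> \<phi> x \<in> cball a r then inv_into U \<phi> (t (\<phi> x)) else x)" for x
  have off: "w0 x = w1 x" if "x \<in> X" "\<not> (x \<in> U \<and> \<phi> x \<in> cball a r)" for x
  proof -
    have "ball a (r / 2) \<subseteq> cball a r" using r by auto
    then have "\<not> (x \<in> U \<and> \<phi> x \<in> ball a (r / 2))" using that(2) by blast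
    then show ?thesis by (rule eq[OF that(1)])
  qed
  have EB: "E x \<in> ?B \<and> E' (E x) = x" if x: "x \<in> ?A" for x
  proof (cases "x \<in> U \<and> \<phi> x \<in> cball a r")
    case True
    then have xU: "x \<in> ?A \<inter> U" "\<phi> x \<in> cball a r" using x by auto
    obtain z where z: "z \<in> ?B" "z \<in> U" "e (\<phi> x) = \<phi> z" "\<phi> z \<in> cball a r" using e(1)[OF xU] by auto
    have "E x = z" using True z chartD(5)[OF c] by (simp add: E_def)
    moreover have "E' z = x" using z e(2)[OF xU] xU chartD(5)[OF c, of x] by (simp add: E'_def)
    ultimately show ?thesis using z by simp
  next
    case False
    then have "E x = x" "E' x = x" by (auto simp only: E_def E'_def if_False)
    then show ?thesis using x off[OF _ False] by simp
  qed
  have EA: "E' x \<in> ?A \<and> E (E' x) = x" if x: "x \<in> ?B" for x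
  proof (cases "x \<in> U \<and> \<phi> x \<in> cball a r")
    case True
    then have xU: "x \<in> ?B \<inter> U" "\<phi> x \<in> cball a r" using x by auto
    obtain z where z: "z \<in> ?A" "z \<in> U" "t (\<phi> x) = \<phi> z" "\<phi> z \<in> cball a r" using t(1)[OF xU] by auto
    have "E' x = z" using True z chartD(5)[OF c] by (simp add: E'_def)
    moreover have "E z = x" using z t(2)[OF xU] xU chartD(5)[OF c, of x] by (simp add: E_def)
    ultimately show ?thesis using z by simp
  next
    case False
    then have "E x = x" "E' x = x" by (auto simp only: E_def E'_def if_False)
    then show ?thesis using x off[OF _ False] by simp
  qed
  have sE: "smooth_in N ?A (\<lambda>x. g (E x))" if "smooth_in N ?B g" for g :: "'a \<Rightarrow> 'm \<times> real"
    unfolding E_def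
    by (rule smooth_in_chart_map[OF c r R _ _ _ _ _ that]) (use e eq et(1)[unfolded A'] in auto)
  have sE': "smooth_in N ?B (\<lambda>x. g (E' x))" if "smooth_in N ?A g" for g :: "'a \<Rightarrow> 'm \<times> real"
    unfolding E'_def
    by (rule smooth_in_chart_map[OF c r R _ _ _ _ _ that]) (use t eq et(2)[unfolded B'] in auto)
  have f1: "\<forall>x\<in>?A. E x \<in> ?B \<and> E' (E x) = x" by (intro ballI) (rule EB)
  have f2: "\<forall>x\<in>?B. E' x \<in> ?A \<and> E (E' x) = x" by (intro ballI) (rule EA)
  have f3: "\<forall>g::'a \<Rightarrow> 'm \<times> real. smooth_in N ?B g \<longrightarrow> smooth_in N ?A (\<lambda>x. g (E x))"
    by (intro allI impI) (rule sE)
  have f4: "\<forall>g::'a \<Rightarrow> 'm \<times> real. smooth_in N ?A g \<longrightarrow> smooth_in N ?B (\<lambda>x. g (E' x))"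
    by (intro allI impI) (rule sE')
  show ?thesis
    unfolding diffeo_between_def by (rule exI[of _ E], rule exI[of _ E']) (intro conjI f1 f2 f3 f4)
qed

end

text \<open>Near \<open>\<phi> x\<close> the derivative of \<open>f\<close> along \<open>v\<close>
  stays above half its value, called \<open>\<epsilon>\<close>, and that of \<open>u\<close> above
  \<open>- m\<close>; hence every \<open>\<tau> \<le> \<epsilon> / m\<close> works. The
  neighbourhood does not depend on \<open>\<tau>\<close>, which allows a compactness
  argument.\<close>

lemma upward_add_small:
  assumes f: "upward U \<phi> v f x" and u: "smooth_on (\<phi> ` U) (\<lambda>y. u (inv_into U \<phi> y) :: real)" and inj: "inj_on \<phi> U"
  shows "\<exists>W \<tau>0. open W \<and> \<phi> x \<in> W \<and> 0 < \<tau>0 \<and>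
    (\<forall>\<tau>\<in>{0..\<tau>0}. \<forall>z\<in>U. \<phi> z \<in> W \<longrightarrow> upward U \<phi> v (\<lambda>x. f x + \<tau> * u x) z)"
proof -
  obtain W h where h: "x \<in> U" "Cinf W h" "\<phi> x \<in> W" "\<And>x. x \<in> U \<Longrightarrow> \<phi> x \<in> W \<Longrightarrow> h (\<phi> x) = f x"
    "0 < frechet_derivative h (at (\<phi> x)) v"
    using f unfolding upward_def by blast
  have "\<phi> x \<in> \<phi> ` U" using h(1) by blast
  then obtain V k where k: "Cinf V k" "\<phi> x \<in> V" "\<And>y. y \<in> \<phi> ` U \<inter> V \<Longrightarrow> k y = u (inv_into U \<phi> y)"
    using u unfolding smooth_on_Cinf by meson
  have k': "k (\<phi> z) = u z" if "z \<in> U" "\<phi> z \<in> V" for z using k(3)[of "\<phi> z"] that inj by simp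
  let ?h = "\<lambda>y. frechet_derivative h (at y) v" and ?k = "\<lambda>y. frechet_derivative k (at y) v"
  define \<epsilon> where "\<epsilon> = ?h (\<phi> x) / 2"
  define m where "m = \<bar>?k (\<phi> x)\<bar> + 1"
  have pos: "0 < \<epsilon>" "0 < m" using h(5) by (auto simp: \<epsilon>_def m_def)
  define W' where "W' = (W \<inter> ?h -` {\<epsilon><..}) \<inter> (V \<inter> ?k -` {- m<..})"
  have oW': "open W'"
    unfolding W'_def
    by (intro open_Int continuous_open_preimage Cinf_continuous_on Cinf_derivative h(2) k(1)
        Cinf_open[OF h(2)] Cinf_open[OF k(1)] open_greaterThan)
  have xW': "\<phi> x \<in> W'" using h(3,5) k(2) by (auto simp: W'_def \<epsilon>_def m_def)
  have "upward U \<phi> v (\<lambda>x. f x + \<tau> * u x) z" if \<tau>: "\<tau> \<in> {0..\<epsilon> / m}" and z: "z \<in> U" "\<phi> z \<in> W'" for \<tau> z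
  proof -
    have zWV: "\<phi> z \<in> W" "\<phi> z \<in> V" "\<epsilon> < ?h (\<phi> z)" "- m < ?k (\<phi> z)" using z(2) by (auto simp: W'_def)
    have "((\<lambda>y. h y + \<tau> * k y) has_derivative (\<lambda>w. frechet_derivative h (at (\<phi> z)) w + \<tau> * frechet_derivative k (at (\<phi> z)) w)) (at (\<phi> z))"
      by (intro has_derivative_add has_derivative_mult_right Cinf_has_derivative[OF h(2) zWV(1)] Cinf_has_derivative[OF k(1) zWV(2)])
    then have D: "frechet_derivative (\<lambda>y. h y + \<tau> * k y) (at (\<phi> z)) v = ?h (\<phi> z) + \<tau> * ?k (\<phi> z)"
      by (simp add: frechet_derivativeI)
    have "\<tau> * (- m) \<le> \<tau> * ?k (\<phi> z)" using \<tau> zWV(4) by (intro mult_left_mono) auto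
    moreover have "\<tau> * m \<le> \<epsilon>" using \<tau> pos(2) by (simp add: field_simps)
    ultimately have "0 < frechet_derivative (\<lambda>y. h y + \<tau> * k y) (at (\<phi> z)) v"
      using zWV(3) unfolding D by simp
    moreover have "Cinf W' (\<lambda>y. h y + \<tau> * k y)"
      by (intro Cinf_add Cinf_mult Cinf_const oW' Cinf_subset[OF h(2) oW'] Cinf_subset[OF k(1) oW']) (auto simp: W'_def)
    ultimately show ?thesis
      using z h(4) k' by (intro upwardI[of z U W' "\<lambda>y. h y + \<tau> * k y" \<phi>]) (auto simp: W'_def)
  qed
  moreover have "0 < \<epsilon> / m" using pos by simp
  ultimately show ?thesis using oW' xW' by blast
qed

section \<open>Lowering the level by pushes in charts\<close>

context compact_mfd
begin

lemma upward_add_small_compact: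
  assumes c: "(U, \<phi>) \<in> smooth_charts N" and R: "compact R" "R \<subseteq> \<phi> ` U"
    and f: "\<And>x. x \<in> U \<Longrightarrow> \<phi> x \<in> R \<Longrightarrow> upward U \<phi> v f x" and u: "smooth_in N X (u :: 'a \<Rightarrow> real)"
  shows "\<exists>\<tau>0>0. \<forall>\<tau>\<in>{0..\<tau>0}. \<forall>x\<in>U. \<phi> x \<in> R \<longrightarrow> upward U \<phi> v (\<lambda>x. f x + \<tau> * u x) x"
proof -
  have "smooth_on (\<phi> ` (X \<inter> U)) (\<lambda>y. u (inv_into U \<phi> y))" by (rule smooth_on_chart_inverse[OF c u])
  then have u': "smooth_on (\<phi> ` U) (\<lambda>y. u (inv_into U \<phi> y))" using chartD(2)[OF c] by (simp add: Int_absorb1)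
  define P where "P y W \<tau>0 \<longleftrightarrow> open W \<and> y \<in> W \<and> 0 < \<tau>0 \<and>
    (\<forall>\<tau>\<in>{0..\<tau>0}. \<forall>z\<in>U. \<phi> z \<in> W \<longrightarrow> upward U \<phi> v (\<lambda>x. f x + \<tau> * u x) z)" for y W and \<tau>0 :: real
  have "\<forall>y\<in>R. \<exists>W \<tau>0. P y W \<tau>0"
  proof
    fix y assume y: "y \<in> R"
    then obtain x where x: "x \<in> U" "y = \<phi> x" using R(2) by blast
    have "upward U \<phi> v f x" using f[OF x(1)] x(2) y by blast
    from upward_add_small[OF this u' chartD(3)[OF c]] x(2) show "\<exists>W \<tau>0. P y W \<tau>0" unfolding P_def by blast
  qed
  then obtain W \<tau> where W: "\<forall>y\<in>R. P y (W y) (\<tau> y)" by metis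
  obtain D where D: "D \<subseteq> R" "finite D" "R \<subseteq> (\<Union>y\<in>D. W y)"
    by (rule compactE_image[OF R(1), of R W]) (use W in \<open>auto simp: P_def\<close>)
  define \<tau>0 where "\<tau>0 = Min (insert 1 (\<tau> ` D))"
  have "0 < \<tau>0" unfolding \<tau>0_def using D(1,2) W by (auto simp: P_def)
  moreover have "upward U \<phi> v (\<lambda>x. f x + t * u x) x" if t: "t \<in> {0..\<tau>0}" and x: "x \<in> U" "\<phi> x \<in> R" for t x
  proof -
    obtain y where y: "y \<in> D" "\<phi> x \<in> W y" using D(3) x(2) by blast
    have "\<tau>0 \<le> \<tau> y" unfolding \<tau>0_def using D(2) y(1) by (intro Min_le) auto
    then have "t \<in> {0..\<tau> y}" using t by auto
    then show ?thesis using W y D(1) x(1) unfolding P_def by blast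
  qed
  ultimately show ?thesis by blast
qed

text \<open>Collects what \<open>push_in_chart\<close> demands of a direction. At an interior point
  the ball is shrunk away from the boundary; at a boundary point the outward direction already
  satisfies the requirement on \<open>snd v\<close>.\<close>

lemma increasing_at_ball:
  assumes "increasing_at N f p"
  shows "\<exists>U \<phi> v r. (U, \<phi>) \<in> smooth_charts N \<and> p \<in> U \<and> norm v = 1 \<and> 0 < r \<and> cball (\<phi> p) r \<inter> half_space \<subseteq> \<phi> ` U \<and>
    (cball (\<phi> p) r \<subseteq> {x. 0 < snd x} \<or> snd v \<le> 0) \<and> (\<forall>x\<in>U. \<phi> x \<in> cball (\<phi> p) r \<longrightarrow> upward U \<phi> v f x)"
proof -
  obtain U \<phi> v0 where c: "(U, \<phi>) \<in> smooth_charts N" "upward U \<phi> v0 f p" "snd (\<phi> p) = 0 \<longrightarrow> snd v0 < 0"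
    using assms unfolding increasing_at_def by blast
  have pU: "p \<in> U" using c(2) unfolding upward_def by blast
  define v where "v = (1 / norm v0) *\<^sub>R v0"
  have n: "0 < 1 / norm v0" using upward_nonzero[OF c(2)] by simp
  then have v: "norm v = 1" by (simp add: v_def)
  have up: "upward U \<phi> v f p" unfolding v_def by (rule upward_scale[OF c(2) n])
  obtain W where W: "open W" "\<phi> p \<in> W" "\<And>x. x \<in> U \<Longrightarrow> \<phi> x \<in> W \<Longrightarrow> upward U \<phi> v f x"
    using upward_nbhd[OF up] by blast
  obtain r1 where r1: "0 < r1" "cball (\<phi> p) r1 \<inter> half_space \<subseteq> \<phi> ` U"
    using chart_ball[OF c(1) pU chartD(1)[OF c(1)] pU] by auto
  obtain r2 where r2: "0 < r2" "cball (\<phi> p) r2 \<subseteq> W" using W(1,2) open_contains_cball by metis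
  obtain r3 where r3: "0 < r3" "cball (\<phi> p) r3 \<subseteq> {x. 0 < snd x} \<or> snd v \<le> 0"
  proof (cases "snd (\<phi> p) = 0")
    case True
    then have "snd v \<le> 0" using c(3) n by (simp add: v_def mult_nonneg_nonpos divide_nonpos_nonneg)
    then show ?thesis using that[of 1] by simp
  next
    case False
    have "open {x :: 'm \<times> real. 0 < snd x}" by (intro open_Collect_less continuous_intros)
    moreover have "\<phi> p \<in> {x. 0 < snd x}" using False chartD(6)[OF c(1) pU] by simp
    ultimately show ?thesis using that open_contains_cball by metis
  qed
  define r where "r = min r1 (min r2 r3)"
  have "cball (\<phi> p) r \<subseteq> cball (\<phi> p) r1" "cball (\<phi> p) r \<subseteq> cball (\<phi> p) r2" "cball (\<phi> p) r \<subseteq> cball (\<phi> p) r3"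
    unfolding r_def by (intro subset_cball; simp)+
  then have "cball (\<phi> p) r \<inter> half_space \<subseteq> \<phi> ` U" "cball (\<phi> p) r \<subseteq> {x. 0 < snd x} \<or> snd v \<le> 0" "cball (\<phi> p) r \<subseteq> W"
    using r1(2) r2(2) r3(2) by blast+
  moreover have "0 < r" using r1(1) r2(1) r3(1) by (simp add: r_def)
  ultimately show ?thesis using c(1) pU v W(3)
    by (intro exI[of _ U] exI[of _ \<phi>] exI[of _ v] exI[of _ r]) blast
qed

text \<open>Passing from \<open>f \<le> c\<close> to \<open>f \<le> c - \<tau>\<close> means adding
  \<open>\<tau>\<close> to the function where it matters, namely on \<open>K\<close>. Adding it bump
  by bump changes the sublevel set in a single chart each time, and the admissible
  \<open>\<tau>\<close> does not depend on \<open>c\<close>.\<close>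

theorem sweep:
  fixes f :: "'a \<Rightarrow> real"
  assumes f: "smooth_in N X f" and f0: "\<And>x. x \<in> X \<Longrightarrow> f x \<le> 0" and bd: "\<And>x. x \<in> manifold_boundary N \<Longrightarrow> f x = 0"
    and c0: "c0 < 0" and inc: "\<And>x. x \<in> X \<Longrightarrow> c0 \<le> f x \<Longrightarrow> increasing_at N f x"
  shows "diffeo_between X {x \<in> X. f x \<le> c0}"
proof -
  define K where "K = {x \<in> X. c0 \<le> f x}"
  have K: "closedin T K" unfolding K_def by (rule smooth_in_closedin_le(1)[OF f])
  define P where "P p U \<phi> v r \<beta> \<longleftrightarrow> (U, \<phi>) \<in> smooth_charts N \<and> p \<in> U \<and> norm v = 1 \<and> 0 < r \<and> cball (\<phi> p) r \<inter> half_space \<subseteq> \<phi> ` U \<and>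
    (cball (\<phi> p) r \<subseteq> {x. 0 < snd x} \<or> snd v \<le> 0) \<and> (\<forall>x\<in>U. \<phi> x \<in> cball (\<phi> p) r \<longrightarrow> upward U \<phi> v f x) \<and>
    smooth_in N X \<beta> \<and> (\<forall>x. 0 \<le> \<beta> x \<and> \<beta> x \<le> 1) \<and> (\<forall>x\<in>U. \<phi> x \<in> cball (\<phi> p) (r / 4) \<longrightarrow> \<beta> x = 1) \<and>
    (\<forall>x. \<beta> x \<noteq> 0 \<longrightarrow> x \<in> U \<and> \<phi> x \<in> ball (\<phi> p) (r / 2))" for p U \<phi> v r and \<beta> :: "'a \<Rightarrow> real"
  have "\<forall>p\<in>K. \<exists>U \<phi> v r \<beta>. P p U \<phi> v r \<beta>"
  proof
    fix p assume "p \<in> K"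
    then have "increasing_at N f p" using inc by (simp add: K_def)
    from increasing_at_ball[OF this] obtain U \<phi> v r where u: "(U, \<phi>) \<in> smooth_charts N" "p \<in> U" "norm v = 1" "0 < r"
      "cball (\<phi> p) r \<inter> half_space \<subseteq> \<phi> ` U" "cball (\<phi> p) r \<subseteq> {x. 0 < snd x} \<or> snd v \<le> 0"
      "\<forall>x\<in>U. \<phi> x \<in> cball (\<phi> p) r \<longrightarrow> upward U \<phi> v f x"
      by (elim exE conjE)
    have "cball (\<phi> p) (r / 2) \<subseteq> cball (\<phi> p) r" using u(4) by (intro subset_cball) simp
    then have "cball (\<phi> p) (r / 2) \<inter> half_space \<subseteq> \<phi> ` U" using u(5) by blast
    then obtain \<beta> :: "'a \<Rightarrow> real" where "smooth_in N X \<beta>" "\<forall>x. 0 \<le> \<beta> x \<and> \<beta> x \<le> 1"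
      "\<forall>x\<in>U. \<phi> x \<in> cball (\<phi> p) (r / 4) \<longrightarrow> \<beta> x = 1" "\<forall>x. \<beta> x \<noteq> 0 \<longrightarrow> x \<in> U \<and> \<phi> x \<in> ball (\<phi> p) (r / 2)"
      using chart_bump[OF u(1), of "r / 4" "r / 2" "\<phi> p"] u(4) by auto
    then have "P p U \<phi> v r \<beta>" unfolding P_def using u by simp
    then show "\<exists>U \<phi> v r \<beta>. P p U \<phi> v r \<beta>" by blast
  qed
  then obtain U \<phi> v r \<beta> where P: "\<forall>p\<in>K. P p (U p) (\<phi> p) (v p) (r p) (\<beta> p)" by metis
  note P = P[unfolded P_def]
  define V where "V p = {x \<in> U p. \<phi> p x \<in> ball (\<phi> p p) (r p / 4)}" for p
  have "openin T (V p)" "p \<in> V p" if "p \<in> K" for p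
  proof -
    have c: "(U p, \<phi> p) \<in> smooth_charts N" "p \<in> U p" "0 < r p" using P that by blast+
    show "openin T (V p)" unfolding V_def by (rule chart_vimage_open[OF c(1) open_ball])
    show "p \<in> V p" using c by (simp add: V_def)
  qed
  then obtain F where F: "finite F" "F \<subseteq> K" "K \<subseteq> (\<Union>p\<in>F. V p)"
    using closedin_finite_cover[OF K, of V] by blast
  obtain ps where ps: "set ps = F" using finite_list[OF F(1)] by blast
  define n where "n = length ps"
  define q where "q j = ps ! j" for j
  have q: "q j \<in> K" if "j < n" for j using that ps F(2) by (auto simp: q_def n_def)
  \<comment> \<open>A partition of unity in multiplicative form: \<open>1 - s j\<close> grows from 0
    to a function equal to 1 wherever some bump is 1, and the increment from \<open>j\<close> to
    \<open>Suc j\<close> is \<open>s j\<close> times the bump of \<open>q j\<close>, which is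
    supported in one chart.\<close>
  define s where "s j x = (\<Prod>i<j. 1 - \<beta> (q i) x)" for j x
  have s01: "0 \<le> s j x" "s j x \<le> 1" if "j \<le> n" for j x
    unfolding s_def using P q that by (auto intro!: prod_nonneg prod_le_1)
  have s_smooth: "smooth_in N X (s j)" if "j \<le> n" for j
    using that
  proof (induction j)
    case 0
    then show ?case by (simp add: s_def smooth_in_const)
  next
    case (Suc j)
    have "smooth_in N X (\<lambda>x. s j x * (1 - \<beta> (q j) x))"
      using Suc P q[of j] by (intro smooth_in_mult smooth_in_diff smooth_in_const) auto
    then show ?case by (simp add: s_def)
  qed
  have s_Suc: "s (Suc j) x = s j x * (1 - \<beta> (q j) x)" for j x by (simp add: s_def)
  have s_K: "s n x = 0" if x: "x \<in> K" for x
  proof -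
    obtain p where p: "p \<in> F" "x \<in> V p" using F(3) x by blast
    then obtain i where i: "i < n" "p = q i" using ps unfolding n_def q_def by (metis in_set_conv_nth)
    have "\<beta> p x = 1" using P p F(2) by (auto simp: V_def)
    then show ?thesis unfolding s_def using i by (intro prod_zero) auto
  qed
  define u where "u j x = 1 - s j x" for j x
  have u_smooth: "smooth_in N X (u j)" if "j \<le> n" for j
    unfolding u_def using s_smooth[OF that] by (intro smooth_in_diff smooth_in_const) auto
  \<comment> \<open>Both functions between which the \<open>j\<close>-th push moves must increase
    along the direction of the \<open>j\<close>-th chart on its whole ball.\<close>
  define Q where "Q j \<tau> \<longleftrightarrow> (\<forall>x\<in>U (q j). \<phi> (q j) x \<in> cball (\<phi> (q j) (q j)) (r (q j)) \<inter> half_space \<longrightarrow>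
      upward (U (q j)) (\<phi> (q j)) (v (q j)) (\<lambda>x. f x + \<tau> * u j x) x \<and>
      upward (U (q j)) (\<phi> (q j)) (v (q j)) (\<lambda>x. f x + \<tau> * u (Suc j) x) x)" for j \<tau>
  have "\<exists>\<tau>0>0. \<forall>j<n. \<forall>\<tau>\<in>{0..\<tau>0}. Q j \<tau>"
  proof -
    have "\<exists>\<tau>0>0. \<forall>\<tau>\<in>{0..\<tau>0}. Q j \<tau>" if j: "j < n" for j
    proof -
      have c: "(U (q j), \<phi> (q j)) \<in> smooth_charts N" using P q[OF j] by blast
      have R: "compact (cball (\<phi> (q j) (q j)) (r (q j)) \<inter> half_space)"
        "cball (\<phi> (q j) (q j)) (r (q j)) \<inter> half_space \<subseteq> \<phi> (q j) ` U (q j)"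
        using P q[OF j] by (auto intro: compact_Int_closed closed_half_space)
      have up: "upward (U (q j)) (\<phi> (q j)) (v (q j)) f x"
        if "x \<in> U (q j)" "\<phi> (q j) x \<in> cball (\<phi> (q j) (q j)) (r (q j)) \<inter> half_space" for x
        using P q[OF j] that by blast
      obtain t1 where t1: "0 < t1" "\<forall>\<tau>\<in>{0..t1}. \<forall>x\<in>U (q j). \<phi> (q j) x \<in> cball (\<phi> (q j) (q j)) (r (q j)) \<inter> half_space \<longrightarrow>
          upward (U (q j)) (\<phi> (q j)) (v (q j)) (\<lambda>x. f x + \<tau> * u j x) x"
        using upward_add_small_compact[OF c R up u_smooth[of j]] j by auto
      obtain t2 where t2: "0 < t2" "\<forall>\<tau>\<in>{0..t2}. \<forall>x\<in>U (q j). \<phi> (q j) x \<in> cball (\<phi> (q j) (q j)) (r (q j)) \<inter> half_space \<longrightarrow>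
          upward (U (q j)) (\<phi> (q j)) (v (q j)) (\<lambda>x. f x + \<tau> * u (Suc j) x) x"
        using upward_add_small_compact[OF c R up u_smooth[of "Suc j"]] j by auto
      have "\<forall>\<tau>\<in>{0..min t1 t2}. Q j \<tau>"
      proof
        fix \<tau> assume "\<tau> \<in> {0..min t1 t2}"
        then have "\<tau> \<in> {0..t1}" "\<tau> \<in> {0..t2}" by auto
        then show "Q j \<tau>" unfolding Q_def using t1(2) t2(2) by blast
      qed
      then show ?thesis using t1(1) t2(1) by (intro exI[of _ "min t1 t2"]) simp
    qed
    then obtain t where t: "\<And>j. j < n \<Longrightarrow> 0 < t j \<and> (\<forall>\<tau>\<in>{0..t j}. Q j \<tau>)" by metis
    define t0 where "t0 = Min (insert 1 (t ` {..<n}))"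
    have tp: "0 < t j" if "j < n" for j by (rule t[OF that, THEN conjunct1])
    have "0 < t0" unfolding t0_def using tp by auto
    moreover have "Q j \<tau>" if j: "j < n" and "\<tau> \<in> {0..t0}" for j \<tau>
    proof -
      have "t0 \<le> t j" unfolding t0_def using j by (intro Min_le) auto
      then have "\<tau> \<in> {0..t j}" using that(2) by auto
      from bspec[OF t[OF j, THEN conjunct2] this] show ?thesis .
    qed
    ultimately show ?thesis by blast
  qed
  then obtain \<tau>0 where \<tau>0: "0 < \<tau>0" "\<And>j \<tau>. j < n \<Longrightarrow> \<tau> \<in> {0..\<tau>0} \<Longrightarrow> Q j \<tau>" by blast
  note \<tau>0Q = \<tau>0(2)[unfolded Q_def]
  \<comment> \<open>The step size is adjusted so that a whole number of steps ends exactly at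
    \<open>c0\<close>.\<close>
  obtain M :: nat where M: "- c0 / \<tau>0 < real M" using reals_Archimedean2 by blast
  have M0: "0 < real M" using M c0 \<tau>0(1) by (smt (verit) divide_pos_pos)
  define \<tau> where "\<tau> = - c0 / real M"
  have \<tau>: "0 < \<tau>" "\<tau> \<le> \<tau>0" "real M * \<tau> = - c0"
    using M M0 c0 \<tau>0(1) by (auto simp: \<tau>_def field_simps)
  have step: "diffeo_between {x \<in> X. f x \<le> c} {x \<in> X. f x \<le> c - \<tau>}" if c: "c \<le> 0" "c0 \<le> c - \<tau>" for c
  proof -
    define w where "w j x = f x + \<tau> * u j x - c" for j x
    have "diffeo_between {x \<in> X. w 0 x \<le> 0} {x \<in> X. w j x \<le> 0}" if "j \<le> n" for j
      using that
    proof (induction j)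
      case 0
      show ?case by (rule diffeo_between_refl)
    next
      case (Suc j)
      then have j: "j < n" by simp
      note Pj = P[rule_format, OF q[OF j]]
      have c': "(U (q j), \<phi> (q j)) \<in> smooth_charts N" using Pj by blast
      have "diffeo_between {x \<in> X. w j x \<le> 0} {x \<in> X. w (Suc j) x \<le> 0}"
      proof (rule push_in_chart[OF c', of "r (q j)" "v (q j)" "\<phi> (q j) (q j)"])
        fix x
        show "upward (U (q j)) (\<phi> (q j)) (v (q j)) (w j) x \<and> upward (U (q j)) (\<phi> (q j)) (v (q j)) (w (Suc j)) x"
          if x: "x \<in> U (q j)" "\<phi> (q j) x \<in> cball (\<phi> (q j) (q j)) (r (q j))"
        proof -
          have "\<phi> (q j) x \<in> half_space" using chartD(4)[OF c'] x(1) by blast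
          then have "upward (U (q j)) (\<phi> (q j)) (v (q j)) (\<lambda>x. f x + \<tau> * u j x) x"
              "upward (U (q j)) (\<phi> (q j)) (v (q j)) (\<lambda>x. f x + \<tau> * u (Suc j) x) x"
            using \<tau>0Q[OF j, of \<tau>] \<tau>(1,2) x by auto
          then show ?thesis unfolding w_def using upward_diff_const by fast
        qed
        have "u (Suc j) x - u j x = s j x * \<beta> (q j) x" by (simp add: u_def s_Suc algebra_simps)
        then have d: "w (Suc j) x - w j x = \<tau> * (s j x * \<beta> (q j) x)" by (simp add: w_def flip: right_diff_distrib)
        have "0 \<le> s j x * \<beta> (q j) x" using s01(1)[of j x] j Pj by simp
        then show "w j x \<le> w (Suc j) x" using d \<tau>(1) by (smt (verit) mult_nonneg_nonneg)
        show "w j x = w (Suc j) x" if "\<not> (x \<in> U (q j) \<and> \<phi> (q j) x \<in> ball (\<phi> (q j) (q j)) (r (q j) / 2))"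
        proof -
          have "\<beta> (q j) x = 0" using Pj that by blast
          then show ?thesis using d by simp
        qed
        \<comment> \<open>The boundary stays outside the interior of every sublevel set because
          \<open>f\<close> vanishes there while the level \<open>c\<close> is at most 0.\<close>
        show "0 \<le> w j x" if "x \<in> manifold_boundary N"
        proof -
          have "0 \<le> \<tau> * u j x" using s01(2)[of j x] j \<tau>(1) by (simp add: u_def)
          then show ?thesis using bd[OF that] c(1) by (simp add: w_def)
        qed
      qed (use Pj in blast)+
      then show ?case using Suc diffeo_between_trans by simp
    qed
    from this[of n] have "diffeo_between {x \<in> X. w 0 x \<le> 0} {x \<in> X. w n x \<le> 0}" by simp
    moreover have "w 0 x = f x - c" for x by (simp add: w_def u_def s_def)
    \<comment> \<open>On \<open>K\<close> the full \<open>\<tau>\<close> has been added. Off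
      \<open>K\<close> the amount is unknown, but \<open>f < c0 \<le> c - \<tau>\<close> holds
      there, so both conditions are true whatever was added.\<close>
    moreover have "w n x \<le> 0 \<longleftrightarrow> f x \<le> c - \<tau>" if x: "x \<in> X" for x
    proof (cases "x \<in> K")
      case True
      then have "w n x = f x + \<tau> - c" using s_K by (simp add: w_def u_def)
      then show ?thesis by linarith
    next
      case False
      then have "f x < c0" using x by (simp add: K_def)
      moreover have "\<tau> * u n x \<le> \<tau> * 1" using s01(1)[of n x] \<tau>(1) by (intro mult_left_mono) (auto simp: u_def)
      ultimately show ?thesis using c(2) by (simp add: w_def)
    qed
    then have "{x \<in> X. w n x \<le> 0} = {x \<in> X. f x \<le> c - \<tau>}" by blast
    ultimately show ?thesis by simp
  qed
  have "diffeo_between X {x \<in> X. f x \<le> - (real k * \<tau>)}" if "k \<le> M" for k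
    using that
  proof (induction k)
    case 0
    have "{x \<in> X. f x \<le> 0} = X" using f0 by blast
    then show ?case using diffeo_between_refl[of X] by simp
  next
    case (Suc k)
    have "real (Suc k) * \<tau> \<le> real M * \<tau>" using Suc.prems \<tau>(1) by (intro mult_right_mono) auto
    then have "c0 \<le> - (real k * \<tau>) - \<tau>" using \<tau>(3) by (simp add: algebra_simps)
    moreover have "- (real k * \<tau>) \<le> 0" using \<tau>(1) by simp
    ultimately have "diffeo_between {x \<in> X. f x \<le> - (real k * \<tau>)} {x \<in> X. f x \<le> - (real k * \<tau>) - \<tau>}" by (intro step)
    moreover have "- (real k * \<tau>) - \<tau> = - (real (Suc k) * \<tau>)" by (simp add: algebra_simps)
    ultimately show ?case using Suc diffeo_between_trans by simp
  qed
  from this[of M] show ?thesis using \<tau>(3) by simp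
qed

end

section \<open>From the low sublevel set to the disk\<close>

context compact_mfd
begin

text \<open>A short step along \<open>-v\<close> decreases \<open>f\<close>. At a boundary point
  \<open>-v\<close> points inwards, so the step stays in the manifold.\<close>

lemma increasing_at_not_minimum:
  assumes "increasing_at N f p" shows "\<exists>x\<in>X. f x < f p"
proof -
  obtain U \<phi> v where c: "(U, \<phi>) \<in> smooth_charts N" "upward U \<phi> v f p" "snd (\<phi> p) = 0 \<longrightarrow> snd v < 0"
    using assms unfolding increasing_at_def by blast
  obtain W h where h: "p \<in> U" "Cinf W h" "\<phi> p \<in> W" "\<And>x. x \<in> U \<Longrightarrow> \<phi> x \<in> W \<Longrightarrow> h (\<phi> x) = f x"
    "0 < frechet_derivative h (at (\<phi> p)) v"
    using c(2) unfolding upward_def by blast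
  obtain r where r: "0 < r" "cball (\<phi> p) r \<inter> half_space \<subseteq> \<phi> ` U"
    using chart_ball[OF c(1) h(1) chartD(1)[OF c(1)] h(1)] by auto
  have "((\<lambda>s. h (\<phi> p + s *\<^sub>R v)) has_real_derivative frechet_derivative h (at (\<phi> p)) v) (at 0)"
    using DERIV_along_line[OF h(2), of "\<phi> p" 0 v] h(3) by (simp only: scaleR_zero_left add_0_right)
  from DERIV_pos_inc_left[OF this h(5)]
  obtain e where e: "0 < e" "\<And>s. 0 < s \<Longrightarrow> s < e \<Longrightarrow> h (\<phi> p + (- s) *\<^sub>R v) < h (\<phi> p)" by auto
  have "((\<lambda>s. \<phi> p + (- s) *\<^sub>R v) \<longlongrightarrow> \<phi> p + (- 0) *\<^sub>R v) (at_right 0)" by (intro tendsto_intros)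
  then have lim: "((\<lambda>s. \<phi> p + (- s) *\<^sub>R v) \<longlongrightarrow> \<phi> p) (at_right 0)" by simp
  have "\<forall>\<^sub>F s in at_right 0. \<phi> p + (- s) *\<^sub>R v \<in> W \<inter> ball (\<phi> p) r"
    by (rule topological_tendstoD[OF lim]) (use h(3) r(1) Cinf_open[OF h(2)] in auto)
  moreover have "\<forall>\<^sub>F s in at_right 0. 0 \<le> snd (\<phi> p + (- s) *\<^sub>R v)"
  proof (cases "snd (\<phi> p) = 0")
    case True
    then have "0 \<le> snd (\<phi> p + (- s) *\<^sub>R v)" if "0 < s" for s
      using that c(3) mult_pos_neg[of s "snd v"] by simp
    then show ?thesis using eventually_at_right_less[of "0::real"] by (rule eventually_mono[rotated])
  next
    case False
    have "open {x :: 'm \<times> real. 0 < snd x}" by (intro open_Collect_less continuous_intros)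
    moreover have "\<phi> p \<in> {x. 0 < snd x}" using False chartD(6)[OF c(1) h(1)] by simp
    ultimately have "\<forall>\<^sub>F s in at_right 0. \<phi> p + (- s) *\<^sub>R v \<in> {x. 0 < snd x}"
      by (rule topological_tendstoD[OF lim])
    then show ?thesis by (rule eventually_mono) auto
  qed
  moreover have "\<forall>\<^sub>F s in at_right 0. 0 < s \<and> s < e"
    using e(1) by (auto simp: eventually_at_right_field)
  ultimately have "\<forall>\<^sub>F s in at_right 0. \<phi> p + (- s) *\<^sub>R v \<in> W \<inter> ball (\<phi> p) r \<and> 0 \<le> snd (\<phi> p + (- s) *\<^sub>R v) \<and> 0 < s \<and> s < e"
    by (simp only: eventually_conj_iff)
  then obtain s where s: "\<phi> p + (- s) *\<^sub>R v \<in> W \<inter> ball (\<phi> p) r" "0 \<le> snd (\<phi> p + (- s) *\<^sub>R v)" "0 < s" "s < e"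
    using eventually_happens'[OF trivial_limit_at_right_real] by blast
  let ?y = "\<phi> p + (- s) *\<^sub>R v"
  have "?y \<in> cball (\<phi> p) r \<inter> half_space" using s(1,2) by (auto simp: half_space_def)
  then obtain x where x: "x \<in> U" "?y = \<phi> x" using r(2) by blast
  have "h ?y < h (\<phi> p)" using e(2)[OF s(3,4)] .
  moreover have "h ?y = f x" using h(4)[OF x(1)] x(2) s(1) by simp
  ultimately show ?thesis using h(4)[OF h(1,3)] x(1) chartD(2)[OF c(1)] by auto
qed

text \<open>A chart map lives on its domain only, whereas the test functions to be composed with a
  map into \<open>N\<close> are smooth on all of \<open>X\<close>; cutting off with a bump changes
  nothing near \<open>p\<close>.\<close>

lemma chart_map_extension:
  assumes c: "(U, \<psi>) \<in> smooth_charts N" "p \<in> U"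
  shows "\<exists>(\<Psi> :: 'a \<Rightarrow> 'm \<times> real) V. smooth_in N X \<Psi> \<and> openin T V \<and> p \<in> V \<and> V \<subseteq> U \<and> (\<forall>x\<in>V. \<Psi> x = \<psi> x)"
proof -
  obtain r where r: "0 < r" "cball (\<psi> p) r \<inter> half_space \<subseteq> \<psi> ` U"
    using chart_ball[OF c chartD(1)[OF c(1)] c(2)] by auto
  obtain \<beta> :: "'a \<Rightarrow> real" where b: "smooth_in N X \<beta>" "\<And>x. x \<in> U \<Longrightarrow> \<psi> x \<in> cball (\<psi> p) (r / 2) \<Longrightarrow> \<beta> x = 1"
    "\<And>x. \<beta> x \<noteq> 0 \<Longrightarrow> x \<in> U \<and> \<psi> x \<in> ball (\<psi> p) r"
    using chart_bump[OF c(1), of "r / 2" r "\<psi> p"] r by auto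
  have "smooth_in N U (\<lambda>x. \<beta> x *\<^sub>R \<psi> x)"
    by (intro smooth_in_scaleR smooth_in_subset[OF b(1)] chartD(2)[OF c(1)] smooth_in_chart[OF c(1)])
  then have "smooth_in N X (\<lambda>x. \<beta> x *\<^sub>R \<psi> x)"
  proof (rule smooth_in_extend_zero[OF chartD(1)[OF c(1)]])
    show "closedin T {x \<in> U. \<psi> x \<in> cball (\<psi> p) r \<inter> half_space}"
      using r by (intro chart_vimage_closedin[OF c(1)] compact_Int_closed closed_half_space) auto
    show "\<beta> x *\<^sub>R \<psi> x = 0" if "x \<notin> {x \<in> U. \<psi> x \<in> cball (\<psi> p) r \<inter> half_space}" for x
    proof -
      have "\<beta> x = 0"
      proof (rule ccontr)
        assume "\<beta> x \<noteq> 0"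
        then show False using b(3)[of x] that chartD(4)[OF c(1)] by auto
      qed
      then show ?thesis by simp
    qed
  qed auto
  moreover have "openin T {x \<in> U. \<psi> x \<in> ball (\<psi> p) (r / 2)}" by (rule chart_vimage_open[OF c(1) open_ball])
  ultimately show ?thesis
    using b(2) c(2) r(1)
    by (intro exI[of _ "\<lambda>x. \<beta> x *\<^sub>R \<psi> x"] exI[of _ "{x \<in> U. \<psi> x \<in> ball (\<psi> p) (r / 2)}"]) auto
qed

text \<open>The chart ball is rescaled to the unit ball. Smoothness of the inverse \<open>G\<close>
  is read off from compositions with globally extended chart maps. Its continuity, needed to
  localise them, holds because \<open>F\<close> is a continuous bijection from a compact space to a
  Hausdorff space.\<close>

lemma diffeomorphic_closed_disk:
  fixes a :: "'m \<times> real"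
  assumes c: "(U, \<phi>) \<in> smooth_charts N" and r: "0 < r" "cball a r \<subseteq> \<phi> ` U"
    and diff: "diffeo_between X {x \<in> U. \<phi> x \<in> cball a r}"
  shows "diffeomorphic N (closed_disk :: ('m \<times> real, 'm) manifold)"
proof -
  let ?B = "{x \<in> U. \<phi> x \<in> cball a r}"
  obtain E E' where E: "\<And>x. x \<in> X \<Longrightarrow> E x \<in> ?B \<and> E' (E x) = x" "\<And>y. y \<in> ?B \<Longrightarrow> E' y \<in> X \<and> E (E' y) = y"
     "\<And>g::'a \<Rightarrow> 'm \<times> real. smooth_in N ?B g \<Longrightarrow> smooth_in N X (\<lambda>x. g (E x))"
     "\<And>g::'a \<Rightarrow> 'm \<times> real. smooth_in N X g \<Longrightarrow> smooth_in N ?B (\<lambda>x. g (E' x))"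
    using diff unfolding diffeo_between_def by auto
  define D where "D = (cball 0 1 :: ('m \<times> real) set)"
  define F where "F x = (1 / r) *\<^sub>R (\<phi> (E x) - a)" for x
  define \<sigma> where "\<sigma> y = a + r *\<^sub>R y" for y :: "'m \<times> real"
  define G where "G y = E' (inv_into U \<phi> (\<sigma> y))" for y
  have \<sigma>: "\<sigma> y \<in> cball a r" if "y \<in> D" for y
    using that r(1) by (simp add: \<sigma>_def D_def dist_norm)
  have inv\<sigma>: "inv_into U \<phi> (\<sigma> y) \<in> ?B" "\<phi> (inv_into U \<phi> (\<sigma> y)) = \<sigma> y" if "y \<in> D" for y
  proof -
    have m: "\<sigma> y \<in> \<phi> ` U" using \<sigma>[OF that] r(2) by blast
    show "\<phi> (inv_into U \<phi> (\<sigma> y)) = \<sigma> y" by (rule f_inv_into_f[OF m])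
    then show "inv_into U \<phi> (\<sigma> y) \<in> ?B" using \<sigma>[OF that] inv_into_into[OF m] by simp
  qed
  have FD: "F x \<in> D" if "x \<in> X" for x
  proof -
    have "norm (\<phi> (E x) - a) \<le> r" using E(1)[OF that] by (simp add: dist_norm norm_minus_commute)
    then have "norm (\<phi> (E x) - a) / r \<le> 1" using r(1) by simp
    then show ?thesis using r(1) by (simp add: F_def D_def)
  qed
  have GF: "G (F x) = x" if "x \<in> X" for x
    using E(1)[OF that] r(1) chartD(5)[OF c, of "E x"] by (simp add: G_def F_def \<sigma>_def)
  have GX: "G y \<in> X" and FG: "F (G y) = y" if "y \<in> D" for y
    using E(2)[OF inv\<sigma>(1)[OF that]] inv\<sigma>(2)[OF that] r(1) by (simp_all add: G_def F_def \<sigma>_def)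
  have F_smooth: "smooth_in N X F"
  proof -
    have "smooth_in N ?B (\<lambda>x. (1 / r) *\<^sub>R (\<phi> x - a))"
      by (rule smooth_in_chart_compose[OF c, of UNIV "\<lambda>y. (1 / r) *\<^sub>R (y - a)"])
         (auto intro!: Cinf_smooth_on[of UNIV] Cinf_intros)
    then show ?thesis unfolding F_def by (rule E(3))
  qed
  have F_cont: "continuous_map T (top_of_set D) F"
    using smooth_in_continuous_map[OF F_smooth] FD by (simp add: continuous_map_in_subtopology image_subset_iff)
  have "homeomorphic_map T (top_of_set D) F"
  proof (rule continuous_imp_homeomorphic_map[OF F_cont cpt])
    show "Hausdorff_space (top_of_set D)" by (simp add: Hausdorff_space_subtopology)
    show "F ` X = topspace (top_of_set D)" using FD FG GX by force
    show "inj_on F X" using GF by (metis inj_onI)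
  qed
  then obtain G' where G': "homeomorphic_maps T (top_of_set D) F G'" by (auto simp: homeomorphic_map_maps)
  have "G' y = G y" if "y \<in> D" for y
    using G' that GX[OF that] FG[OF that] by (metis homeomorphic_maps_def)
  then have G_cont: "continuous_map (top_of_set D) T G"
    using G' continuous_map_eq[of "top_of_set D" T G' G] by (simp add: homeomorphic_maps_def)
  have G_smooth: "smooth_on D (\<lambda>y. g (G y))" if g: "smooth_in N X g" for g :: "'a \<Rightarrow> 'm \<times> real"
  proof -
    have 1: "smooth_on (\<phi> ` (?B \<inter> U)) (\<lambda>y. g (E' (inv_into U \<phi> y)))"
      by (rule smooth_on_chart_inverse[OF c E(4)[OF g]])
    have 2: "smooth_on D \<sigma>" unfolding \<sigma>_def by (rule Cinf_smooth_on[of UNIV]) (auto intro!: Cinf_intros)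
    show ?thesis
      unfolding G_def
    proof (rule smooth_on_compose[OF 2 1])
      show "\<sigma> y \<in> \<phi> ` (?B \<inter> U)" if "y \<in> D" for y
        using inv\<sigma>[OF that] by (metis (no_types, lifting) IntI image_eqI mem_Collect_eq)
    qed
  qed
  let ?D = "closed_disk :: ('m \<times> real, 'm) manifold"
  have mD: "mtop ?D = top_of_set D" by (simp add: closed_disk_def D_def)
  have atlD: "is_chart (top_of_set D) (V, \<psi>)" "smooth_on V \<psi>" "smooth_on (\<psi> ` V) (inv_into V \<psi>)"
    if "(V, \<psi>) \<in> atlas ?D" for V \<psi> using that by (auto simp: closed_disk_def D_def)
  have "smooth_map N ?D F"
    unfolding smooth_map_def mD
  proof (intro conjI F_cont ballI, clarify)
    fix U1 \<phi>1 V \<psi> assume u: "(U1, \<phi>1) \<in> atlas N" and v: "(V, \<psi>) \<in> atlas ?D"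
    have c1: "(U1, \<phi>1) \<in> smooth_charts N" using u atlas_smooth_charts by blast
    have "smooth_on (\<phi>1 ` (X \<inter> U1)) (\<lambda>y. F (inv_into U1 \<phi>1 y))" by (rule smooth_on_chart_inverse[OF c1 F_smooth])
    then have "smooth_on (\<phi>1 ` (U1 \<inter> F -` V)) (\<lambda>y. F (inv_into U1 \<phi>1 y))"
      by (rule smooth_on_subset) (use chartD(2)[OF c1] in blast)
    then have "smooth_on (\<phi>1 ` (U1 \<inter> F -` V)) (\<lambda>y. \<psi> (F (inv_into U1 \<phi>1 y)))"
      by (rule smooth_on_compose[OF _ atlD(2)[OF v]]) (use chartD(5)[OF c1] in auto)
    then show "smooth_on (\<phi>1 ` (U1 \<inter> F -` V)) (\<psi> \<circ> F \<circ> inv_into U1 \<phi>1)"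
      by (simp add: comp_def)
  qed
  moreover have "smooth_map ?D N G"
    unfolding smooth_map_def mD
  proof (intro conjI G_cont ballI, clarify)
    fix V \<psi> U1 \<phi>1 assume v: "(V, \<psi>) \<in> atlas ?D" and u: "(U1, \<phi>1) \<in> atlas N"
    have c1: "(U1, \<phi>1) \<in> smooth_charts N" using u atlas_smooth_charts by blast
    note V = atlD[OF v]
    have VD: "V \<subseteq> D" using is_chartD(2)[OF V(1)] by simp
    show "smooth_on (\<psi> ` (V \<inter> G -` U1)) (\<phi>1 \<circ> G \<circ> inv_into V \<psi>)"
      unfolding smooth_on_Cinf
    proof
      fix w assume "w \<in> \<psi> ` (V \<inter> G -` U1)"
      then obtain y where y: "y \<in> V" "G y \<in> U1" "w = \<psi> y" by auto
      obtain \<Psi> :: "'a \<Rightarrow> 'm \<times> real" and O' where P: "smooth_in N X \<Psi>" "openin T O'" "G y \<in> O'" "\<And>x. x \<in> O' \<Longrightarrow> \<Psi> x = \<phi>1 x"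
        using chart_map_extension[OF c1 y(2)] by auto
      have "openin (top_of_set D) {y \<in> D. G y \<in> O'}" using G_cont P(2) by (auto simp: continuous_map_def)
      then obtain W0 where W0: "open W0" "\<psi> ` (V \<inter> {y \<in> D. G y \<in> O'}) = W0 \<inter> half_space"
        using is_chart_image_open[OF V(1)] by blast
      have "smooth_on (\<psi> ` V) (\<lambda>z. \<Psi> (G (inv_into V \<psi> z)))"
        by (rule smooth_on_compose[OF V(3) G_smooth[OF P(1)]]) (use is_chartD(5)[OF V(1)] VD in auto)
      moreover have "w \<in> \<psi> ` V" using y by blast
      ultimately obtain W h where h: "Cinf W h" "w \<in> W" "\<And>z. z \<in> \<psi> ` V \<inter> W \<Longrightarrow> h z = \<Psi> (G (inv_into V \<psi> z))"
        unfolding smooth_on_Cinf by meson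
      have "Cinf (W \<inter> W0) h" using Cinf_open[OF h(1)] W0(1) by (intro Cinf_subset[OF h(1)]) auto
      moreover have "w \<in> W \<inter> W0" using h(2) y W0(2) P(3) VD by blast
      moreover have "h z = (\<phi>1 \<circ> G \<circ> inv_into V \<psi>) z" if z: "z \<in> \<psi> ` (V \<inter> G -` U1) \<inter> (W \<inter> W0)" for z
      proof -
        have "z \<in> W0 \<inter> half_space" using z is_chartD(4)[OF V(1)] by blast
        then have "z \<in> \<psi> ` (V \<inter> {y \<in> D. G y \<in> O'})" using W0(2) by simp
        then have "G (inv_into V \<psi> z) \<in> O'" using is_chartD(5)[OF V(1)] by auto
        then show ?thesis using h(3)[of z] z P(4) by auto
      qed
      ultimately show "\<exists>W h. Cinf W h \<and> w \<in> W \<and> (\<forall>z\<in>\<psi> ` (V \<inter> G -` U1) \<inter> W. h z = (\<phi>1 \<circ> G \<circ> inv_into V \<psi>) z)"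
        by blast
    qed
  qed
  ultimately show ?thesis
    unfolding diffeomorphic_def mD using GF FG by (intro exI[of _ F] exI[of _ G]) simp
qed

theorem diffeomorphic_disk_if_standard:
  fixes f :: "'a \<Rightarrow> real"
  assumes con: "connected_space T" and X: "X \<noteq> {}"
    and f: "smooth_in N X f" "\<And>x. x \<in> X \<Longrightarrow> f x \<le> 0" "\<And>x. x \<in> X \<Longrightarrow> f x = 0 \<longleftrightarrow> x \<in> manifold_boundary N"
    and Z: "finite Z" and inc: "\<And>x. x \<in> X - Z \<Longrightarrow> increasing_at N f x"
    and min: "\<And>z. z \<in> Z \<Longrightarrow> standard_minimum f C z"
  shows "diffeomorphic N (closed_disk :: ('m \<times> real, 'm) manifold)"
proof -
  define P where "P z U \<phi> r \<longleftrightarrow> (U, \<phi>) \<in> smooth_charts N \<and> z \<in> U \<and> 0 < r \<and> cball (\<phi> z) r \<subseteq> \<phi> ` U \<inter> {y. 0 < snd y} \<and>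
     (\<forall>x\<in>U. \<phi> x \<in> cball (\<phi> z) r \<longrightarrow> f x = (dist (\<phi> z) (\<phi> x))\<^sup>2 + C)" for z U and \<phi> :: "'a \<Rightarrow> 'm \<times> real" and r
  have "\<forall>z\<in>Z. \<exists>U \<phi> r. P z U \<phi> r" using min unfolding standard_minimum_def P_def by blast
  then obtain U \<phi> r where P: "\<forall>z\<in>Z. P z (U z) (\<phi> z) (r z)" by metis
  note P = P[unfolded P_def]
  have fZ: "f z = C" if "z \<in> Z" for z
  proof -
    have "z \<in> U z" "\<phi> z z \<in> cball (\<phi> z z) (r z)" using P that by auto
    then show ?thesis using P that by fastforce
  qed
  obtain xm where xm: "xm \<in> X" "\<And>y. y \<in> X \<Longrightarrow> f xm \<le> f y"
    using continuous_attains_inf[OF f(1) closedin_topspace X] by blast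
  \<comment> \<open>A global minimum cannot be a point where \<open>f\<close> increases. So
    \<open>Z\<close> is not empty, and the common value \<open>C\<close> is the minimal value of
    \<open>f\<close>.\<close>
  have xmZ: "xm \<in> Z" using increasing_at_not_minimum[OF inc[of xm]] xm by (meson DiffI not_less)
  have gt: "C < f x" if x: "x \<in> X - Z" for x
  proof -
    obtain y where "y \<in> X" "f y < f x" using increasing_at_not_minimum[OF inc[OF x]] by blast
    then show ?thesis using xm(2)[of y] fZ[OF xmZ] by simp
  qed
  have C0: "C < 0"
  proof -
    have "f xm \<noteq> 0" using f(3)[OF xm(1)] standard_minimum_not_boundary[OF min[OF xmZ]] by blast
    then show ?thesis using f(2)[OF xm(1)] fZ[OF xmZ] by simp
  qed
  define V where "V z = {x \<in> U z. \<phi> z x \<in> ball (\<phi> z z) (r z)}" for z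
  have V: "openin T (V z)" "z \<in> V z" if "z \<in> Z" for z
  proof -
    have c: "(U z, \<phi> z) \<in> smooth_charts N" "z \<in> U z" "0 < r z" using P that by blast+
    show "openin T (V z)" unfolding V_def by (rule chart_vimage_open[OF c(1) open_ball])
    show "z \<in> V z" using c by (simp add: V_def)
  qed
  define K where "K = X - (\<Union>z\<in>Z. V z)"
  have K: "closedin T K" unfolding K_def using V by blast
  obtain \<epsilon> where \<epsilon>: "0 < \<epsilon>" "\<And>x. x \<in> K \<Longrightarrow> C + \<epsilon> \<le> f x"
  proof (cases "K = {}")
    case True
    then show ?thesis using that[of 1] by simp
  next
    case False
    then obtain x where x: "x \<in> K" "\<And>y. y \<in> K \<Longrightarrow> f x \<le> f y" using continuous_attains_inf[OF f(1) K] by blast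
    then have "x \<in> X - Z" using V(2) by (auto simp: K_def)
    then show ?thesis using that[of "f x - C"] gt x(2) by simp
  qed
  \<comment> \<open>The level \<open>C + \<rho>^2\<close> has to be negative, and balls of radius
    \<open>\<rho>\<close> have to lie strictly inside the chart balls. Halving provides the
    strictness, and \<open>\<rho> \<le> 1 / 2\<close> gives \<open>\<rho>^2 \<le> \<rho>\<close>, so
    that linear bounds suffice.\<close>
  define \<rho> where "\<rho> = Min (insert (min 1 (min \<epsilon> (- C))) (r ` Z)) / 2"
  have fin: "finite (insert (min 1 (min \<epsilon> (- C))) (r ` Z))" using Z by simp
  have "0 < Min (insert (min 1 (min \<epsilon> (- C))) (r ` Z))" using fin P \<epsilon>(1) C0 by auto
  then have \<rho>: "0 < \<rho>" by (simp add: \<rho>_def)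
  have "2 * \<rho> \<le> t" if "t \<in> insert (min 1 (min \<epsilon> (- C))) (r ` Z)" for t
    unfolding \<rho>_def using Min_le[OF fin that] by simp
  then have \<rho>': "2 * \<rho> \<le> min 1 (min \<epsilon> (- C))" "\<And>z. z \<in> Z \<Longrightarrow> 2 * \<rho> \<le> r z" by blast+
  have \<rho>2: "\<rho>\<^sup>2 < \<epsilon>" "\<rho>\<^sup>2 < - C"
  proof -
    have "\<rho> * \<rho> \<le> 1 * \<rho>" using \<rho> \<rho>'(1) by (intro mult_right_mono) auto
    then have "\<rho>\<^sup>2 \<le> \<rho>" by (simp add: power2_eq_square)
    moreover have "2 * \<rho> \<le> \<epsilon>" "2 * \<rho> \<le> - C" using \<rho>'(1) by auto
    ultimately show "\<rho>\<^sup>2 < \<epsilon>" "\<rho>\<^sup>2 < - C" using \<rho> by linarith+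
  qed
  define B where "B = {x \<in> X. f x \<le> C + \<rho>\<^sup>2}"
  define Bz where "Bz z = {x \<in> U z. \<phi> z x \<in> cball (\<phi> z z) \<rho>}" for z
  have BV: "B \<inter> V z = Bz z" if z: "z \<in> Z" for z
  proof -
    have c: "(U z, \<phi> z) \<in> smooth_charts N" "\<forall>x\<in>U z. \<phi> z x \<in> cball (\<phi> z z) (r z) \<longrightarrow> f x = (dist (\<phi> z z) (\<phi> z x))\<^sup>2 + C"
      using P z by blast+
    have le: "(dist (\<phi> z z) (\<phi> z x))\<^sup>2 \<le> \<rho>\<^sup>2 \<longleftrightarrow> dist (\<phi> z z) (\<phi> z x) \<le> \<rho>" for x
      using \<rho> by (simp add: power2_le_iff_abs_le)
    show ?thesis
    proof (intro equalityI subsetI)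
      fix x assume x: "x \<in> B \<inter> V z"
      then have "f x = (dist (\<phi> z z) (\<phi> z x))\<^sup>2 + C" using c(2) by (auto simp: V_def)
      then show "x \<in> Bz z" using x le[of x] by (auto simp: B_def Bz_def V_def)
    next
      fix x assume x: "x \<in> Bz z"
      then have d: "x \<in> U z" "dist (\<phi> z z) (\<phi> z x) \<le> \<rho>" by (auto simp: Bz_def)
      then have "dist (\<phi> z z) (\<phi> z x) < r z" using \<rho> \<rho>'(2)[OF z] by linarith
      then have "f x = (dist (\<phi> z z) (\<phi> z x))\<^sup>2 + C" "x \<in> V z" using c(2) d(1) by (auto simp: V_def)
      then show "x \<in> B \<inter> V z" using d le[of x] chartD(2)[OF c(1)] by (auto simp: B_def)
    qed
  qed
  have diff: "diffeo_between X B"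
    unfolding B_def
  proof (rule sweep[OF f(1,2)])
    show "C + \<rho>\<^sup>2 < 0" using \<rho>2 by simp
    show "f x = 0" if "x \<in> manifold_boundary N" for x using f(3)[of x] that manifold_boundary_subset by blast
    show "increasing_at N f x" if "x \<in> X" "C + \<rho>\<^sup>2 \<le> f x" for x
    proof -
      have "0 < \<rho>\<^sup>2" using \<rho> by simp
      then have "x \<notin> Z" using that(2) fZ[of x] by force
      then show ?thesis using inc that(1) by blast
    qed
  qed
  obtain E E' where E: "\<forall>x\<in>X. E x \<in> B \<and> E' (E x) = x" "\<forall>y\<in>B. E' y \<in> X \<and> E (E' y) = y"
     "\<forall>g::'a \<Rightarrow> 'm \<times> real. smooth_in N B g \<longrightarrow> smooth_in N X (\<lambda>x. g (E x))"
    using diff unfolding diffeo_between_def by blast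
  define z where "z = xm"
  have z: "z \<in> Z" using xmZ by (simp add: z_def)
  have c: "(U z, \<phi> z) \<in> smooth_charts N" "z \<in> U z" "cball (\<phi> z z) (r z) \<subseteq> \<phi> z ` U z" using P z by blast+
  have "\<rho> < r z" using \<rho> \<rho>'(2)[OF z] by linarith
  then obtain \<beta> :: "'a \<Rightarrow> real" where b: "smooth_in N X \<beta>" "\<And>x. x \<in> U z \<Longrightarrow> \<phi> z x \<in> cball (\<phi> z z) \<rho> \<Longrightarrow> \<beta> x = 1"
    "\<And>x. \<beta> x \<noteq> 0 \<Longrightarrow> x \<in> U z \<and> \<phi> z x \<in> ball (\<phi> z z) (r z)"
    using chart_bump[OF c(1), of \<rho> "r z" "\<phi> z z"] \<rho> c(3) by (auto simp: le_infI1)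
  \<comment> \<open>On the low sublevel set the bump has only the values 0 and 1: inside
    \<open>V z\<close> the set consists of the small ball, where the bump is 1, and outside
    \<open>V z\<close> the bump vanishes.\<close>
  have bB: "\<beta> x = (if x \<in> Bz z then 1 else 0)" if x: "x \<in> B" for x
  proof (cases "x \<in> Bz z")
    case True
    then show ?thesis using b(2)[of x] by (simp add: Bz_def)
  next
    case False
    then have "x \<notin> V z" using BV[OF z] x by blast
    then show ?thesis using False b(3)[of x] by (auto simp: V_def)
  qed
  \<comment> \<open>The bump is placed in the second component because \<open>diffeo_between\<close>
    tests only with functions into the model space.\<close>
  have "smooth_in N B (\<lambda>x. (0, \<beta> x) :: 'm \<times> real)"
  proof -
    have "B \<subseteq> X" by (auto simp: B_def)
    then show ?thesis
      using smooth_in_compose[OF smooth_in_subset[OF b(1)], of B UNIV "\<lambda>t. (0, t)"] Cinf_Pair[OF Cinf_const Cinf_id] by auto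
  qed
  then have "smooth_in N X (\<lambda>x. (0, \<beta> (E x)) :: 'm \<times> real)" using E(3) by blast
  then have h: "smooth_in N X (\<lambda>x. \<beta> (E x))"
    using smooth_in_compose[of X _ UNIV snd] Cinf_snd[OF Cinf_id] by fastforce
  note o = smooth_in_openin_less[OF h, of "1 / 2"]
  \<comment> \<open>The function \<open>\<beta> (E x)\<close> takes only the values 0 and 1 on
    \<open>X\<close>, so the threshold \<open>1 / 2\<close> splits the connected space into two open
    sets. The one containing \<open>E' z\<close> is not empty; hence the other is, and the low
    sublevel set is the single ball around \<open>z\<close>.\<close>
  define A1 where "A1 = {x \<in> X. 1 / 2 < \<beta> (E x)}"
  define A2 where "A2 = {x \<in> X. \<beta> (E x) < 1 / 2}"
  note o = o[folded A1_def A2_def]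
  have cover: "X \<subseteq> A1 \<union> A2"
  proof
    fix x assume x: "x \<in> X"
    then have "\<beta> (E x) = 0 \<or> \<beta> (E x) = 1" using bB[of "E x"] E(1) by auto
    then show "x \<in> A1 \<union> A2" using x by (auto simp: A1_def A2_def)
  qed
  have zBz: "z \<in> Bz z" using c(2) \<rho> by (simp add: Bz_def)
  then have zB: "z \<in> B" using BV[OF z] by blast
  have "\<beta> z = 1" using bB[OF zB] zBz by simp
  moreover have "E' z \<in> X" "E (E' z) = z" using bspec[OF E(2) zB] by blast+
  ultimately have "E' z \<in> A1" unfolding A1_def mem_Collect_eq by (simp only:) simp
  then have "A1 \<noteq> {}" by blast
  moreover have "A1 \<inter> A2 = {}" by (auto simp: A1_def A2_def)
  ultimately have "A2 = {}" using con o cover unfolding connected_space_def by metis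
  then have e: "{x \<in> X. \<beta> (E x) < 1 / 2} = {}" by (simp add: A2_def)
  have "B \<subseteq> Bz z"
  proof
    fix y assume y: "y \<in> B"
    then have "E' y \<in> X" "E (E' y) = y" using E(2) by auto
    then have "\<not> \<beta> y < 1 / 2" using e by auto
    then show "y \<in> Bz z" using bB[OF y] by (auto split: if_splits)
  qed
  then have "B = Bz z" using BV[OF z] by blast
  then have "diffeo_between X {x \<in> U z. \<phi> z x \<in> cball (\<phi> z z) \<rho>}" using diff by (simp add: Bz_def)
  moreover have "cball (\<phi> z z) \<rho> \<subseteq> \<phi> z ` U z" using c(3) \<open>\<rho> < r z\<close> by (meson less_imp_le order_trans subset_cball)
  ultimately show ?thesis using diffeomorphic_closed_disk[OF c(1) \<rho>] by blast
qed

end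

section \<open>Reading off ranks and folds of real functions in charts\<close>

lemma dim_range_real:
  fixes D :: "'x \<Rightarrow> real"
  shows "dim (range D) = 1 \<longleftrightarrow> (\<exists>v. D v \<noteq> 0)" "dim (range D) < 1 \<longleftrightarrow> (\<forall>v. D v = 0)"
proof -
  have "dim (range D) \<le> 1" using dim_subset_UNIV[of "range D"] by simp
  moreover have "dim (range D) = 0 \<longleftrightarrow> (\<forall>v. D v = 0)" by (auto simp: dim_eq_0)
  ultimately show "dim (range D) = 1 \<longleftrightarrow> (\<exists>v. D v \<noteq> 0)" "dim (range D) < 1 \<longleftrightarrow> (\<forall>v. D v = 0)"
    by (auto simp: order_le_less less_Suc0)
qed

text \<open>Uniqueness needs points of the set near \<open>y\<close> along each basis vector. Basis
  vectors have nonnegative last coordinate, so small positive multiples never leave the half space,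
  even at a boundary point.\<close>

lemma half_space_derivative_unique:
  fixes f :: "'m::euclidean_space \<times> real \<Rightarrow> 'b::real_normed_vector"
  assumes "(f has_derivative D1) (at y within W \<inter> half_space)" "(f has_derivative D2) (at y within W \<inter> half_space)"
    and W: "open W" "y \<in> W \<inter> half_space"
  shows "D1 = D2"
proof (rule frechet_derivative_unique_within[OF assms(1,2)])
  fix i :: "'m \<times> real" and e :: real
  assume i: "i \<in> Basis" and e: "0 < e"
  obtain r where r: "0 < r" "ball y r \<subseteq> W" using W open_contains_ball by blast
  define d where "d = min e r / 2"
  have d: "0 < d" "d < e" "d < r" using e r(1) by (auto simp: d_def min_def)
  have "dist y (y + d *\<^sub>R i) < r" using d i by (simp add: dist_norm)
  then have "y + d *\<^sub>R i \<in> W" using r(2) by auto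
  moreover have "0 \<le> snd i" using i by (auto simp: Basis_prod_def)
  then have "y + d *\<^sub>R i \<in> half_space" using W(2) d(1) by (auto simp: half_space_def)
  ultimately show "\<exists>d. 0 < \<bar>d\<bar> \<and> \<bar>d\<bar> < e \<and> y + d *\<^sub>R i \<in> W \<inter> half_space" using d by (intro exI[of _ d]) auto
qed

context smooth_mfd
begin

lemma chart_image:
  assumes "(U, \<phi>) \<in> smooth_charts N"
  obtains W where "open W" "\<phi> ` U = W \<inter> half_space"
  using is_chart_image_open[OF smooth_charts_is_chart[OF assms] chartD(1)[OF assms]] by auto

text \<open>Together with its counterpart for the boundary this translates the derivatives in
  \<open>submersion\<close> and \<open>boundary_singular_point\<close> into those of a local
  extension, which all other arguments use.\<close>

lemma chart_frechet_derivative: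
  fixes F :: "'a \<Rightarrow> 'b::real_normed_vector"
  assumes c: "(U, \<phi>) \<in> smooth_charts N" "p \<in> U" and h: "Cinf W h" "\<phi> p \<in> W"
    "\<And>x. x \<in> U \<Longrightarrow> \<phi> x \<in> W \<Longrightarrow> h (\<phi> x) = F x"
  shows "frechet_derivative (F \<circ> inv_into U \<phi>) (at (\<phi> p) within \<phi> ` U) = frechet_derivative h (at (\<phi> p))"
proof -
  obtain W0 where W0: "open W0" "\<phi> ` U = W0 \<inter> half_space" using chart_image[OF c(1)] by blast
  obtain r where r: "0 < r" "ball (\<phi> p) r \<subseteq> W" using Cinf_open[OF h(1)] h(2) open_contains_ball by blast
  have "(h has_derivative frechet_derivative h (at (\<phi> p))) (at (\<phi> p) within \<phi> ` U)"
    by (rule has_derivative_at_withinI[OF Cinf_has_derivative[OF h(1,2)]])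
  then have d: "((F \<circ> inv_into U \<phi>) has_derivative frechet_derivative h (at (\<phi> p))) (at (\<phi> p) within \<phi> ` U)"
  proof (rule has_derivative_transform_within[OF _ r(1)])
    show "\<phi> p \<in> \<phi> ` U" using c(2) by blast
    show "h y = (F \<circ> inv_into U \<phi>) y" if y: "y \<in> \<phi> ` U" "dist y (\<phi> p) < r" for y
    proof -
      obtain x where x: "x \<in> U" "y = \<phi> x" using y(1) by blast
      moreover have "y \<in> W" using y(2) subsetD[OF r(2), of y] by (simp add: dist_commute)
      ultimately show ?thesis using h(3) chartD(5)[OF c(1)] by simp
    qed
  qed
  then have "((F \<circ> inv_into U \<phi>) has_derivative frechet_derivative (F \<circ> inv_into U \<phi>) (at (\<phi> p) within \<phi> ` U))
      (at (\<phi> p) within \<phi> ` U)"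
    using frechet_derivative_works differentiable_def by blast
  from half_space_derivative_unique[OF this[unfolded W0(2)] d[unfolded W0(2)] W0(1)] show ?thesis
    using W0(2) c(2) by auto
qed

lemma chart_boundary_frechet_derivative:
  fixes F :: "'a \<Rightarrow> 'b::real_normed_vector"
  assumes c: "(U, \<phi>) \<in> smooth_charts N" "p \<in> U" and p: "snd (\<phi> p) = 0" and h: "Cinf W h" "\<phi> p \<in> W"
    "\<And>x. x \<in> U \<Longrightarrow> \<phi> x \<in> W \<Longrightarrow> h (\<phi> x) = F x"
  shows "frechet_derivative (\<lambda>y. F (inv_into U \<phi> (y, 0))) (at (fst (\<phi> p))) = (\<lambda>w. frechet_derivative h (at (\<phi> p)) (w, 0))"
proof -
  obtain W0 where W0: "open W0" "\<phi> ` U = W0 \<inter> half_space" using chart_image[OF c(1)] by blast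
  have p': "(fst (\<phi> p), 0) = \<phi> p" using p by (simp add: prod_eq_iff)
  have "((\<lambda>y. (y, 0::real)) has_derivative (\<lambda>w. (w, 0))) (at (fst (\<phi> p)))"
    by (auto intro!: derivative_eq_intros)
  from has_derivative_compose[OF this, of h] Cinf_has_derivative[OF h(1,2)]
  have "((\<lambda>y. h (y, 0)) has_derivative (\<lambda>w. frechet_derivative h (at (\<phi> p)) (w, 0))) (at (fst (\<phi> p)))"
    by (simp add: p')
  then have "((\<lambda>y. F (inv_into U \<phi> (y, 0))) has_derivative (\<lambda>w. frechet_derivative h (at (\<phi> p)) (w, 0))) (at (fst (\<phi> p)))"
  proof (rule has_derivative_transform_within_open)
    show "open ((\<lambda>y. (y, 0::real)) -` (W \<inter> W0))"
      using Cinf_open[OF h(1)] W0(1) by (intro open_vimage open_Int continuous_intros)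
    show "fst (\<phi> p) \<in> (\<lambda>y. (y, 0::real)) -` (W \<inter> W0)" using h(2) c(2) W0(2) by (auto simp: p')
    show "h (y, 0) = F (inv_into U \<phi> (y, 0))" if y: "y \<in> (\<lambda>y. (y, 0::real)) -` (W \<inter> W0)" for y
    proof -
      have "(y, 0) \<in> \<phi> ` U" using y W0(2) by (auto simp: half_space_def)
      then obtain x where "x \<in> U" "(y, 0) = \<phi> x" by blast
      then show ?thesis using h(3)[of x] y chartD(5)[OF c(1)] by auto
    qed
  qed
  then show ?thesis by (rule frechet_derivativeI)
qed

lemma smooth_fun_smooth_in:
  fixes F :: "'a \<Rightarrow> 'e::euclidean_space"
  shows "smooth_fun N F \<longleftrightarrow> smooth_in N X F"
proof
  assume F: "smooth_fun N F"
  show "smooth_in N X F"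
    unfolding smooth_in_def
  proof
    fix p assume "p \<in> X"
    then obtain U \<phi> where c: "(U, \<phi>) \<in> atlas N" "p \<in> U" using atlas_cover by blast
    have c': "(U, \<phi>) \<in> smooth_charts N" using c(1) atlas_smooth_charts by blast
    have "smooth_on (\<phi> ` U) (F \<circ> inv_into U \<phi>)" using F c(1) unfolding smooth_fun_def by blast
    moreover have "\<phi> p \<in> \<phi> ` U" using c(2) by blast
    ultimately obtain W h where h: "Cinf W h" "\<phi> p \<in> W" "\<And>y. y \<in> \<phi> ` U \<inter> W \<Longrightarrow> h y = (F \<circ> inv_into U \<phi>) y"
      unfolding smooth_on_Cinf by meson
    have "ext_at U \<phi> X F p"
      unfolding ext_at_def using h chartD(5)[OF c'] by (intro exI[of _ W] exI[of _ h]) auto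
    then show "smooth_at N X F p" using c unfolding smooth_at_def by blast
  qed
next
  assume F: "smooth_in N X F"
  show "smooth_fun N F"
    unfolding smooth_fun_def
  proof (intro ballI, clarify)
    fix U \<phi> assume "(U, \<phi>) \<in> atlas N"
    then have c: "(U, \<phi>) \<in> smooth_charts N" using atlas_smooth_charts by blast
    have "ext_at U \<phi> X F p" if "p \<in> U" for p
      using smooth_at_chart[OF _ c that] F chartD(2)[OF c] that unfolding smooth_in_def by blast
    then show "smooth_on (\<phi> ` U) (F \<circ> inv_into U \<phi>)"
      unfolding smooth_on_Cinf
    proof (intro ballI)
      fix y assume e: "\<And>p. p \<in> U \<Longrightarrow> ext_at U \<phi> X F p" and "y \<in> \<phi> ` U"
      then obtain p where p: "p \<in> U" "y = \<phi> p" by blast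
      obtain W h where h: "Cinf W h" "\<phi> p \<in> W" "\<And>x. x \<in> X \<inter> U \<Longrightarrow> \<phi> x \<in> W \<Longrightarrow> h (\<phi> x) = F x"
        using e[OF p(1)] unfolding ext_at_def by blast
      have "h z = (F \<circ> inv_into U \<phi>) z" if "z \<in> \<phi> ` U \<inter> W" for z
        using that h(3) chartD(2,5)[OF c] by auto
      then show "\<exists>W h. Cinf W h \<and> y \<in> W \<and> (\<forall>z\<in>\<phi> ` U \<inter> W. h z = (F \<circ> inv_into U \<phi>) z)"
        using h(1,2) p(2) by blast
    qed
  qed
qed

end

text \<open>A coordinate composed with its inverse is the identity, so by the chain rule the
  derivative of the inverse is a factor of 1 and cannot vanish.\<close>

lemma local_coordinates_real:
  assumes "local_coordinates W \<psi>" "t \<in> \<psi> ` W"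
  shows "\<exists>V \<theta>. Cinf V \<theta> \<and> t \<in> V \<and> V \<subseteq> \<psi> ` W \<and> (\<forall>s\<in>V. \<theta> s = inv_into W \<psi> s) \<and> frechet_derivative \<theta> (at t) (1::real) \<noteq> 0"
proof -
  have lc: "open W" "open (\<psi> ` W)" "inj_on \<psi> W" "smooth_on W \<psi>" "smooth_on (\<psi> ` W) (inv_into W \<psi>)"
    using assms(1) by (auto simp: local_coordinates_def)
  obtain W1 \<theta> where t1: "Cinf W1 \<theta>" "t \<in> W1" "\<And>s. s \<in> \<psi> ` W \<inter> W1 \<Longrightarrow> \<theta> s = inv_into W \<psi> s"
    using lc(5) assms(2) unfolding smooth_on_Cinf by meson
  have iW: "inv_into W \<psi> s \<in> W" "\<psi> (inv_into W \<psi> s) = s" if "s \<in> \<psi> ` W" for s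
    using that by (auto simp: inv_into_into f_inv_into_f)
  obtain W2 \<psi>1 where p1: "Cinf W2 \<psi>1" "inv_into W \<psi> t \<in> W2" "\<And>s. s \<in> W \<inter> W2 \<Longrightarrow> \<psi>1 s = \<psi> s"
    using lc(4) iW(1)[OF assms(2)] unfolding smooth_on_Cinf by meson
  define V where "V = W1 \<inter> \<psi> ` W"
  have V: "Cinf V \<theta>" unfolding V_def using lc(2) Cinf_open[OF t1(1)] by (intro Cinf_subset[OF t1(1)]) auto
  have th: "\<theta> s = inv_into W \<psi> s" if "s \<in> V" for s using t1(3) that by (auto simp: V_def)
  have tV: "t \<in> V" using t1(2) assms(2) by (simp add: V_def)
  let ?V = "V \<inter> \<theta> -` W2"
  have o: "open ?V"
    by (intro continuous_open_preimage Cinf_continuous_on[OF V] Cinf_open[OF V] Cinf_open[OF p1(1)])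
  have id: "s = \<psi>1 (\<theta> s)" if "s \<in> ?V" for s
    using that th[of s] iW[of s] p1(3)[of "\<theta> s"] by (auto simp: V_def)
  have "t \<in> ?V" using tV th p1(2) by simp
  from has_derivative_transform_within_open[OF has_derivative_ident o this id]
  have "((\<lambda>s. \<psi>1 (\<theta> s)) has_derivative (\<lambda>w. w)) (at t)" .
  then have "frechet_derivative (\<lambda>s. \<psi>1 (\<theta> s)) (at t) 1 = 1" by (simp add: frechet_derivativeI)
  moreover have "\<theta> t \<in> W2" using th[OF tV] p1(2) by simp
  ultimately have "frechet_derivative \<psi>1 (at (\<theta> t)) (frechet_derivative \<theta> (at t) 1) = 1"
    using Cinf_frechet_derivative_compose[OF V p1(1) tV, of 1] by simp
  moreover have "frechet_derivative \<psi>1 (at (\<theta> t)) 0 = 0"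
    using linear_0[OF has_derivative_linear[OF Cinf_has_derivative[OF p1(1) \<open>\<theta> t \<in> W2\<close>]]] .
  ultimately have "frechet_derivative \<theta> (at t) 1 \<noteq> 0" by auto
  then show ?thesis using V th tV by (intro exI[of _ V] exI[of _ \<theta>]) (auto simp: V_def)
qed

context compact_mfd
begin

text \<open>With \<open>\<theta>\<close> the inverse of the coordinate on the target,
  \<open>F\<close> is \<open>\<theta>\<close> of the fold form, and the sign of the derivative of
  \<open>\<theta>\<close> at 0 decides. If it is negative, the fold is a local maximum and the
  outward normal \<open>(0, -1)\<close> increases \<open>F\<close>.\<close>

lemma definite_fold_point_cases:
  fixes F :: "'a \<Rightarrow> real"
  assumes "boundary_definite_fold_point N F p"
  shows "increasing_at N F p \<or> minimum_fold N F p"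
proof -
  obtain U \<phi> W \<psi> b c where c: "(U, \<phi>) \<in> smooth_charts N" "p \<in> U" "\<phi> p = 0" and W: "local_coordinates W \<psi>" "F ` U \<subseteq> W"
    and b: "bij_betw b {1..DIM('m)} (Basis :: 'm set)" "bij_betw c {1..DIM(real)} (Basis :: real set)"
    and eq: "\<forall>q\<in>U. \<psi> (F q) \<bullet> c DIM(real) = (\<Sum>i=DIM(real)..DIM('m). (fst (\<phi> q) \<bullet> b i)\<^sup>2) + snd (\<phi> q)"
    using assms unfolding boundary_definite_fold_point_def by blast
  \<comment> \<open>For \<open>k = 1\<close> the numbering of the target basis has no freedom, and
    the sum of squares covers all of the first component, whatever the numbering
    \<open>b\<close>.\<close>
  have "c 1 = 1" using b(2) by (auto simp: bij_betw_def)
  moreover have "(\<Sum>i=1..DIM('m). (x \<bullet> b i)\<^sup>2) = x \<bullet> x" for x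
    using sum.reindex_bij_betw[OF b(1), of "\<lambda>i. (x \<bullet> i)\<^sup>2"] euclidean_inner[of x x] by (simp add: power2_eq_square)
  ultimately have eq': "\<psi> (F q) = fold_form (\<phi> q)" if "q \<in> U" for q
    using eq that by (simp add: fold_form_def)
  have FW: "F q \<in> W" if "q \<in> U" for q using W(2) that by blast
  have "0 \<in> \<psi> ` W" using eq'[OF c(2)] c(3) FW[OF c(2)] by (force simp: fold_form_def)
  then obtain V \<theta> where V: "Cinf V \<theta>" "0 \<in> V" "\<forall>s\<in>V. \<theta> s = inv_into W \<psi> s" "frechet_derivative \<theta> (at 0) 1 \<noteq> 0"
    using local_coordinates_real[OF W(1)] by blast
  have F: "F q = \<theta> (fold_form (\<phi> q))" if "q \<in> U" "fold_form (\<phi> q) \<in> V" for q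
  proof -
    have "inv_into W \<psi> (\<psi> (F q)) = F q" using W(1) FW[OF that(1)] by (simp add: local_coordinates_def)
    then show ?thesis using V(3) that(2) eq'[OF that(1)] by simp
  qed
  show ?thesis
  proof (cases "0 < frechet_derivative \<theta> (at 0) 1")
    case True
    let ?V = "V \<inter> (\<lambda>t. frechet_derivative \<theta> (at t) 1) -` {0<..}"
    have o: "open ?V"
      by (intro continuous_open_preimage Cinf_continuous_on[OF Cinf_derivative[OF V(1)]] Cinf_open[OF V(1)] open_greaterThan)
    have "Cinf ?V \<theta>" by (rule Cinf_subset[OF V(1) o]) auto
    moreover have "0 \<in> ?V" using V(2) True by simp
    moreover have "\<forall>t\<in>?V. 0 < frechet_derivative \<theta> (at t) 1" by auto
    moreover have "\<forall>x\<in>U. fold_form (\<phi> x) \<in> ?V \<longrightarrow> F x = \<theta> (fold_form (\<phi> x))" using F by blast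
    ultimately have "minimum_fold N F p" unfolding minimum_fold_def using c by blast
    then show ?thesis by blast
  next
    case False
    let ?W = "fold_form -` V \<inter> (UNIV :: ('m \<times> real) set)"
    have o: "open ?W"
      using Cinf_open[OF V(1)] unfolding fold_form_def by (auto intro!: open_vimage continuous_intros)
    have f0: "fold_form (0 :: 'm \<times> real) = 0" by (simp add: fold_form_def)
    have "((\<lambda>y. \<theta> (fold_form y)) has_derivative (\<lambda>w. frechet_derivative \<theta> (at (fold_form (0::'m \<times> real))) 1 * (2 * (fst (0::'m \<times> real) \<bullet> fst w) + snd w))) (at (0 :: 'm \<times> real))"
      by (rule frechet_derivative_real_compose[OF V(1) _ fold_form_has_derivative]) (simp add: f0 V(2))
    from frechet_derivativeI[OF this]
    have "frechet_derivative (\<lambda>y. \<theta> (fold_form y)) (at (0 :: 'm \<times> real)) (0, - 1) = - frechet_derivative \<theta> (at 0) 1"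
      by (simp add: f0)
    then have "0 < frechet_derivative (\<lambda>y. \<theta> (fold_form y)) (at (\<phi> p)) (0, - 1)" using False V(4) c(3) by simp
    moreover have "Cinf ?W (\<lambda>y. \<theta> (fold_form y))"
      by (rule Cinf_compose[OF Cinf_fold_form[OF o] V(1)]) auto
    ultimately have "upward U \<phi> (0, - 1) F p"
      using c(2,3) F V(2) f0 by (intro upwardI[of p U ?W "\<lambda>y. \<theta> (fold_form y)" \<phi>]) auto
    then have "increasing_at N F p" unfolding increasing_at_def using c(1) by force
    then show ?thesis by blast
  qed
qed

lemma boundary_special_generic_cases:
  fixes F :: "'a \<Rightarrow> real"
  assumes F: "boundary_special_generic N F" and p: "p \<in> X"
  shows "increasing_at N F p \<or> (p \<in> manifold_boundary N \<and> minimum_fold N F p)"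
proof -
  obtain U \<phi> where u: "(U, \<phi>) \<in> atlas N" "p \<in> U" using atlas_cover p by blast
  have c: "(U, \<phi>) \<in> smooth_charts N" using u(1) atlas_smooth_charts by blast
  have sF: "smooth_in N X F" using F by (simp add: boundary_special_generic_def submersion_def smooth_fun_smooth_in)
  obtain W h where h: "Cinf W h" "\<phi> p \<in> W" "W \<inter> half_space \<subseteq> \<phi> ` U" "\<And>x. x \<in> U \<Longrightarrow> \<phi> x \<in> W \<Longrightarrow> h (\<phi> x) = F x"
    using chart_extension[OF c u(2) sF] by metis
  let ?D = "frechet_derivative h (at (\<phi> p))"
  have lin: "linear ?D" using has_derivative_linear[OF Cinf_has_derivative[OF h(1,2)]] .
  have up: "upward U \<phi> v F p" if "0 < ?D v" for v by (rule upwardI[of p U W h \<phi>, OF u(2) h(1,2,4) that])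
  show ?thesis
  proof (cases "snd (\<phi> p) = 0")
    case False
    have "dim (range (frechet_derivative (F \<circ> inv_into U \<phi>) (at (\<phi> p) within \<phi> ` U))) = DIM(real)"
      using F u unfolding boundary_special_generic_def submersion_def by blast
    moreover have "frechet_derivative (F \<circ> inv_into U \<phi>) (at (\<phi> p) within \<phi> ` U) = ?D"
      by (rule chart_frechet_derivative[OF c u(2) h(1,2)]) (rule h(4))
    ultimately obtain v where "?D v \<noteq> 0" using dim_range_real(1)[of ?D] by auto
    then have "0 < ?D v \<or> 0 < ?D (- v)" using linear_neg[OF lin, of v] by auto
    then show ?thesis using up c False unfolding increasing_at_def by blast
  next
    case True
    then have bd: "p \<in> manifold_boundary N" using manifold_boundary_chart[OF c u(2)] by blast
    show ?thesis
    proof (cases "boundary_singular_point N F p")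
      case True
      then have "boundary_definite_fold_point N F p" using F unfolding boundary_special_generic_def by blast
      then show ?thesis using definite_fold_point_cases bd by blast
    next
      case False
      then have "\<not> dim (range (frechet_derivative (\<lambda>y. F (inv_into U \<phi> (y, 0))) (at (fst (\<phi> p))))) < DIM(real)"
        using bd u unfolding boundary_singular_point_def by blast
      moreover have "frechet_derivative (\<lambda>y. F (inv_into U \<phi> (y, 0))) (at (fst (\<phi> p))) = (\<lambda>w. ?D (w, 0))"
        by (rule chart_boundary_frechet_derivative[OF c u(2) True h(1,2)]) (rule h(4))
      ultimately obtain w where w: "?D (w, 0) \<noteq> 0"
        using dim_range_real(2)[of "\<lambda>w. ?D (w, 0)"] by auto
      \<comment> \<open>At a regular boundary point the tangential derivative is nonzero, so adding
        a suitable multiple of a tangential vector to the outward normal gives the derivative 1,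
        whatever the normal derivative is.\<close>
      define k where "k = (?D (0, 1) + 1) / ?D (w, 0)"
      have "(k *\<^sub>R w, - 1) = k *\<^sub>R (w, 0) - (0, 1 :: real)" by simp
      then have "?D (k *\<^sub>R w, - 1) = k *\<^sub>R ?D (w, 0) - ?D (0, 1)"
        using linear_diff[OF lin] linear_scale[OF lin] by metis
      also have "\<dots> = 1" using w by (simp add: k_def)
      finally have "upward U \<phi> (k *\<^sub>R w, - 1) F p" by (intro up) simp
      then show ?thesis using c unfolding increasing_at_def by force
    qed
  qed
qed

theorem boundary_special_generic_imp_disk:
  fixes F :: "'a \<Rightarrow> real"
  assumes F: "boundary_special_generic N F" and con: "connected_space T" and X: "X \<noteq> {}"
  shows "diffeomorphic N (closed_disk :: ('m \<times> real, 'm) manifold)"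
proof -
  have sF: "smooth_in N X F" using F by (simp add: boundary_special_generic_def submersion_def smooth_fun_smooth_in)
  obtain G Z C where G: "smooth_in N X (G :: 'a \<Rightarrow> real)" "finite Z" "\<forall>x\<in>X - Z. increasing_at N G x"
    "\<forall>z\<in>Z. standard_minimum G C z"
    using remove_folds[OF sF X boundary_special_generic_cases[OF F]] unfolding standard_minimum_def by metis
  obtain f C' where f: "smooth_in N X f" "\<forall>x\<in>X. f x \<le> 0" "\<forall>x\<in>X. f x = 0 \<longleftrightarrow> x \<in> manifold_boundary N"
    "\<forall>x\<in>X - Z. increasing_at N f x" "\<forall>z\<in>Z. standard_minimum f C' z"
    using constant_on_boundary[OF G(1) X G(2)] G(3,4) by metis
  show ?thesis
    by (rule diffeomorphic_disk_if_standard[OF con X f(1) _ _ G(2)]) (use f in auto)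
qed

end

section \<open>The height function on the disk\<close>

text \<open>The atlas of the disk contains all diffeomorphisms onto open subsets of the half space,
  so an explicit smooth inverse is all that has to be exhibited.\<close>

lemma disk_atlasI:
  fixes \<phi> \<chi>' :: "'m::euclidean_space \<times> real \<Rightarrow> 'm \<times> real"
  assumes U: "openin (top_of_set (cball 0 1)) U" "openin (top_of_set half_space) (\<phi> ` U)"
    and s: "smooth_on U \<phi>" "smooth_on (\<phi> ` U) \<chi>'" and inv: "\<And>q. q \<in> U \<Longrightarrow> \<chi>' (\<phi> q) = q"
  shows "(U, \<phi>) \<in> atlas (closed_disk :: ('m \<times> real, 'm) manifold)"
proof -
  have sub: "U \<subseteq> cball 0 1" using openin_subset[OF U(1)] by simp
  have inj: "inj_on \<phi> U" using inv by (rule inj_on_inverseI)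
  have "homeomorphic_maps (top_of_set U) (top_of_set (\<phi> ` U)) \<phi> \<chi>'"
    using inv smooth_on_continuous_on[OF s(1)] smooth_on_continuous_on[OF s(2)]
    by (auto simp: homeomorphic_maps_def)
  then have "homeomorphic_map (subtopology (top_of_set (cball 0 1)) U) (top_of_set (\<phi> ` U)) \<phi>"
    using sub by (simp add: subtopology_subtopology Int_absorb1 homeomorphic_maps_map)
  then have "is_chart (top_of_set (cball 0 1)) (U, \<phi>)" using U by (simp add: is_chart_def)
  moreover have "smooth_on (\<phi> ` U) (inv_into U \<phi>)"
    by (rule smooth_on_cong[OF s(2)]) (use inv inj in auto)
  ultimately show ?thesis using s(1) by (simp add: closed_disk_def)
qed

text \<open>The inversion at \<open>(0, -1)\<close> of radius \<open>\<surd>2\<close>, an involution that exchanges the half space with the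
  ball without the centre of inversion.\<close>

definition cayley :: "'m::euclidean_space \<times> real \<Rightarrow> 'm \<times> real" where
  "cayley q = (2 / ((q + (0, 1)) \<bullet> (q + (0, 1)))) *\<^sub>R (q + (0, 1)) - (0, 1)"

lemma cayley_add: "cayley q + (0, 1) = (2 / ((q + (0, 1)) \<bullet> (q + (0, 1)))) *\<^sub>R (q + (0, 1))"
  by (simp add: cayley_def)

lemma cayley_involution:
  assumes "q \<noteq> (0, - 1)" shows "cayley (cayley q) = q" "cayley q \<noteq> (0, - 1)"
proof -
  define u where "u = q + (0, 1)"
  have u: "u \<bullet> u \<noteq> 0" using assms by (auto simp: u_def prod_eq_iff add_eq_0_iff)
  have c: "cayley q + (0, 1) = (2 / (u \<bullet> u)) *\<^sub>R u" by (simp add: cayley_add u_def)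
  have "(cayley q + (0, 1)) \<bullet> (cayley q + (0, 1)) = 4 / (u \<bullet> u)"
    unfolding c using u by (simp add: field_simps power2_eq_square)
  then have "cayley (cayley q) + (0, 1) = (2 / (4 / (u \<bullet> u))) *\<^sub>R ((2 / (u \<bullet> u)) *\<^sub>R u)"
    by (simp only: cayley_add[of "cayley q"] c)
  also have "\<dots> = u" using u by simp
  finally show "cayley (cayley q) = q" by (simp add: u_def)
  have "(2 / (u \<bullet> u)) *\<^sub>R u \<noteq> 0" using u by auto
  then show "cayley q \<noteq> (0, - 1)" unfolding c[symmetric] by (auto simp: prod_eq_iff)
qed

text \<open>The numerator \<open>1 - |q|^2\<close> is the reason why the ball corresponds to the
  half space and the sphere to its boundary.\<close>

lemma snd_cayley:
  assumes "q \<noteq> (0, - 1)"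
  shows "snd (cayley q) = (1 - (norm q)\<^sup>2) / ((q + (0, 1)) \<bullet> (q + (0, 1)))" "0 < (q + (0, 1)) \<bullet> (q + (0, 1))"
proof -
  have "q + (0, 1) \<noteq> 0" using assms by (auto simp: prod_eq_iff add_eq_0_iff)
  then show p: "0 < (q + (0, 1)) \<bullet> (q + (0, 1))" by simp
  have "(q + (0, 1)) \<bullet> (q + (0, 1)) = (norm q)\<^sup>2 + 2 * snd q + 1"
    by (simp add: inner_prod_def power2_norm_eq_inner algebra_simps)
  moreover have "snd (cayley q) = 2 * (snd q + 1) / ((q + (0, 1)) \<bullet> (q + (0, 1))) - 1"
    by (simp add: cayley_def)
  ultimately show "snd (cayley q) = (1 - (norm q)\<^sup>2) / ((q + (0, 1)) \<bullet> (q + (0, 1)))"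
    using p by (simp add: field_simps)
qed

lemma cayley_half_space:
  assumes "q \<noteq> (0, - 1)"
  shows "cayley q \<in> half_space \<longleftrightarrow> norm q \<le> 1" "snd (cayley q) = 0 \<longleftrightarrow> norm q = 1"
proof -
  define b where "b = (q + (0, 1)) \<bullet> (q + (0, 1))"
  have b: "0 < b" "snd (cayley q) = (1 - (norm q)\<^sup>2) / b" using snd_cayley[OF assms] by (simp_all only: b_def)
  have "cayley q \<in> half_space \<longleftrightarrow> (norm q)\<^sup>2 \<le> 1"
    using b(1) by (simp add: half_space_def b(2) zero_le_divide_iff)
  then show "cayley q \<in> half_space \<longleftrightarrow> norm q \<le> 1" by (simp add: power_le_one_iff)
  have "snd (cayley q) = 0 \<longleftrightarrow> (norm q)\<^sup>2 = 1\<^sup>2" using b(1) by (auto simp: b(2))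
  also have "\<dots> \<longleftrightarrow> norm q = 1" using power2_eq_iff_nonneg[of "norm q" 1] by simp
  finally show "snd (cayley q) = 0 \<longleftrightarrow> norm q = 1" .
qed

lemma Cinf_cayley: "Cinf (- {(0, - 1)}) (cayley :: 'm::euclidean_space \<times> real \<Rightarrow> _)"
proof -
  let ?W = "- {(0, - 1)} :: ('m \<times> real) set"
  have o: "open ?W" by (intro open_Compl closed_singleton)
  have u: "Cinf ?W (\<lambda>q. q + (0, 1))" by (rule Cinf_add[OF Cinf_id[OF o] Cinf_const[OF o]])
  have "Cinf ?W (\<lambda>q. 2 / ((q + (0, 1)) \<bullet> (q + (0, 1))))"
  proof (rule Cinf_divide[OF Cinf_const[OF o] Cinf_inner[OF u u]])
    fix q assume "q \<in> ?W"
    then show "(q + (0, 1)) \<bullet> (q + (0, 1)) \<noteq> 0" using snd_cayley(2)[of q] by simp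
  qed
  from Cinf_diff[OF Cinf_scaleR[OF this u] Cinf_const[OF o]] show ?thesis unfolding cayley_def .
qed

text \<open>The disk without the pole \<open>(0, -s)\<close>. Two values of \<open>s\<close> are
  needed because each inversion misses its own centre; for \<open>s = -1\<close> the inversion is
  preceded by the antipodal map.\<close>

definition cayley_domain :: "real \<Rightarrow> ('m::euclidean_space \<times> real) set" where
  "cayley_domain s = cball 0 1 - {(0, - s)}"

lemma cayley_domain_ne:
  assumes s: "s = 1 \<or> s = - 1" and q: "q \<noteq> (0, - s)"
  shows "s *\<^sub>R q \<noteq> (0, - 1)"
proof
  assume "s *\<^sub>R q = (0, - 1)"
  then have "s *\<^sub>R s *\<^sub>R q = (0, - s)" by simp
  then show False using s q by auto
qed

lemma cayley_inverse:
  assumes s: "s = 1 \<or> s = - 1" and q: "q \<noteq> (0, - s)"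
  shows "s *\<^sub>R cayley (cayley (s *\<^sub>R q)) = q"
proof -
  have "s * s = 1" using s by auto
  then show ?thesis using cayley_involution(1)[OF cayley_domain_ne[OF assms]] by simp
qed

lemma Cinf_cayley_scale:
  assumes s: "s = 1 \<or> s = - 1"
  shows "Cinf (- {(0, - s)}) (\<lambda>q :: 'm::euclidean_space \<times> real. cayley (s *\<^sub>R q))"
proof (rule Cinf_compose[OF _ Cinf_cayley])
  show "Cinf (- {(0, - s)}) (\<lambda>q :: 'm \<times> real. s *\<^sub>R q)" by (intro Cinf_scaleR Cinf_const Cinf_id open_Compl closed_singleton)
  show "s *\<^sub>R q \<in> - {(0, - 1)}" if "q \<in> - {(0, - s)}" for q :: "'m \<times> real"
    using cayley_domain_ne[OF s, of q] that by simp
qed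

lemma smooth_on_cayley_inverse: "smooth_on half_space (\<lambda>y :: 'm::euclidean_space \<times> real. s *\<^sub>R cayley y)"
proof (rule Cinf_smooth_on)
  show "Cinf (- {(0, - 1)}) (\<lambda>y :: 'm \<times> real. s *\<^sub>R cayley y)"
    by (intro Cinf_scaleR Cinf_const Cinf_cayley open_Compl closed_singleton)
qed (auto simp: half_space_def)

lemma cayley_disk_chart:
  assumes s: "s = 1 \<or> s = - 1"
  shows "(cayley_domain s, \<lambda>q. cayley (s *\<^sub>R q)) \<in> atlas (closed_disk :: ('m::euclidean_space \<times> real, 'm) manifold)"
    and "(\<lambda>q. cayley (s *\<^sub>R q)) ` cayley_domain s = (half_space :: ('m \<times> real) set)"
proof -
  have ss: "s * s = 1" using s by auto
  have ne: "s *\<^sub>R q \<noteq> (0, - 1)" if "q \<in> cayley_domain s" for q :: "'m \<times> real"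
    using cayley_domain_ne[OF s, of q] that by (simp add: cayley_domain_def)
  show img: "(\<lambda>q. cayley (s *\<^sub>R q)) ` cayley_domain s = (half_space :: ('m \<times> real) set)"
  proof (intro equalityI subsetI)
    fix y :: "'m \<times> real" assume "y \<in> (\<lambda>q. cayley (s *\<^sub>R q)) ` cayley_domain s"
    then obtain q where q: "q \<in> cayley_domain s" "y = cayley (s *\<^sub>R q)" by blast
    have "norm (s *\<^sub>R q) \<le> 1" using q(1) s by (auto simp: cayley_domain_def)
    then show "y \<in> half_space" using cayley_half_space(1)[OF ne[OF q(1)]] q(2) by simp
  next
    fix y :: "'m \<times> real" assume y: "y \<in> half_space"
    then have y': "y \<noteq> (0, - 1)" by (auto simp: half_space_def)
    have "norm (cayley y) \<le> 1" using cayley_half_space(1)[OF cayley_involution(2)[OF y']] cayley_involution(1)[OF y'] y by simp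
    moreover have "s *\<^sub>R cayley y \<noteq> (0, - s)"
    proof
      assume "s *\<^sub>R cayley y = (0, - s)"
      then have "s *\<^sub>R s *\<^sub>R cayley y = (0, - (s * s))" by simp
      then show False using cayley_involution(2)[OF y'] ss by simp
    qed
    ultimately have "s *\<^sub>R cayley y \<in> cayley_domain s" using s by (auto simp: cayley_domain_def)
    moreover have "cayley (s *\<^sub>R s *\<^sub>R cayley y) = y" using ss cayley_involution(1)[OF y'] by simp
    ultimately show "y \<in> (\<lambda>q. cayley (s *\<^sub>R q)) ` cayley_domain s" by (metis image_eqI)
  qed
  show "(cayley_domain s, \<lambda>q. cayley (s *\<^sub>R q)) \<in> atlas (closed_disk :: ('m \<times> real, 'm) manifold)"
  proof (rule disk_atlasI[where \<chi>'="\<lambda>y. s *\<^sub>R cayley y"])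
    show "openin (top_of_set (cball 0 1)) (cayley_domain s :: ('m \<times> real) set)"
      by (auto simp: cayley_domain_def openin_open intro!: exI[of _ "- {(0, - s)}"])
    show "smooth_on (cayley_domain s) (\<lambda>q :: 'm \<times> real. cayley (s *\<^sub>R q))"
      by (rule Cinf_smooth_on[OF Cinf_cayley_scale[OF s]]) (auto simp: cayley_domain_def)
    show "smooth_on ((\<lambda>q. cayley (s *\<^sub>R q)) ` cayley_domain s) (\<lambda>y :: 'm \<times> real. s *\<^sub>R cayley y)"
      unfolding img by (rule smooth_on_cayley_inverse)
    show "s *\<^sub>R cayley (cayley (s *\<^sub>R q)) = q" if "q \<in> cayley_domain s" for q :: "'m \<times> real"
      using that by (intro cayley_inverse[OF s]) (auto simp: cayley_domain_def)
  qed (simp add: img)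
qed

definition pole_domain :: "real \<Rightarrow> ('m::euclidean_space \<times> real) set" where
  "pole_domain s = {q \<in> cball 0 1. 0 < s * snd q}"

definition pole_chart :: "'m::euclidean_space \<times> real \<Rightarrow> 'm \<times> real" where
  "pole_chart q = (fst q, 1 - (snd q)\<^sup>2 - fst q \<bullet> fst q)"

lemma pole_disk_chart:
  assumes s: "s = 1 \<or> s = - 1"
  shows "(pole_domain s, pole_chart) \<in> atlas (closed_disk :: ('m::euclidean_space \<times> real, 'm) manifold)"
proof -
  have ss: "s * s = 1" using s by auto
  have nrm: "(norm q)\<^sup>2 = fst q \<bullet> fst q + (snd q)\<^sup>2" for q :: "'m \<times> real"
    by (simp add: norm_prod_def dot_square_norm)
  have cb: "q \<in> cball 0 1 \<longleftrightarrow> fst q \<bullet> fst q + (snd q)\<^sup>2 \<le> 1" for q :: "'m \<times> real"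
    unfolding nrm[symmetric] by (simp add: power_le_one_iff)
  let ?\<chi> = "\<lambda>y :: 'm \<times> real. (fst y, s * sqrt (1 - snd y - fst y \<bullet> fst y))"
  \<comment> \<open>In the coordinates of \<open>pole_chart\<close> the expression
    \<open>1 - snd y - fst y \<bullet> fst y\<close> is the square of the height. It is positive off
    the equator and determines the height up to the sign \<open>s\<close>.\<close>
  define W where "W = {y :: 'm \<times> real. 0 < 1 - snd y - fst y \<bullet> fst y}"
  have oW: "open W" unfolding W_def by (intro open_Collect_less continuous_intros)
  have inv: "?\<chi> (pole_chart q) = q" if "q \<in> pole_domain s" for q :: "'m \<times> real"
  proof -
    have "s * sqrt ((snd q)\<^sup>2) = s * \<bar>snd q\<bar>" by simp
    also have "\<dots> = snd q" using that s by (auto simp: pole_domain_def)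
    finally show ?thesis by (simp add: pole_chart_def prod_eq_iff)
  qed
  have img: "pole_chart ` pole_domain s = W \<inter> (half_space :: ('m \<times> real) set)"
  proof (intro equalityI subsetI)
    fix y :: "'m \<times> real" assume "y \<in> pole_chart ` pole_domain s"
    then obtain q where q: "q \<in> pole_domain s" "y = pole_chart q" by blast
    then have "q \<in> cball 0 1" "snd q \<noteq> 0" by (auto simp: pole_domain_def)
    then show "y \<in> W \<inter> half_space" using cb[of q] q(2) by (auto simp: W_def half_space_def pole_chart_def)
  next
    fix y :: "'m \<times> real" assume y: "y \<in> W \<inter> half_space"
    then have p: "0 < 1 - snd y - fst y \<bullet> fst y" "0 \<le> snd y" by (auto simp: W_def half_space_def)
    define t where "t = sqrt (1 - snd y - fst y \<bullet> fst y)"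
    have t: "0 < t" "t\<^sup>2 = 1 - snd y - fst y \<bullet> fst y" using p(1) by (auto simp: t_def)
    have st: "(s * t)\<^sup>2 = t\<^sup>2" using ss by (simp add: power_mult_distrib power2_eq_square[of s])
    have "(fst y, s * t) \<in> cball 0 1" unfolding cb fst_conv snd_conv st t(2) using p(2) by simp
    moreover have "0 < s * (s * t)" using ss t(1) by (simp flip: mult.assoc)
    ultimately have "(fst y, s * t) \<in> pole_domain s" by (simp add: pole_domain_def)
    moreover have "pole_chart (fst y, s * t) = y" by (simp add: pole_chart_def st t(2))
    ultimately show "y \<in> pole_chart ` pole_domain s" by (metis image_eqI)
  qed
  show ?thesis
  proof (rule disk_atlasI[where \<chi>'="?\<chi>"])
    have "open {q :: 'm \<times> real. 0 < s * snd q}" by (intro open_Collect_less continuous_intros)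
    then show "openin (top_of_set (cball 0 1)) (pole_domain s :: ('m \<times> real) set)"
      by (auto simp: pole_domain_def openin_open)
    show "openin (top_of_set half_space) (pole_chart ` pole_domain s :: ('m \<times> real) set)"
      unfolding img using oW by (auto simp: openin_open)
    show "smooth_on (pole_domain s) (pole_chart :: 'm \<times> real \<Rightarrow> _)"
      unfolding pole_chart_def by (rule Cinf_smooth_on[of UNIV]) (auto intro!: Cinf_Pair Cinf_fst Cinf_snd Cinf_diff Cinf_power Cinf_inner Cinf_const Cinf_id)
    have "Cinf W ?\<chi>"
      by (intro Cinf_Pair Cinf_mult Cinf_sqrt Cinf_diff Cinf_inner Cinf_fst Cinf_snd Cinf_id Cinf_const oW)
         (simp add: W_def)
    then show "smooth_on (pole_chart ` pole_domain s) ?\<chi>"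
      unfolding img by (rule Cinf_smooth_on) auto
  qed (rule inv)
qed

section \<open>Carrying the charts and the height function over to the manifold\<close>

context smooth_mfd
begin

text \<open>The two smoothness clauses for \<open>f\<close> and \<open>g\<close> are precisely
  compatibility with the charts of the given atlas. The result is a chart of the maximal atlas,
  which is where fold coordinates may be taken from.\<close>

lemma pullback_chart:
  assumes fg: "smooth_map N (closed_disk :: ('m \<times> real, 'm) manifold) f" "smooth_map (closed_disk :: ('m \<times> real, 'm) manifold) N g"
    and gf: "\<And>p. p \<in> X \<Longrightarrow> g (f p) = p" and fg': "\<And>q. q \<in> cball 0 1 \<Longrightarrow> f (g q) = q"
    and c: "(V, \<psi>) \<in> atlas (closed_disk :: ('m \<times> real, 'm) manifold)"
  shows "({x \<in> X. f x \<in> V}, \<psi> \<circ> f) \<in> smooth_charts N"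
proof -
  let ?D = "closed_disk :: ('m \<times> real, 'm) manifold"
  let ?U = "{x \<in> X. f x \<in> V}"
  have mD: "mtop ?D = top_of_set (cball 0 1)" by (simp add: closed_disk_def)
  have ch: "is_chart (top_of_set (cball 0 1)) (V, \<psi>)" using c by (simp add: closed_disk_def)
  have fc: "continuous_map T (top_of_set (cball 0 1)) f" and gc: "continuous_map (top_of_set (cball 0 1)) T g"
    using fg by (auto simp: smooth_map_def mD)
  have fX: "f x \<in> cball 0 1" if "x \<in> X" for x
    using continuous_map_image_subset_topspace[OF fc] that by auto
  have gX: "g q \<in> X" if "q \<in> cball 0 1" for q
    using continuous_map_image_subset_topspace[OF gc] that by auto
  have V1: "V \<subseteq> cball 0 1" using is_chartD(2)[OF ch] by simp
  have oU: "openin T ?U" using fc is_chartD(1)[OF ch] by (auto simp: continuous_map_def)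
  have fU: "f ` ?U = V"
  proof (intro equalityI subsetI)
    fix q assume q: "q \<in> V"
    then have "g q \<in> ?U" "f (g q) = q" using gX[OF subsetD[OF V1 q]] fg'[OF subsetD[OF V1 q]] by auto
    then show "q \<in> f ` ?U" by (metis image_eqI)
  qed auto
  have img: "(\<psi> \<circ> f) ` ?U = \<psi> ` V" unfolding image_comp[symmetric] fU ..
  have "homeomorphic_maps T (top_of_set (cball 0 1)) f g"
    using fc gc gf fg' by (auto simp: homeomorphic_maps_def)
  then have "homeomorphic_map T (top_of_set (cball 0 1)) f" by (rule homeomorphic_maps_map[THEN iffD1, THEN conjunct1])
  then have "homeomorphic_map (subtopology T ?U) (subtopology (top_of_set (cball 0 1)) V) f"
    by (rule homeomorphic_map_subtopologies) (use fU fX V1 in auto)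
  moreover have "homeomorphic_map (subtopology (top_of_set (cball 0 1)) V) (top_of_set (\<psi> ` V)) \<psi>"
    using ch by (simp add: is_chart_def)
  ultimately have "homeomorphic_map (subtopology T ?U) (top_of_set (\<psi> ` V)) (\<psi> \<circ> f)"
    by (rule homeomorphic_map_compose)
  then have chart: "is_chart T (?U, \<psi> \<circ> f)"
    using oU ch unfolding is_chart_def prod.case img by blast
  have "compatible (?U, \<psi> \<circ> f) (U, \<phi>)" if u: "(U, \<phi>) \<in> atlas N" for U \<phi>
  proof -
    have UX: "U \<subseteq> X" using u atlas_smooth_charts chartD(2) by blast
    have "smooth_on (\<phi> ` (U \<inter> f -` V)) (\<psi> \<circ> f \<circ> inv_into U \<phi>)"
      using fg(1) u c unfolding smooth_map_def by blast
    moreover have "U \<inter> f -` V = ?U \<inter> U" using UX by auto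
    ultimately have 1: "smooth_on (\<phi> ` (?U \<inter> U)) (\<psi> \<circ> f \<circ> inv_into U \<phi>)" by simp
    have 2: "smooth_on (\<psi> ` (V \<inter> g -` U)) (\<phi> \<circ> g \<circ> inv_into V \<psi>)"
      using fg(2) u c unfolding smooth_map_def by blast
    have eq: "(\<psi> \<circ> f) ` (?U \<inter> U) = \<psi> ` (V \<inter> g -` U)"
    proof -
      have "f ` (?U \<inter> U) = V \<inter> g -` U"
      proof (intro equalityI subsetI)
        fix q assume q: "q \<in> V \<inter> g -` U"
        then have qV: "q \<in> V" "g q \<in> U" by auto
        then have "g q \<in> ?U \<inter> U" "f (g q) = q" using gX[OF subsetD[OF V1 qV(1)]] fg'[OF subsetD[OF V1 qV(1)]] by auto
        then show "q \<in> f ` (?U \<inter> U)" by (metis image_eqI)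
      next
        fix q assume "q \<in> f ` (?U \<inter> U)"
        then obtain x where "x \<in> X" "f x \<in> V" "x \<in> U" "q = f x" by blast
        then show "q \<in> V \<inter> g -` U" using gf[of x] by simp
      qed
      then show ?thesis by (simp only: image_comp[symmetric])
    qed
    have "smooth_on ((\<psi> \<circ> f) ` (?U \<inter> U)) (\<phi> \<circ> inv_into ?U (\<psi> \<circ> f))"
      unfolding eq
    proof (rule smooth_on_cong[OF 2])
      fix y assume "y \<in> \<psi> ` (V \<inter> g -` U)"
      then obtain x where x: "x \<in> ?U" "x \<in> U" "y = (\<psi> \<circ> f) x" unfolding eq[symmetric] by blast
      have "inv_into ?U (\<psi> \<circ> f) y = x" using is_chartD(5)[OF chart x(1)] x(3) by simp
      moreover have "inv_into V \<psi> y = f x" using is_chartD(5)[OF ch, of "f x"] x(1,3) by simp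
      ultimately show "(\<phi> \<circ> g \<circ> inv_into V \<psi>) y = (\<phi> \<circ> inv_into ?U (\<psi> \<circ> f)) y"
        using gf[of x] x(1) by simp
    qed
    then show ?thesis using 1 by (simp add: compatible_def comp_assoc)
  qed
  then show ?thesis using chart by (auto simp: smooth_charts_def)
qed

end

text \<open>The inverse is \<open>s * sqrt (1 - u)\<close>. The coordinate \<open>1 - t^2\<close>
  vanishes at the height \<open>s\<close> of the pole; it reverses the orientation for
  \<open>s = 1\<close>, where the height is maximal, and preserves it for
  \<open>s = -1\<close>.\<close>

lemma pole_local_coordinates:
  assumes s: "s = 1 \<or> s = - 1"
  shows "local_coordinates {t. 0 < s * t} (\<lambda>t::real. 1 - t\<^sup>2)"
proof -
  have ss: "s * s = 1" using s by auto
  let ?W = "{t. 0 < s * t}" and ?\<psi> = "\<lambda>t::real. 1 - t\<^sup>2"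
  have inv: "s * sqrt (1 - ?\<psi> t) = t" if "t \<in> ?W" for t using s that by auto
  then have inj: "inj_on ?\<psi> ?W" by (rule inj_on_inverseI)
  have img: "?\<psi> ` ?W = {..<1}"
  proof (intro equalityI subsetI)
    fix u :: real assume "u \<in> {..<1}"
    then have u: "0 < sqrt (1 - u)" "(sqrt (1 - u))\<^sup>2 = 1 - u" by auto
    have "(s * sqrt (1 - u))\<^sup>2 = 1 - u" using ss u(2) by (simp add: power_mult_distrib power2_eq_square[of s])
    moreover have "s * sqrt (1 - u) \<in> ?W" using ss u(1) by (simp flip: mult.assoc)
    ultimately show "u \<in> ?\<psi> ` ?W" by (intro image_eqI[of _ _ "s * sqrt (1 - u)"]) auto
  qed auto
  have "Cinf {..<1} (\<lambda>u. s * sqrt (1 - u))"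
    by (intro Cinf_mult Cinf_sqrt Cinf_diff Cinf_const Cinf_id open_lessThan) auto
  then have "smooth_on {..<1} (\<lambda>u. s * sqrt (1 - u))" by (rule Cinf_smooth_on) auto
  then have "smooth_on (?\<psi> ` ?W) (inv_into ?W ?\<psi>)"
    unfolding img
  proof (rule smooth_on_cong)
    fix u :: real assume "u \<in> {..<1}"
    then obtain t where t: "t \<in> ?W" "u = ?\<psi> t" using img by blast
    show "s * sqrt (1 - u) = inv_into ?W ?\<psi> u"
      unfolding t(2) using inv[OF t(1)] inv_into_f_f[OF inj t(1)] by (simp only:)
  qed
  moreover have "smooth_on ?W ?\<psi>"
    by (rule Cinf_smooth_on[of UNIV]) (auto intro!: Cinf_diff Cinf_const Cinf_power Cinf_id)
  moreover have "open ?W" by (intro open_Collect_less continuous_intros)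
  ultimately show ?thesis unfolding local_coordinates_def using inj img by simp
qed

context smooth_mfd
begin

theorem disk_imp_boundary_special_generic:
  assumes "diffeomorphic N (closed_disk :: ('m \<times> real, 'm) manifold)"
  shows "\<exists>F :: 'a \<Rightarrow> real. boundary_special_generic N F"
proof -
  let ?D = "closed_disk :: ('m \<times> real, 'm) manifold"
  have mD: "mtop ?D = top_of_set (cball 0 1)" by (simp add: closed_disk_def)
  obtain f g where fg: "smooth_map N ?D f" "smooth_map ?D N g" and gf: "\<And>p. p \<in> X \<Longrightarrow> g (f p) = p"
    and fg': "\<And>q. q \<in> cball 0 1 \<Longrightarrow> f (g q) = q"
    using assms unfolding diffeomorphic_def mD by auto
  have fX: "f x \<in> cball 0 1" if "x \<in> X" for x
    using fg(1) that unfolding smooth_map_def mD using continuous_map_image_subset_topspace by fastforce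
  note pull = pullback_chart[OF fg gf fg']
  define U' where "U' s = {x \<in> X. f x \<in> cayley_domain s}" for s
  define \<phi>' where "\<phi>' s = (\<lambda>q. cayley (s *\<^sub>R q)) \<circ> f" for s
  have c': "(U' s, \<phi>' s) \<in> smooth_charts N" if "s = 1 \<or> s = - 1" for s
    unfolding U'_def \<phi>'_def by (rule pull[OF _ _ cayley_disk_chart(1)[OF that]])
  have cov: "\<exists>s. (s = 1 \<or> s = - 1) \<and> p \<in> U' s" if p: "p \<in> X" for p
  proof (cases "f p = (0, - 1)")
    case True
    then have "p \<in> U' (- 1)" using p fX[OF p] by (simp add: U'_def cayley_domain_def)
    then show ?thesis by blast
  next
    case False
    then have "p \<in> U' 1" using p fX[OF p] by (simp add: U'_def cayley_domain_def)
    then show ?thesis by blast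
  qed
  have ne: "f x \<noteq> (0, - s)" if "x \<in> U' s" for x s using that by (auto simp: U'_def cayley_domain_def)
  have f: "smooth_in N X f"
    unfolding smooth_in_def
  proof
    fix p assume p: "p \<in> X"
    obtain s where s: "s = 1 \<or> s = - 1" "p \<in> U' s" using cov[OF p] by blast
    have "smooth_in N (U' s) (\<lambda>x. s *\<^sub>R cayley (\<phi>' s x))"
      by (rule smooth_in_chart_compose[OF c'[OF s(1)] smooth_on_cayley_inverse]) (use chartD(4)[OF c'[OF s(1)]] in auto)
    then have "smooth_at N (U' s) (\<lambda>x. s *\<^sub>R cayley (\<phi>' s x)) p" using s(2) by (simp add: smooth_in_def)
    then show "smooth_at N X f p"
      by (rule smooth_at_local[OF _ chartD(1)[OF c'[OF s(1)]] s(2)])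
         (use cayley_inverse[OF s(1) ne] in \<open>auto simp: \<phi>'_def\<close>)
  qed
  have bd: "norm (f p) = 1 \<longleftrightarrow> p \<in> manifold_boundary N" if p: "p \<in> X" for p
  proof -
    obtain s where s: "s = 1 \<or> s = - 1" "p \<in> U' s" using cov[OF p] by blast
    have "p \<in> manifold_boundary N \<longleftrightarrow> snd (\<phi>' s p) = 0" by (rule manifold_boundary_chart[OF c'[OF s(1)] s(2)])
    also have "\<dots> \<longleftrightarrow> norm (s *\<^sub>R f p) = 1"
      unfolding \<phi>'_def comp_def by (rule cayley_half_space(2)[OF cayley_domain_ne[OF s(1) ne[OF s(2)]]])
    finally show ?thesis using s(1) by auto
  qed
  define F where "F x = snd (f x)" for x
  have F: "smooth_in N X F"
    unfolding F_def by (rule smooth_in_compose[OF f Cinf_snd[OF Cinf_id[OF open_UNIV]]]) simp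
  \<comment> \<open>The extension \<open>h\<close> of \<open>f\<close> has a smooth left inverse on
    the half space, the change from a Cayley chart back to \<open>\<phi>\<close>. Derivatives are
    unique there even at boundary points, so the derivative of \<open>h\<close> is injective, and
    surjective since both dimensions agree.\<close>
  have loc: "\<exists>W h. Cinf W h \<and> \<phi> p \<in> W \<and> W \<inter> half_space \<subseteq> \<phi> ` U \<and> (\<forall>x\<in>U. \<phi> x \<in> W \<longrightarrow> h (\<phi> x) = f x) \<and>
      surj (frechet_derivative h (at (\<phi> p)))"
    if c: "(U, \<phi>) \<in> smooth_charts N" "p \<in> U" for U \<phi> p
  proof -
    obtain W h where h: "Cinf W h" "\<phi> p \<in> W" "W \<inter> half_space \<subseteq> \<phi> ` U" "\<And>x. x \<in> U \<Longrightarrow> \<phi> x \<in> W \<Longrightarrow> h (\<phi> x) = f x"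
      using chart_extension[OF c f] by metis
    have "p \<in> X" using chartD(2)[OF c(1)] c(2) by blast
    then obtain s where s: "s = 1 \<or> s = - 1" "p \<in> U' s" using cov by blast
    have "ext_at (U' s) (\<phi>' s) U \<phi> p" by (rule smooth_at_chart[OF smooth_at_chart_map[OF c] c'[OF s(1)] s(2)])
    then obtain W1 \<tau> where t: "Cinf W1 \<tau>" "\<phi>' s p \<in> W1" "\<And>x. x \<in> U \<inter> U' s \<Longrightarrow> \<phi>' s x \<in> W1 \<Longrightarrow> \<tau> (\<phi>' s x) = \<phi> x"
      unfolding ext_at_def by blast
    let ?cs = "\<lambda>q :: 'm \<times> real. cayley (s *\<^sub>R q)"
    define V where "V = (- {(0, - s)}) \<inter> ?cs -` W1"
    have cs: "Cinf (- {(0, - s)}) ?cs" by (rule Cinf_cayley_scale[OF s(1)])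
    have oV: "open V"
      unfolding V_def by (intro continuous_open_preimage Cinf_continuous_on[OF cs] Cinf_open[OF cs] Cinf_open[OF t(1)])
    have k: "Cinf V (\<lambda>q. \<tau> (?cs q))"
      by (rule Cinf_compose[OF Cinf_subset[OF cs oV] t(1)]) (auto simp: V_def)
    obtain W2 where W2: "open W2" "\<phi> ` (U \<inter> U' s) = W2 \<inter> half_space"
      using is_chart_image_open[OF smooth_charts_is_chart[OF c(1)] chartD(1)[OF c'[OF s(1)]]] by blast
    define W' where "W' = (W \<inter> h -` V) \<inter> W2"
    have oW': "open W'"
      unfolding W'_def by (intro open_Int W2(1) continuous_open_preimage Cinf_continuous_on[OF h(1)] Cinf_open[OF h(1)] oV)
    have fV: "f p \<in> V" using ne[OF s(2)] t(2) by (simp add: V_def \<phi>'_def)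
    have pW': "\<phi> p \<in> W' \<inter> half_space"
      using h(2) h(4)[OF c(2) h(2)] fV W2(2) c(2) s(2) by (auto simp: W'_def)
    have kh: "\<tau> (?cs (h y)) = y" if y: "y \<in> W' \<inter> half_space" for y
    proof -
      have "y \<in> \<phi> ` (U \<inter> U' s)" using y W2(2) by (auto simp: W'_def)
      then obtain x where x: "x \<in> U" "x \<in> U' s" "y = \<phi> x" by blast
      have "h y = f x" "h y \<in> V" using y h(4)[OF x(1)] x(3) by (auto simp: W'_def)
      then show ?thesis using t(3)[of x] x by (simp add: V_def \<phi>'_def)
    qed
    let ?h' = "frechet_derivative h (at (\<phi> p))" and ?k' = "frechet_derivative (\<lambda>q. \<tau> (?cs q)) (at (f p))"
    have k': "((\<lambda>q. \<tau> (?cs q)) has_derivative ?k') (at (h (\<phi> p)))"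
      using Cinf_has_derivative[OF k fV] h(4)[OF c(2) h(2)] by simp
    have 1: "((\<lambda>y. \<tau> (?cs (h y))) has_derivative (\<lambda>v. ?k' (?h' v))) (at (\<phi> p) within W' \<inter> half_space)"
      by (rule has_derivative_at_withinI[OF has_derivative_compose[OF Cinf_has_derivative[OF h(1,2)] k']])
    have 2: "((\<lambda>y. \<tau> (?cs (h y))) has_derivative (\<lambda>v. v)) (at (\<phi> p) within W' \<inter> half_space)"
      by (rule has_derivative_transform[OF pW' kh has_derivative_ident])
    have "?k' (?h' v) = v" for v
      using half_space_derivative_unique[OF 1 2 oW' pW'] by metis
    then have "inj ?h'" by (metis injI)
    then have "surj ?h'"
      by (rule linear_injective_imp_surjective[OF has_derivative_linear[OF Cinf_has_derivative[OF h(1,2)]]]) simp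
    then show ?thesis using h by blast
  qed
  have snd_der: "Cinf W (\<lambda>y. snd (h y))" "frechet_derivative (\<lambda>y. snd (h y)) (at y) = (\<lambda>v. snd (frechet_derivative h (at y) v))"
    if "Cinf W h" "y \<in> W" for W y and h :: "'m \<times> real \<Rightarrow> 'm \<times> real"
    using Cinf_snd[OF that(1)] frechet_derivativeI[OF has_derivative_snd[OF Cinf_has_derivative[OF that]]] by auto
  have "submersion N F"
    unfolding submersion_def
  proof (intro conjI ballI, simp add: smooth_fun_smooth_in F, clarify)
    fix U \<phi> p assume u: "(U, \<phi>) \<in> atlas N" "p \<in> U"
    have c: "(U, \<phi>) \<in> smooth_charts N" using u(1) atlas_smooth_charts by blast
    obtain W h where h: "Cinf W h" "\<phi> p \<in> W" "\<forall>x\<in>U. \<phi> x \<in> W \<longrightarrow> h (\<phi> x) = f x" "surj (frechet_derivative h (at (\<phi> p)))"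
      using loc[OF c u(2)] by blast
    have "frechet_derivative (F \<circ> inv_into U \<phi>) (at (\<phi> p) within \<phi> ` U) = frechet_derivative (\<lambda>y. snd (h y)) (at (\<phi> p))"
      by (rule chart_frechet_derivative[OF c u(2) snd_der(1)[OF h(1,2)] h(2)]) (use h(3) in \<open>auto simp: F_def\<close>)
    then have eq: "frechet_derivative (F \<circ> inv_into U \<phi>) (at (\<phi> p) within \<phi> ` U) = (\<lambda>v. snd (frechet_derivative h (at (\<phi> p)) v))"
      using snd_der(2)[OF h(1,2)] by simp
    \<comment> \<open>Surjectivity provides a vector that is mapped to the vertical direction, along
      which the height changes.\<close>
    obtain v where "(0, 1) = frechet_derivative h (at (\<phi> p)) v" using h(4) by (rule surjE)
    then have "snd (frechet_derivative h (at (\<phi> p)) v) \<noteq> 0" by (metis snd_conv zero_neq_one)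
    then show "dim (range (frechet_derivative (F \<circ> inv_into U \<phi>) (at (\<phi> p) within \<phi> ` U))) = DIM(real)"
      unfolding eq DIM_real dim_range_real(1) by (rule exI)
  qed
  moreover have "boundary_definite_fold_point N F p" if sing: "boundary_singular_point N F p" for p
  proof -
    obtain U \<phi> where u: "(U, \<phi>) \<in> atlas N" "p \<in> U" and pb: "p \<in> manifold_boundary N"
      and dim: "dim (range (frechet_derivative (\<lambda>y. F (inv_into U \<phi> (y, 0))) (at (fst (\<phi> p))))) < DIM(real)"
      using sing unfolding boundary_singular_point_def by blast
    have c: "(U, \<phi>) \<in> smooth_charts N" using u(1) atlas_smooth_charts by blast
    have pX: "p \<in> X" using pb manifold_boundary_subset by blast
    have p0: "snd (\<phi> p) = 0" using manifold_boundary_chart[OF c u(2)] pb by blast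
    have fp: "norm (f p) = 1" using bd[OF pX] pb by blast
    obtain W h where h: "Cinf W h" "\<phi> p \<in> W" "W \<inter> half_space \<subseteq> \<phi> ` U" "\<forall>x\<in>U. \<phi> x \<in> W \<longrightarrow> h (\<phi> x) = f x"
        "surj (frechet_derivative h (at (\<phi> p)))"
      using loc[OF c u(2)] by blast
    let ?h' = "frechet_derivative h (at (\<phi> p))"
    have lin: "linear ?h'" using has_derivative_linear[OF Cinf_has_derivative[OF h(1,2)]] .
    have "frechet_derivative (\<lambda>y. F (inv_into U \<phi> (y, 0))) (at (fst (\<phi> p))) = (\<lambda>w. frechet_derivative (\<lambda>y. snd (h y)) (at (\<phi> p)) (w, 0))"
      by (rule chart_boundary_frechet_derivative[OF c u(2) p0 snd_der(1)[OF h(1,2)] h(2)]) (use h(4) in \<open>auto simp: F_def\<close>)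
    \<comment> \<open>Singularity for the height means that the tangent space of the boundary is
      mapped to horizontal vectors.\<close>
    then have s0: "snd (?h' (w, 0)) = 0" for w
      using dim unfolding DIM_real dim_range_real(2) snd_der(2)[OF h(1,2)] by metis
    have snd_h': "snd (?h' v) = snd v * snd (?h' (0, 1))" for v
    proof -
      have "v = (fst v, 0) + snd v *\<^sub>R (0, 1)" by (simp add: prod_eq_iff)
      then have "?h' v = ?h' (fst v, 0) + snd v *\<^sub>R ?h' (0, 1)" using linear_add[OF lin] linear_scale[OF lin] by metis
      then show ?thesis using s0 by simp
    qed
    \<comment> \<open>This function vanishes on the boundary because \<open>f\<close> maps it to the
      sphere, and it is nonnegative inside. Its derivative therefore kills tangential vectors, so
      that their images are orthogonal to \<open>f p\<close>.\<close>
    let ?H = "\<lambda>y. 1 - h y \<bullet> h y"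
    have hz: "\<exists>x\<in>U. z = \<phi> x \<and> h z = f x" if "z \<in> W" "0 \<le> snd z" for z
      using that h(3,4) by (auto simp: half_space_def)
    have H: "Cinf W ?H" by (intro Cinf_diff Cinf_const Cinf_inner h(1) Cinf_open[OF h(1)])
    have H0: "?H z = 0" if z: "z \<in> W" "snd z = 0" for z
    proof -
      obtain x where x: "x \<in> U" "z = \<phi> x" "h z = f x" using hz[of z] z by auto
      then have "x \<in> manifold_boundary N" using manifold_boundary_chart[OF c] z(2) by blast
      then have "norm (f x) = 1" using bd[of x] x(1) chartD(2)[OF c] by blast
      then show ?thesis using x(3) by (simp add: dot_square_norm)
    qed
    have Hn: "0 \<le> ?H z" if z: "z \<in> W" "0 < snd z" for z
    proof -
      obtain x where x: "x \<in> U" "z = \<phi> x" "h z = f x" using hz[of z] z by auto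
      then have "norm (f x) \<le> 1" using fX[of x] chartD(2)[OF c] by auto
      then show ?thesis using x(3) by (simp add: dot_square_norm power_le_one_iff)
    qed
    have "(?H has_derivative (\<lambda>v. - 2 * (h (\<phi> p) \<bullet> ?h' v))) (at (\<phi> p))"
      by (rule has_derivative_eq_rhs[OF has_derivative_diff[OF has_derivative_const
            has_derivative_inner[OF Cinf_has_derivative[OF h(1,2)] Cinf_has_derivative[OF h(1,2)]]]])
         (auto simp: inner_commute)
    then have dH: "frechet_derivative ?H (at (\<phi> p)) = (\<lambda>v. - 2 * (h (\<phi> p) \<bullet> ?h' v))" by (rule frechet_derivativeI)
    have hp: "h (\<phi> p) = f p" using h(2,4) u(2) by blast
    have tan: "f p \<bullet> ?h' v = 0" if "snd v = 0" for v
      using derivative_at_half_space_boundary(1)[OF H h(2) p0 H0 Hn, of v] that unfolding dH hp by simp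
    \<comment> \<open>The preimage of the vertical vector shows that the normal direction has a
      nonzero vertical image. Hence the preimage \<open>v2\<close> of the horizontal vector
      \<open>(fst (f p), 0)\<close> is tangential, and orthogonality to \<open>f p\<close> leaves
      \<open>fst (f p) \<bullet> fst (f p) = 0\<close>. So \<open>f p\<close> is a pole.\<close>
    obtain v1 where v1: "(0, 1) = ?h' v1" using h(5) by (rule surjE)
    obtain v2 where v2: "(fst (f p), 0) = ?h' v2" using h(5) by (rule surjE)
    have "snd v1 * snd (?h' (0, 1)) = 1" using snd_h'[of v1] unfolding v1[symmetric] by simp
    then have "snd (?h' (0, 1)) \<noteq> 0" by auto
    moreover have "snd v2 * snd (?h' (0, 1)) = 0" using snd_h'[of v2] unfolding v2[symmetric] by simp
    ultimately have "snd v2 = 0" by simp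
    then have "f p \<bullet> (fst (f p), 0) = 0" using tan[of v2] unfolding v2 by simp
    then have f1: "fst (f p) = 0" by (simp add: inner_prod_def)
    define s where "s = snd (f p)"
    have "\<bar>s\<bar> = 1" using fp f1 by (simp add: s_def norm_prod_def)
    then have s: "s = 1 \<or> s = - 1" by auto
    have ss: "s * s = 1" using s by auto
    let ?U = "{x \<in> X. f x \<in> pole_domain s}" and ?\<phi> = "pole_chart \<circ> f"
    have cp: "(?U, ?\<phi>) \<in> smooth_charts N" by (rule pull[OF _ _ pole_disk_chart[OF s]])
    have pU: "p \<in> ?U" using pX fX[OF pX] ss by (simp add: pole_domain_def s_def)
    have p\<phi>: "?\<phi> p = 0" using f1 ss by (simp add: pole_chart_def s_def zero_prod_def power2_eq_square)
    obtain b where b: "bij_betw b {1..DIM('m)} (Basis :: 'm set)" using ex_bij_betw_nat_finite_1[OF finite_Basis] by blast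
    have cb: "bij_betw (\<lambda>_. 1) {1..DIM(real)} (Basis :: real set)" by (auto simp: bij_betw_def inj_on_def)
    have norm_b: "(\<Sum>i=DIM(real)..DIM('m). (x \<bullet> b i)\<^sup>2) = x \<bullet> x" for x
      using sum.reindex_bij_betw[OF b, of "\<lambda>i. (x \<bullet> i)\<^sup>2"] euclidean_inner[of x x] by (simp add: power2_eq_square)
    have FW: "F ` ?U \<subseteq> {t. 0 < s * t}" by (auto simp: pole_domain_def F_def)
    \<comment> \<open>The first condition ranges over an empty index set, as
      \<open>DIM(real)\<close> is 1; the second is the definition of \<open>pole_chart\<close>
      rearranged.\<close>
    have "\<forall>q\<in>?U. (\<forall>j\<in>{1..<DIM(real)}. (1 - (F q)\<^sup>2) \<bullet> 1 = fst (?\<phi> q) \<bullet> b j) \<and>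
        (1 - (F q)\<^sup>2) \<bullet> 1 = (\<Sum>i=DIM(real)..DIM('m). (fst (?\<phi> q) \<bullet> b i)\<^sup>2) + snd (?\<phi> q)"
      unfolding norm_b by (simp add: pole_chart_def F_def)
    then show ?thesis
      unfolding boundary_definite_fold_point_def using pb cp pU p\<phi> pole_local_coordinates[OF s] FW b cb
      by (intro conjI exI[of _ ?U] exI[of _ ?\<phi>] exI[of _ "{t. 0 < s * t}"] exI[of _ "\<lambda>t. 1 - t\<^sup>2"] exI[of _ b] exI[of _ "\<lambda>_. 1"])
  qed
  ultimately show ?thesis unfolding boundary_special_generic_def by blast
qed

end

theorem theorem1p1:
  fixes N :: "('a, 'm::euclidean_space) manifold"
  assumes "DIM('m \<times> real) \<ge> 2"
    and "manifold_with_boundary N"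
    and "compact_space (mtop N)"
    and "connected_space (mtop N)"
  shows "(\<exists>F :: 'a \<Rightarrow> real. boundary_special_generic N F) \<longleftrightarrow>
    diffeomorphic N (closed_disk :: ('m \<times> real, 'm) manifold)"
proof -
  interpret compact_mfd N
    using assms(2,3) by unfold_locales (auto simp: manifold_with_boundary_def)
  have "X \<noteq> {}"
    using assms(2) manifold_boundary_subset by (auto simp: manifold_with_boundary_def)
  then show ?thesis
    using boundary_special_generic_imp_disk[OF _ assms(4)] disk_imp_boundary_special_generic by blast
qed

end
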